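(* The theory $\mathsf{PA}^-+\mathsf{Coll}$ has a completion that is axiomatised by a single sentence $\Phi$ plus a set of $\Sigma_1$-sentences.
   Context: The language of arithmetic has signature $\{0,1,+,\times,<\}$. $\mathsf{PA}^-$ is the theory of non-negative parts of discretely ordered commutative rings, axiomatised by (the universal closures of): $(x+y)+z=x+(y+z)$; $x+y=y+x$; $(xy)z=x(yz)$; $xy=yx$; $x(y+z)=xy+xz$; $x+0=x\wedge x\cdot 0=0$; $x\cdot 1=x$; $(x<y\wedge y<z)\to x<z$; $\neg\,x<x$; $x<y\vee x=y\vee y<x$; $x<y\to x+z<y+z$; $(0<z\wedge x<y)\to xz<yz$; $x<y\to\exists z\,(x+z=y)$; $0<1\wedge(0<x\to(x=1\vee 1<x))$; $x=0\vee 0<x$. $\mathsf{Coll}$ is the full collection scheme: for every formula $\varphi$ of the language, with parameters $\vec z$ allowed, $\forall x<v\,\exists y\,\varphi(x,y,\vec z)\to\exists w\,\forall x<v\,\exists y<w\,\varphi(x,y,\vec z)$. A formula is $\Delta_0$ if all its quantifiers are bounded (of the form $\forall y\le x$, $\exists y\le x$). A $\Sigma_1$-formula is a $\Delta_0$-formula prefixed by a (possibly empty) block of existential quantifiers. A completion of a theory $T$ is a consistent complete theory in the same language extending $T$. *)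

theory Defs
  imports Main
begin

text \<open>
  First-order logic with equality over the signature of arithmetic, with de Bruijn indices:
  \<open>Var 0\<close> refers to the innermost enclosing quantifier, and indices exceeding the number of
  enclosing quantifiers are free variables.
\<close>

datatype tm =
    Var nat
  | Zero ("\<^bold>0")
  | One ("\<^bold>1")
  | Add tm tm (infixl "\<^bold>+" 65)
  | Mul tm tm (infixl "\<^bold>*" 70)

datatype fm =
    Bot ("\<^bold>\<bottom>")
  | Eql tm tm (infix "\<^bold>=" 50)
  | Less tm tm (infix "\<^bold><" 50)
  | Imp fm fm (infixr "\<^bold>\<longrightarrow>" 25)
  | Forall fm

abbreviation Neg :: "fm \<Rightarrow> fm" ("\<^bold>\<not> _" [40] 40)
  where "\<^bold>\<not> p \<equiv> p \<^bold>\<longrightarrow> \<^bold>\<bottom>"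

abbreviation Con :: "fm \<Rightarrow> fm \<Rightarrow> fm" (infixr "\<^bold>\<and>" 35)
  where "p \<^bold>\<and> q \<equiv> \<^bold>\<not> (p \<^bold>\<longrightarrow> \<^bold>\<not> q)"

abbreviation Dis :: "fm \<Rightarrow> fm \<Rightarrow> fm" (infixr "\<^bold>\<or>" 30)
  where "p \<^bold>\<or> q \<equiv> \<^bold>\<not> p \<^bold>\<longrightarrow> q"

abbreviation Exists :: "fm \<Rightarrow> fm"
  where "Exists p \<equiv> \<^bold>\<not> Forall (\<^bold>\<not> p)"

abbreviation Leq :: "tm \<Rightarrow> tm \<Rightarrow> fm" (infix "\<^bold>\<le>" 50)
  where "s \<^bold>\<le> t \<equiv> s \<^bold>< t \<^bold>\<or> s \<^bold>= t"

text \<open>Capture-avoiding simultaneous substitution.\<close>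

primrec subst_tm :: "(nat \<Rightarrow> tm) \<Rightarrow> tm \<Rightarrow> tm" where
  "subst_tm \<sigma> (Var n) = \<sigma> n"
| "subst_tm \<sigma> \<^bold>0 = \<^bold>0"
| "subst_tm \<sigma> \<^bold>1 = \<^bold>1"
| "subst_tm \<sigma> (s \<^bold>+ t) = subst_tm \<sigma> s \<^bold>+ subst_tm \<sigma> t"
| "subst_tm \<sigma> (s \<^bold>* t) = subst_tm \<sigma> s \<^bold>* subst_tm \<sigma> t"

definition under_binder :: "(nat \<Rightarrow> tm) \<Rightarrow> nat \<Rightarrow> tm" where
  "under_binder \<sigma> = case_nat (Var 0) (\<lambda>n. subst_tm (\<lambda>m. Var (Suc m)) (\<sigma> n))"

primrec subst_fm :: "(nat \<Rightarrow> tm) \<Rightarrow> fm \<Rightarrow> fm" where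
  "subst_fm \<sigma> \<^bold>\<bottom> = \<^bold>\<bottom>"
| "subst_fm \<sigma> (s \<^bold>= t) = (subst_tm \<sigma> s \<^bold>= subst_tm \<sigma> t)"
| "subst_fm \<sigma> (s \<^bold>< t) = (subst_tm \<sigma> s \<^bold>< subst_tm \<sigma> t)"
| "subst_fm \<sigma> (p \<^bold>\<longrightarrow> q) = (subst_fm \<sigma> p \<^bold>\<longrightarrow> subst_fm \<sigma> q)"
| "subst_fm \<sigma> (Forall p) = Forall (subst_fm (under_binder \<sigma>) p)"

definition shift :: "fm \<Rightarrow> fm" where
  "shift = subst_fm (\<lambda>n. Var (Suc n))"

text \<open>The instance \<open>p(t)\<close> of \<open>Forall p\<close>.\<close>

definition inst :: "fm \<Rightarrow> tm \<Rightarrow> fm" where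
  "inst p t = subst_fm (case_nat t Var) p"

text \<open>The least \<open>n\<close> such that all free variables have index below \<open>n\<close>.\<close>

primrec free_bound_tm :: "tm \<Rightarrow> nat" where
  "free_bound_tm (Var n) = Suc n"
| "free_bound_tm \<^bold>0 = 0"
| "free_bound_tm \<^bold>1 = 0"
| "free_bound_tm (s \<^bold>+ t) = max (free_bound_tm s) (free_bound_tm t)"
| "free_bound_tm (s \<^bold>* t) = max (free_bound_tm s) (free_bound_tm t)"

primrec free_bound :: "fm \<Rightarrow> nat" where
  "free_bound \<^bold>\<bottom> = 0"
| "free_bound (s \<^bold>= t) = max (free_bound_tm s) (free_bound_tm t)"
| "free_bound (s \<^bold>< t) = max (free_bound_tm s) (free_bound_tm t)"
| "free_bound (p \<^bold>\<longrightarrow> q) = max (free_bound p) (free_bound q)"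
| "free_bound (Forall p) = free_bound p - 1"

definition sentence :: "fm \<Rightarrow> bool" where
  "sentence p \<longleftrightarrow> free_bound p = 0"

definition universal_closure :: "fm \<Rightarrow> fm" where
  "universal_closure p = (Forall ^^ free_bound p) p"

text \<open>
  Classical natural deduction with equality. Shifting the hypotheses in \<open>ForallI\<close> expresses the
  eigenvariable condition: \<open>Var 0\<close> is not free in them.
\<close>

inductive derives :: "fm set \<Rightarrow> fm \<Rightarrow> bool" (infix "\<turnstile>" 20) where
  Hyp: "p \<in> \<Gamma> \<Longrightarrow> \<Gamma> \<turnstile> p"
| ImpI: "insert p \<Gamma> \<turnstile> q \<Longrightarrow> \<Gamma> \<turnstile> p \<^bold>\<longrightarrow> q"
| ImpE: "\<Gamma> \<turnstile> p \<^bold>\<longrightarrow> q \<Longrightarrow> \<Gamma> \<turnstile> p \<Longrightarrow> \<Gamma> \<turnstile> q"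
| Contr: "insert (\<^bold>\<not> p) \<Gamma> \<turnstile> \<^bold>\<bottom> \<Longrightarrow> \<Gamma> \<turnstile> p"
| ForallI: "shift ` \<Gamma> \<turnstile> p \<Longrightarrow> \<Gamma> \<turnstile> Forall p"
| ForallE: "\<Gamma> \<turnstile> Forall p \<Longrightarrow> \<Gamma> \<turnstile> inst p t"
| EqlI: "\<Gamma> \<turnstile> t \<^bold>= t"
| EqlE: "\<Gamma> \<turnstile> s \<^bold>= t \<Longrightarrow> \<Gamma> \<turnstile> inst p s \<Longrightarrow> \<Gamma> \<turnstile> inst p t"

definition Th :: "fm set \<Rightarrow> fm set" where
  "Th A = {p. sentence p \<and> (A \<turnstile> p)}"

definition is_theory :: "fm set \<Rightarrow> bool" where
  "is_theory T \<longleftrightarrow> Th T = T"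

definition axiomatised_by :: "fm set \<Rightarrow> fm set \<Rightarrow> bool" where
  "axiomatised_by T A \<longleftrightarrow> (\<forall>p\<in>A. sentence p) \<and> T = Th A"

definition consistent :: "fm set \<Rightarrow> bool" where
  "consistent T \<longleftrightarrow> \<not> (T \<turnstile> \<^bold>\<bottom>)"

definition complete_theory :: "fm set \<Rightarrow> bool" where
  "complete_theory T \<longleftrightarrow> (\<forall>p. sentence p \<longrightarrow> (T \<turnstile> p) \<or> (T \<turnstile> \<^bold>\<not> p))"

definition completion_of :: "fm set \<Rightarrow> fm set \<Rightarrow> bool" where
  "completion_of T U \<longleftrightarrow> is_theory U \<and> consistent U \<and> complete_theory U \<and> T \<subseteq> U"

text \<open>
  Here \<open>Var 0\<close>, \<open>Var 1\<close>, \<open>Var 2\<close> stand for \<open>x\<close>, \<open>y\<close>, \<open>z\<close>; under the existential quantifier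
  in \<open>x < y \<longrightarrow> (\<exists>z. x + z = y)\<close> the indices of \<open>x\<close> and \<open>y\<close> go up by one.
\<close>

definition PA_minus_axioms :: "fm set" where
  "PA_minus_axioms = universal_closure `
    (let x = Var 0; y = Var 1; z = Var 2 in
     {(x \<^bold>+ y) \<^bold>+ z \<^bold>= x \<^bold>+ (y \<^bold>+ z),
      x \<^bold>+ y \<^bold>= y \<^bold>+ x,
      (x \<^bold>* y) \<^bold>* z \<^bold>= x \<^bold>* (y \<^bold>* z),
      x \<^bold>* y \<^bold>= y \<^bold>* x,
      x \<^bold>* (y \<^bold>+ z) \<^bold>= x \<^bold>* y \<^bold>+ x \<^bold>* z,
      x \<^bold>+ \<^bold>0 \<^bold>= x \<^bold>\<and> x \<^bold>* \<^bold>0 \<^bold>= \<^bold>0,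
      x \<^bold>* \<^bold>1 \<^bold>= x,
      x \<^bold>< y \<^bold>\<and> y \<^bold>< z \<^bold>\<longrightarrow> x \<^bold>< z,
      \<^bold>\<not> x \<^bold>< x,
      x \<^bold>< y \<^bold>\<or> x \<^bold>= y \<^bold>\<or> y \<^bold>< x,
      x \<^bold>< y \<^bold>\<longrightarrow> x \<^bold>+ z \<^bold>< y \<^bold>+ z,
      \<^bold>0 \<^bold>< z \<^bold>\<and> x \<^bold>< y \<^bold>\<longrightarrow> x \<^bold>* z \<^bold>< y \<^bold>* z,
      x \<^bold>< y \<^bold>\<longrightarrow> Exists (Var 1 \<^bold>+ Var 0 \<^bold>= Var 2),
      \<^bold>0 \<^bold>< \<^bold>1 \<^bold>\<and> (\<^bold>0 \<^bold>< x \<^bold>\<longrightarrow> x \<^bold>= \<^bold>1 \<^bold>\<or> \<^bold>1 \<^bold>< x),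
      x \<^bold>= \<^bold>0 \<^bold>\<or> \<^bold>0 \<^bold>< x})"

text \<open>
  In \<open>p\<close>, \<open>Var 0\<close> is \<open>y\<close>, \<open>Var 1\<close> is \<open>x\<close> and the variables from index 2 on are the parameters.
  The substitutions make room for the quantified variables that do not occur in \<open>p\<close>: the free
  variable \<open>v\<close> (\<open>Var 0\<close> at the outermost level, hence \<open>Var 2\<close> below \<open>x\<close> and \<open>y\<close>) in the
  hypothesis, and both \<open>w\<close> (\<open>Var 2\<close>) and \<open>v\<close> (\<open>Var 3\<close>) in the conclusion.
\<close>

definition collection :: "fm \<Rightarrow> fm" where
  "collection p =
    (Forall (Var 0 \<^bold>< Var 1 \<^bold>\<longrightarrow>
       Exists (subst_fm (\<lambda>n. Var (if n < 2 then n else n + 1)) p))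
     \<^bold>\<longrightarrow>
     Exists (Forall (Var 0 \<^bold>< Var 2 \<^bold>\<longrightarrow>
       Exists (Var 0 \<^bold>< Var 2 \<^bold>\<and> subst_fm (\<lambda>n. Var (if n < 2 then n else n + 2)) p))))"

definition Coll_axioms :: "fm set" where
  "Coll_axioms = range (\<lambda>p. universal_closure (collection p))"

inductive Delta0 :: "fm \<Rightarrow> bool" where
  "Delta0 \<^bold>\<bottom>"
| "Delta0 (s \<^bold>= t)"
| "Delta0 (s \<^bold>< t)"
| "Delta0 p \<Longrightarrow> Delta0 q \<Longrightarrow> Delta0 (p \<^bold>\<longrightarrow> q)"
| "Delta0 p \<Longrightarrow> Delta0 (Forall (Var 0 \<^bold>\<le> Var (Suc n) \<^bold>\<longrightarrow> p))"
| "Delta0 p \<Longrightarrow> Delta0 (Exists (Var 0 \<^bold>\<le> Var (Suc n) \<^bold>\<and> p))"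

inductive Sigma1 :: "fm \<Rightarrow> bool" where
  "Delta0 p \<Longrightarrow> Sigma1 p"
| "Sigma1 p \<Longrightarrow> Sigma1 (Exists p)"

end

theory Submission
  imports Defs Complex_Main "HOL-Library.Poly_Mapping" "HOL-Library.Countable"
begin

text \<open>
  Let \<open>M\<close> be the non-negative part of \<open>\<int>[X\<^sub>i : i \<in> \<rat>]\<close>, where \<open>X\<^sub>j\<close> exceeds all powers of \<open>X\<^sub>i\<close> for
  \<open>i < j\<close>. Up to terms of lower order the generators are definable by a bounded formula, and so is
  the relation \<open>a \<lless> w\<close> that \<open>w\<close> is a generator whose index exceeds all indices that matter for \<open>a\<close>.
  Order-isomorphisms between finite sets of generators induce a back-and-forth system of partial
  isomorphisms of \<open>M\<close>, and \<open>\<rat>\<close> being dense, for \<open>a \<lless> w\<close> every element can be moved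
  below \<open>w\<close> by a partial isomorphism that fixes \<open>a\<close>. As \<open>M\<close> codes finite sets of its elements by
  divisibility, all this is expressed by a single sentence \<open>\<Phi>\<close>.

  In every model of \<open>\<Phi>\<close> a satisfiable \<open>\<exists>y. \<phi>(a, y)\<close> therefore has a witness below any
  \<open>w\<close> with \<open>a \<lless> w\<close>. This yields collection. It also shows that a sentence is equivalent to the
  \<open>\<Sigma>\<^sub>1\<close>-sentence saying that it holds with its nested quantifiers bounded by
  some \<open>w\<^sub>1 \<lless> w\<^sub>2 \<lless> \<dots>\<close>. Hence \<open>\<Phi>\<close> and the \<open>\<Sigma>\<^sub>1\<close>-sentences true in \<open>M\<close>
  axiomatise the complete theory of \<open>M\<close>.
\<close>

section \<open>Monoid rings over an ordered group\<close>

text \<open>A partial isomorphism is an infinite object, so what is quantified over is a code of its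
  finite set of generator pairs; the graph is recovered through a second code, which lists a
  derivation.

  In \<open>M\<close> these codes stand for finite sets, in other models of \<Phi> they need not.
  Therefore \<Phi> does not try to express finiteness: it asserts, of the defined relations, just
  the extension properties collected in the locale \<open>homogeneous\<close>, and both collection
  and the reduction to bounded formulas are drawn from these alone.

  Subrings and partial maps are treated as one notion, the subring \<open>ring_rel G\<close> of the
  product ring generated by a set of pairs. Normal forms, discreteness and preservation of order
  then come from the same induction: adjoin the highest generator last and write elements in Horner
  form.\<close>

lemma poly_mapping_pos_iff:
  fixes f :: "'a::linorder \<Rightarrow>\<^sub>0 'b::{zero,linorder}"
  shows "0 < f \<longleftrightarrow> (\<exists>k. 0 < Poly_Mapping.lookup f k \<and> (\<forall>k'<k. Poly_Mapping.lookup f k' = 0))"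
  by transfer (auto simp: less_fun_def)

text \<open>The least exponents \<open>a\<close> and \<open>b\<close> carry the leading
  coefficients; only this pair contributes to the coefficient at \<open>a + b\<close>, and nothing
  contributes below it.\<close>

lemma poly_mapping_mult_pos:
  fixes f g :: "'a::linordered_ab_group_add \<Rightarrow>\<^sub>0 'b::linordered_idom"
  assumes "0 < f" "0 < g"
  shows "0 < f * g"
proof -
  obtain a where a: "0 < Poly_Mapping.lookup f a" "\<And>k. k < a \<Longrightarrow> Poly_Mapping.lookup f k = 0"
    using assms(1) by (auto simp: poly_mapping_pos_iff)
  obtain b where b: "0 < Poly_Mapping.lookup g b" "\<And>k. k < b \<Longrightarrow> Poly_Mapping.lookup g k = 0"
    using assms(2) by (auto simp: poly_mapping_pos_iff)
  have zero: "(Poly_Mapping.lookup g q when k = l + q) = 0" if "k < a + b \<or> k = a + b \<and> l \<noteq> a" "\<not> l < a" for k l q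
  proof (cases "k = l + q")
    case True
    have "q < b"
    proof (rule ccontr)
      assume "\<not> q < b"
      with that(2) have *: "a \<le> l" "b \<le> q" by auto
      then have "a + b \<le> k" unfolding True by (rule add_mono)
      with that(1) have "k = a + b" "l \<noteq> a" by auto
      with * have "a + b < l + q" by (intro add_less_le_mono) auto
      with \<open>k = a + b\<close> True show False by simp
    qed
    then show ?thesis by (simp add: b)
  qed simp
  have term0: "Poly_Mapping.lookup f l * (\<Sum>q. Poly_Mapping.lookup g q when k = l + q) = 0"
    if "k < a + b \<or> k = a + b \<and> l \<noteq> a" for k l
  proof (cases "l < a")
    case False
    then have "(\<Sum>q. Poly_Mapping.lookup g q when k = l + q) = (\<Sum>q::'a. 0)"
      by (intro Sum_any.cong zero[OF that])
    then show ?thesis by simp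
  qed (simp add: a)
  have "Poly_Mapping.lookup (f * g) k = 0" if "k < a + b" for k
    unfolding lookup_mult by (subst term0) (use that in simp_all)
  moreover have "Poly_Mapping.lookup (f * g) (a + b) = Poly_Mapping.lookup f a * Poly_Mapping.lookup g b"
  proof -
    have "Poly_Mapping.lookup (f * g) (a + b)
      = (\<Sum>l. (Poly_Mapping.lookup f l * (\<Sum>q. Poly_Mapping.lookup g q when a + b = l + q)) when l = a)"
      unfolding lookup_mult by (rule Sum_any.cong) (use term0 in \<open>auto simp: when_def\<close>)
    also have "\<dots> = Poly_Mapping.lookup f a * (\<Sum>q. Poly_Mapping.lookup g q when a + b = a + q)" by simp
    also have "(\<lambda>q. Poly_Mapping.lookup g q when a + b = a + q) = (\<lambda>q. Poly_Mapping.lookup g q when q = b)"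
      by (auto simp: fun_eq_iff when_def)
    finally show ?thesis by simp
  qed
  ultimately show ?thesis
    using a b by (auto simp: poly_mapping_pos_iff intro!: exI[of _ "a + b"])
qed

instantiation poly_mapping :: (linordered_ab_group_add, linordered_idom) linordered_idom
begin

definition abs_poly_mapping :: "('a \<Rightarrow>\<^sub>0 'b) \<Rightarrow> 'a \<Rightarrow>\<^sub>0 'b" where
  "abs_poly_mapping f = (if f < 0 then - f else f)"

definition sgn_poly_mapping :: "('a \<Rightarrow>\<^sub>0 'b) \<Rightarrow> 'a \<Rightarrow>\<^sub>0 'b" where
  "sgn_poly_mapping f = (if f = 0 then 0 else if 0 < f then 1 else - 1)"

instance
proof
  fix f g h :: "'a \<Rightarrow>\<^sub>0 'b"
  assume "f < g" "0 < h"
  then have "0 < h * (g - f)" by (intro poly_mapping_mult_pos) simp_all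
  then show "h * f < h * g" by (simp add: right_diff_distrib)
qed (auto simp: abs_poly_mapping_def sgn_poly_mapping_def)

end

text \<open>Both lexicographic orders, on exponents and on elements, are decided by the least key.
  Hence the negative exponent makes the generator infinite, and the negated index lets a larger
  \<open>i\<close> dominate.\<close>

definition tower_gen :: "rat \<Rightarrow> (rat \<Rightarrow>\<^sub>0 int) \<Rightarrow>\<^sub>0 int" where
  "tower_gen i = Poly_Mapping.single (Poly_Mapping.single (- i) (- 1)) 1"

lemma tower_gen_power:
  "tower_gen i ^ n = Poly_Mapping.single (Poly_Mapping.single (- i) (- int n)) 1"
  by (induction n) (simp_all add: tower_gen_def mult_single flip: single_add)

text \<open>The difference has its least exponent at the generator, with coefficient 1, however
  large \<open>c\<close> is.\<close>

lemma tower_gen_less: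
  assumes "Poly_Mapping.single (- i) (- 1) < m"
  shows "Poly_Mapping.single m c < tower_gen i"
  using assms unfolding tower_gen_def less_poly_mapping.rep_eq[of "Poly_Mapping.single m c"] less_fun_def
  by (intro exI[of _ "Poly_Mapping.single (- i) (- 1)"]) (auto simp: lookup_single when_def)

lemma tower_gen_gt_power: "i < j \<Longrightarrow> tower_gen i ^ n < tower_gen j"
  unfolding tower_gen_power
  by (rule tower_gen_less)
    (auto simp: less_poly_mapping.rep_eq less_fun_def lookup_single when_def intro!: exI[of _ "- j"])

lemma tower_gen_gt_of_nat: "of_nat n < tower_gen i"
  unfolding single_of_nat[symmetric]
  by (rule tower_gen_less)
    (auto simp: less_poly_mapping.rep_eq less_fun_def lookup_single when_def intro!: exI[of _ "- i"])

section \<open>Subrings generated by a tower of infinite elements\<close>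

text \<open>The subring of the product ring generated by \<open>G\<close>. Diagonal pairs describe
  subrings, other pairs the graph of a candidate partial isomorphism.\<close>

inductive ring_rel :: "('r::comm_ring_1 \<times> 'r) set \<Rightarrow> 'r \<Rightarrow> 'r \<Rightarrow> bool" for G where
  zero: "ring_rel G 0 0"
| one: "ring_rel G 1 1"
| gen: "(g, g') \<in> G \<Longrightarrow> ring_rel G g g'"
| add: "ring_rel G x x' \<Longrightarrow> ring_rel G y y' \<Longrightarrow> ring_rel G (x + y) (x' + y')"
| mult: "ring_rel G x x' \<Longrightarrow> ring_rel G y y' \<Longrightarrow> ring_rel G (x * y) (x' * y')"
| minus: "ring_rel G x x' \<Longrightarrow> ring_rel G (- x) (- x')"

lemma ring_rel_diff: "ring_rel G x x' \<Longrightarrow> ring_rel G y y' \<Longrightarrow> ring_rel G (x - y) (x' - y')"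
  using ring_rel.add[OF _ ring_rel.minus] by (metis add_uminus_conv_diff)

lemma ring_rel_of_nat: "ring_rel G (of_nat n) (of_nat n)"
  by (induction n) (auto intro: ring_rel.intros)

lemma ring_rel_trans:
  assumes "ring_rel G x x'" "\<And>g g'. (g, g') \<in> G \<Longrightarrow> ring_rel G' g g'"
  shows "ring_rel G' x x'"
  using assms(1) by induction (auto intro: ring_rel.intros assms(2))

lemma ring_rel_mono: "ring_rel G x x' \<Longrightarrow> G \<subseteq> G' \<Longrightarrow> ring_rel G' x x'"
  by (erule ring_rel_trans) (auto intro: ring_rel.gen)

lemma ring_rel_converse: "ring_rel G x x' \<Longrightarrow> ring_rel (G\<inverse>) x' x"
  by (induction rule: ring_rel.induct) (auto intro: ring_rel.intros)

lemma ring_rel_Id_on: "ring_rel G x x' \<Longrightarrow> G \<subseteq> Id \<Longrightarrow> x' = x"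
  by (induction rule: ring_rel.induct) auto

lemma ring_rel_finite:
  assumes "ring_rel (f ` A) x x'"
  shows "\<exists>F. finite F \<and> F \<subseteq> A \<and> ring_rel (f ` F) x x'"
  using assms
proof induction
  case (gen g g')
  then obtain a where "a \<in> A" "f a = (g, g')" by auto
  then show ?case by (intro exI[of _ "{a}"]) (auto intro: ring_rel.gen)
next
  case (add x x' y y')
  then obtain F F' where "finite F" "F \<subseteq> A" "ring_rel (f ` F) x x'"
    "finite F'" "F' \<subseteq> A" "ring_rel (f ` F') y y'" by blast
  then show ?case
    by (intro exI[of _ "F \<union> F'"]) (auto intro!: ring_rel.add elim: ring_rel_mono simp: image_Un)
next
  case (mult x x' y y')
  then obtain F F' where "finite F" "F \<subseteq> A" "ring_rel (f ` F) x x'"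
    "finite F'" "F' \<subseteq> A" "ring_rel (f ` F') y y'" by blast
  then show ?case
    by (intro exI[of _ "F \<union> F'"]) (auto intro!: ring_rel.mult elim: ring_rel_mono simp: image_Un)
qed (auto intro: ring_rel.intros)

text \<open>Polynomials in \<open>(c, c')\<close> with coefficients in \<open>S\<close>, in Horner form: this makes the sign of
  \<open>a + c * r\<close> that of \<open>r\<close>, or that of \<open>a\<close> if \<open>r = 0\<close>, when \<open>c\<close> exceeds all coefficients.\<close>

inductive horner :: "'r::comm_ring_1 \<Rightarrow> 'r \<Rightarrow> ('r \<Rightarrow> 'r \<Rightarrow> bool) \<Rightarrow> 'r \<Rightarrow> 'r \<Rightarrow> bool"
  for c c' S where
  base: "S a a' \<Longrightarrow> horner c c' S a a'"
| step: "S a a' \<Longrightarrow> horner c c' S r r' \<Longrightarrow> horner c c' S (a + c * r) (a' + c' * r')"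

lemma horner_mono: "horner c c' S x x' \<Longrightarrow> (\<And>a a'. S a a' \<Longrightarrow> T a a') \<Longrightarrow> horner c c' T x x'"
  by (induction rule: horner.induct) (auto intro: horner.intros)

locale horner_ring =
  fixes c c' :: "'r::comm_ring_1" and S :: "'r \<Rightarrow> 'r \<Rightarrow> bool"
  assumes S_zero: "S 0 0" and S_one: "S 1 1"
    and S_add: "S a a' \<Longrightarrow> S b b' \<Longrightarrow> S (a + b) (a' + b')"
    and S_mult: "S a a' \<Longrightarrow> S b b' \<Longrightarrow> S (a * b) (a' * b')"
    and S_minus: "S a a' \<Longrightarrow> S (- a) (- a')"
begin

abbreviation "P \<equiv> horner c c' S"

lemma horner_gen: "P c c'"
  using horner.step[where c=c and c'=c' and S=S, OF S_zero horner.base, of 1 1] S_one by simp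

lemma horner_add_base: "P x x' \<Longrightarrow> S b b' \<Longrightarrow> P (b + x) (b' + x')"
proof (induction rule: horner.induct)
  case (step a a' r r')
  then show ?case
    using horner.step[where S=S and c=c and c'=c', OF S_add[OF step.prems step.hyps(1)] step.hyps(2)]
    by (simp add: add.assoc)
qed (auto intro: horner.base S_add)

lemma horner_add: "P x x' \<Longrightarrow> P y y' \<Longrightarrow> P (x + y) (x' + y')"
proof (induction arbitrary: y y' rule: horner.induct)
  case (step a a' r r')
  from step.prems show ?case
  proof cases
    case base
    then show ?thesis
      using horner_add_base[OF horner.step[where c=c and c'=c', OF step.hyps]] by (metis add.commute)
  next
    case (step b b' s s')
    have "P (r + s) (r' + s')" using step.IH step by blast
    from horner.step[where c=c and c'=c', OF S_add[OF step.hyps(1) step(3)] this] step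
    show ?thesis by (simp add: algebra_simps)
  qed
qed (rule horner_add_base)

lemma horner_mult_base: "P x x' \<Longrightarrow> S b b' \<Longrightarrow> P (b * x) (b' * x')"
proof (induction rule: horner.induct)
  case (step a a' r r')
  from horner.step[where c=c and c'=c', OF S_mult[OF step.prems step.hyps(1)] step.IH[OF step.prems]]
  show ?case by (simp add: algebra_simps)
qed (auto intro: horner.base S_mult)

lemma horner_mult_gen: "P x x' \<Longrightarrow> P (c * x) (c' * x')"
  using horner.step[where c=c and c'=c' and S=S, OF S_zero] by fastforce

lemma horner_mult: "P x x' \<Longrightarrow> P y y' \<Longrightarrow> P (x * y) (x' * y')"
proof (induction rule: horner.induct)
  case (step a a' r r')
  have "P (a * y + c * (r * y)) (a' * y' + c' * (r' * y'))"
    by (intro horner_add horner_mult_base horner_mult_gen step)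
  then show ?case by (simp add: algebra_simps)
qed (rule horner_mult_base)

lemma horner_minus: "P x x' \<Longrightarrow> P (- x) (- x')"
  using horner_mult_base[OF _ S_minus[OF S_one], of x x'] by simp

end

lemma horner_ring_ring_rel: "horner_ring (ring_rel G)"
  by standard (auto intro: ring_rel.intros)

text \<open>The Horner forms contain the old subring and the new pair and are closed under all
  operations. The later inductions that adjoin the highest generator last rest on this.\<close>

lemma ring_rel_insert:
  assumes "ring_rel (insert (c, c') G) x x'"
  shows "horner c c' (ring_rel G) x x'"
proof -
  interpret horner_ring c c' "ring_rel G" by (rule horner_ring_ring_rel)
  show ?thesis using assms
    by induction (auto intro: horner.base ring_rel.intros horner_add horner_mult horner_minus horner_gen)
qed

locale tower =
  fixes X :: "rat \<Rightarrow> 'r::linordered_idom"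
  assumes X_gt_power: "i < j \<Longrightarrow> X i ^ n < X j"
    and X_gt_of_nat: "of_nat n < X i"
begin

definition XX :: "rat \<Rightarrow> 'r \<times> 'r" where "XX i = (X i, X i)"

text \<open>The ambient ring of the concrete tower contains inverses of the generators, so
  discreteness can only be expected in this subring.\<close>

definition R :: "'r set" where "R = {z. ring_rel (range XX) z z}"

lemma X_gt_numeral: "numeral n < X i"
  using X_gt_of_nat[of "numeral n" i] by simp

lemma X_gt_1: "1 < X i"
  using X_gt_of_nat[of 1 i] by simp

lemma X_pos: "0 < X i"
  using X_gt_of_nat[of 0 i] by simp

lemma X_mono: "i \<le> j \<Longrightarrow> X i \<le> X j"
  using X_gt_power[of i j 1] by (cases "i = j") auto

lemma R_X: "X i \<in> R"
  by (auto simp: R_def XX_def intro!: ring_rel.gen)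

lemma R_add: "x \<in> R \<Longrightarrow> y \<in> R \<Longrightarrow> x + y \<in> R"
  and R_mult: "x \<in> R \<Longrightarrow> y \<in> R \<Longrightarrow> x * y \<in> R"
  and R_minus: "x \<in> R \<Longrightarrow> - x \<in> R"
  and R_diff: "x \<in> R \<Longrightarrow> y \<in> R \<Longrightarrow> x - y \<in> R"
  and R_0: "0 \<in> R" and R_1: "1 \<in> R" and R_of_nat: "of_nat n \<in> R"
  by (auto simp: R_def intro: ring_rel.intros ring_rel_diff ring_rel_of_nat)

lemma R_numeral: "numeral n \<in> R"
  using R_of_nat[of "numeral n"] by simp

lemma R_abs: "x \<in> R \<Longrightarrow> \<bar>x\<bar> \<in> R"
  by (auto simp: abs_if R_minus)

lemmas R_intros = R_X R_add R_mult R_minus R_diff R_0 R_1 R_numeral R_of_nat R_abs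

text \<open>The elements of \<open>low j\<close> are those involving only \<open>X k\<close> with \<open>k < j\<close>.\<close>

definition low :: "rat \<Rightarrow> 'r set" where
  "low j = {z \<in> R. \<exists>k<j. \<exists>n. \<bar>z\<bar> \<le> X k ^ n}"

lemma low_R: "z \<in> low j \<Longrightarrow> z \<in> R"
  by (simp add: low_def)

lemma low_0: "0 \<in> low j" and low_1: "1 \<in> low j"
proof -
  obtain k where "k < j" using lt_ex by blast
  moreover have "\<bar>0\<bar> \<le> X k ^ 0" "\<bar>1\<bar> \<le> X k ^ 0" by simp_all
  ultimately show "0 \<in> low j" "1 \<in> low j" unfolding low_def using R_0 R_1 by blast+
qed

lemma X_power_mono: "k \<le> l \<Longrightarrow> m \<le> n \<Longrightarrow> X k ^ m \<le> X l ^ n"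
proof -
  assume *: "k \<le> l" "m \<le> n"
  have "X k ^ m \<le> X l ^ m" using X_mono[OF *(1)] X_pos[of k] by (intro power_mono) auto
  also have "\<dots> \<le> X l ^ n" using X_gt_1[of l] *(2) by (intro power_increasing) auto
  finally show ?thesis .
qed

lemma low_common:
  assumes "x \<in> low j" "y \<in> low j"
  obtains k n where "k < j" "\<bar>x\<bar> \<le> X k ^ n" "\<bar>y\<bar> \<le> X k ^ n"
proof -
  obtain k n l m where *: "k < j" "\<bar>x\<bar> \<le> X k ^ n" "l < j" "\<bar>y\<bar> \<le> X l ^ m"
    using assms by (auto simp: low_def)
  have "X k ^ n \<le> X (max k l) ^ max n m" "X l ^ m \<le> X (max k l) ^ max n m"
    by (auto intro!: X_power_mono)
  with * show ?thesis by (intro that[of "max k l" "max n m"]) auto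
qed

lemma low_add: assumes "x \<in> low j" "y \<in> low j" shows "x + y \<in> low j"
proof -
  obtain k n where *: "k < j" "\<bar>x\<bar> \<le> X k ^ n" "\<bar>y\<bar> \<le> X k ^ n"
    using assms by (rule low_common)
  have "\<bar>x + y\<bar> \<le> 2 * X k ^ n" using *(2,3) abs_triangle_ineq[of x y] by linarith
  \<comment> \<open>One more factor \<open>X k\<close> absorbs the 2.\<close>
  also have "\<dots> \<le> X k * X k ^ n" using X_gt_numeral[of "num.Bit0 num.One" k] X_pos[of k]
    by (intro mult_right_mono) auto
  finally have "\<bar>x + y\<bar> \<le> X k ^ Suc n" by simp
  with *(1) assms show ?thesis unfolding low_def by (auto intro: R_add simp del: power_Suc)
qed

lemma low_mult: assumes "x \<in> low j" "y \<in> low j" shows "x * y \<in> low j"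
proof -
  obtain k n where *: "k < j" "\<bar>x\<bar> \<le> X k ^ n" "\<bar>y\<bar> \<le> X k ^ n"
    using assms by (rule low_common)
  have "\<bar>x * y\<bar> \<le> X k ^ n * X k ^ n" unfolding abs_mult using * by (intro mult_mono) auto
  then have "\<bar>x * y\<bar> \<le> X k ^ (n + n)" by (simp add: power_add)
  with *(1) assms show ?thesis unfolding low_def by (auto intro: R_mult)
qed

lemma low_minus: "x \<in> low j \<Longrightarrow> - x \<in> low j"
  by (auto simp: low_def R_minus)

lemma low_abs: "x \<in> low j \<Longrightarrow> \<bar>x\<bar> \<in> low j"
  by (auto simp: low_def R_abs)

lemma low_diff: "x \<in> low j \<Longrightarrow> y \<in> low j \<Longrightarrow> x - y \<in> low j"
  using low_add[OF _ low_minus] by (metis add_uminus_conv_diff)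

lemma low_numeral: "numeral n \<in> low j"
proof -
  have "of_nat n \<in> low j" for n by (induction n) (auto intro: low_0 low_1 low_add)
  from this[of "numeral n"] show ?thesis by simp
qed

lemma low_convex: "x \<in> R \<Longrightarrow> \<bar>x\<bar> \<le> \<bar>y\<bar> \<Longrightarrow> y \<in> low j \<Longrightarrow> x \<in> low j"
  by (auto simp: low_def intro: order_trans)

lemma low_less_X: "x \<in> low j \<Longrightarrow> \<bar>x\<bar> < X j"
  using X_gt_power by (auto simp: low_def intro: le_less_trans)

lemma low_X_iff: "X k \<in> low j \<longleftrightarrow> k < j"
proof
  assume "X k \<in> low j"
  then obtain l n where "l < j" "X k \<le> X l ^ n" using X_pos[of k] by (auto simp: low_def)
  then show "k < j" using X_gt_power[of l k n] by (meson leD le_less_trans not_le_imp_less)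
next
  assume "k < j"
  moreover have "\<bar>X k\<bar> \<le> X k ^ 1" using X_pos[of k] by simp
  ultimately show "X k \<in> low j" unfolding low_def using R_X by blast
qed

lemma low_mono: "i \<le> j \<Longrightarrow> x \<in> low i \<Longrightarrow> x \<in> low j"
  unfolding low_def using less_le_trans by blast

lemma low_of_nat: "of_nat n \<in> low j"
  by (induction n) (auto intro: low_0 low_1 low_add)

lemmas low_intros = low_0 low_1 low_add low_mult low_minus low_diff low_abs low_numeral low_of_nat

text \<open>A low \<open>a\<close> cannot cancel \<open>X j\<close>, so \<open>X j + a\<close> alone
  already dominates \<open>b\<close>; multiplying by \<open>r\<close>, of absolute value at least 1,
  does no harm.\<close>

lemma low_lead:
  assumes "a \<in> low j" "b \<in> low j" "r \<noteq> 0" "\<bar>r\<bar> \<ge> 1"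
  shows "\<bar>b\<bar> < \<bar>(X j + a) * r\<bar>"
proof -
  have "\<bar>a\<bar> + \<bar>b\<bar> \<in> low j" by (intro low_intros assms)
  from low_less_X[OF this] have "\<bar>b\<bar> < \<bar>X j + a\<bar>" by linarith
  also have "\<dots> \<le> \<bar>X j + a\<bar> * \<bar>r\<bar>" using assms(4) mult_left_mono[OF assms(4), of "\<bar>X j + a\<bar>"] by simp
  finally show ?thesis by (simp add: abs_mult)
qed

text \<open>If the factor \<open>r\<close> of a Horner step is nonzero, \<open>X j * r\<close>
  exceeds \<open>|a| + 1\<close>; otherwise only a coefficient is left.\<close>

lemma horner_discrete:
  assumes "horner (X j) (X j) S z z'" "\<And>a a'. S a a' \<Longrightarrow> a \<in> low j \<and> (a \<noteq> 0 \<longrightarrow> 1 \<le> \<bar>a\<bar>)"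
  shows "z \<noteq> 0 \<longrightarrow> 1 \<le> \<bar>z\<bar>"
  using assms(1)
proof induction
  case (step a a' r r')
  show ?case
  proof (cases "r = 0")
    case False
    have "\<bar>a\<bar> + 1 \<in> low j" using assms(2) step by (auto intro!: low_intros)
    from low_lead[OF low_0 this False] False step.IH
    have "\<bar>\<bar>a\<bar> + 1\<bar> < \<bar>(X j + 0) * r\<bar>" by blast
    then have "\<bar>a\<bar> + 1 < \<bar>X j * r\<bar>" by simp
    then show ?thesis by linarith
  qed (use assms(2) step in auto)
qed (use assms(2) in auto)

lemma ring_rel_low:
  assumes "ring_rel G x x'" "\<And>g g'. (g, g') \<in> G \<Longrightarrow> g \<in> low j \<and> g' \<in> low j'"
  shows "x \<in> low j \<and> x' \<in> low j'"
  using assms(1) by induction (use assms(2) in \<open>auto intro: low_intros\<close>)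

abbreviation "poly_in j \<equiv> horner (X j) (X j) (\<lambda>a a'. a \<in> low j \<and> a' = a)"

lemma poly_in_same: "poly_in j x x' \<Longrightarrow> x' = x"
  by (induction rule: horner.induct) auto

text \<open>Normal form and discreteness go together: the induction hypothesis makes the
  coefficients discrete, which is what lets the top generator dominate.\<close>

lemma R_cases_aux:
  assumes "finite A" "ring_rel (XX ` A) z z"
  shows "((\<exists>n. z = of_int n) \<or>
      (\<exists>j\<in>A. \<exists>a r. z = a + X j * r \<and> a \<in> low j \<and> poly_in j r r \<and> r \<noteq> 0)) \<and> (z \<noteq> 0 \<longrightarrow> 1 \<le> \<bar>z\<bar>)"
  using assms
proof (induction A arbitrary: z rule: finite_linorder_max_induct)
  case empty
  have "ring_rel {} x x' \<Longrightarrow> \<exists>n. x = of_int n" for x x' :: 'r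
  proof (induction rule: ring_rel.induct)
    case zero show ?case by (metis of_int_0)
  next
    case one show ?case by (metis of_int_1)
  next
    case add then show ?case by (metis of_int_add)
  next
    case mult then show ?case by (metis of_int_mult)
  next
    case minus then show ?case by (metis of_int_minus)
  qed auto
  from this[of z z] empty obtain n where n: "z = of_int n" by auto
  moreover have "1 \<le> \<bar>n\<bar>" if "z \<noteq> 0" using n that by auto
  then have "z \<noteq> 0 \<longrightarrow> 1 \<le> \<bar>z\<bar>" unfolding n
    by (metis of_int_1_le_iff of_int_abs n)
  ultimately show ?case by blast
next
  case (insert j A)
  have low: "a \<in> low j \<and> a' = a \<and> (a \<noteq> 0 \<longrightarrow> 1 \<le> \<bar>a\<bar>)" if "ring_rel (XX ` A) a a'" for a a'
  proof -
    have "a' = a" by (rule ring_rel_Id_on[OF that]) (auto simp: XX_def)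
    moreover have "a \<in> low j"
      using ring_rel_low[OF that, of j j] insert.hyps(2) by (force simp: XX_def low_X_iff)
    ultimately show ?thesis using insert.IH[of a] that by auto
  qed
  have h: "horner (X j) (X j) (ring_rel (XX ` A)) z z"
    using insert.prems by (intro ring_rel_insert) (simp add: XX_def)
  have d: "z \<noteq> 0 \<longrightarrow> 1 \<le> \<bar>z\<bar>" by (rule horner_discrete[OF h]) (use low in blast)
  from h show ?case
  proof cases
    case base
    then show ?thesis using insert.IH[of z] by blast
  next
    case (step a a' r r')
    show ?thesis
    proof (cases "r = 0")
      case True
      then have "z = a" "a' = a" using step(1) low[OF step(3)] by auto
      then have "ring_rel (XX ` A) z z" using step(3) by simp
      then show ?thesis using insert.IH[of z] by blast
    next
      case False
      have "poly_in j r r'" by (rule horner_mono[OF step(4)]) (use low in blast)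
      moreover from this have "r' = r" by (rule poly_in_same)
      ultimately show ?thesis using False step low[OF step(3)] d by blast
    qed
  qed
qed

lemma R_finite: "z \<in> R \<Longrightarrow> \<exists>A. finite A \<and> ring_rel (XX ` A) z z"
  unfolding R_def using ring_rel_finite by blast

lemma R_discrete: "z \<in> R \<Longrightarrow> z \<noteq> 0 \<Longrightarrow> 1 \<le> \<bar>z\<bar>"
  using R_finite R_cases_aux by blast

lemma R_cases:
  assumes "z \<in> R"
  obtains n where "z = of_int n"
  | j a r where "z = a + X j * r" "a \<in> low j" "poly_in j r r" "r \<noteq> 0"
proof -
  obtain A where "finite A" "ring_rel (XX ` A) z z" using R_finite[OF assms] by blast
  from R_cases_aux[OF this] show ?thesis using that by blast
qed

lemma poly_in_R: "poly_in j r r' \<Longrightarrow> r \<in> R"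
  by (induction rule: horner.induct) (auto intro!: R_intros dest: low_R)

lemma low_of_int: "of_int n \<in> low j"
  by (cases n rule: int_cases2) (auto intro!: low_intros)

text \<open>The factor 2 absorbs \<open>a\<close>, which is smaller than half of
  \<open>X j\<close>.\<close>

lemma X_le_2:
  assumes "a \<in> low j" "r \<in> R" "r \<noteq> 0"
  shows "X j < 2 * \<bar>a + X j * r\<bar>"
proof -
  have r: "1 \<le> \<bar>r\<bar>" using R_discrete assms by blast
  have "X j * 1 \<le> X j * \<bar>r\<bar>" using r X_pos[of j] by (intro mult_left_mono) auto
  then have "X j \<le> \<bar>X j * r\<bar>" using X_pos[of j] by (simp add: abs_mult)
  moreover have "2 * \<bar>a\<bar> \<in> low j" by (intro low_intros assms)
  from low_less_X[OF this] have "\<bar>a\<bar> + \<bar>a\<bar> < X j" by simp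
  moreover have "\<bar>X j * r\<bar> \<le> \<bar>a + X j * r\<bar> + \<bar>a\<bar>" using abs_triangle_ineq4[of "a + X j * r" a] by simp
  ultimately show ?thesis unfolding mult_2 by linarith
qed

text \<open>The top generator \<open>X j\<close> of \<open>z\<close> decides: for
  \<open>j < i\<close> all of \<open>z\<close> is low, for \<open>i \<le> j\<close> its size is at
  least about that of \<open>X i\<close>. This gap between \<open>low i\<close> and the rest of
  \<open>R\<close> is what makes lower order definable.\<close>

lemma not_low_imp: assumes "z \<in> R" "z \<notin> low i" shows "X i < 2 * \<bar>z\<bar>"
  using assms(1)
proof (cases rule: R_cases)
  case (1 n)
  then show ?thesis using assms(2) low_of_int by simp
next
  case (2 j a r)
  from 2 have big: "X j < 2 * \<bar>z\<bar>" using X_le_2 poly_in_R by blast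
  show ?thesis
  proof (cases "i \<le> j")
    case True then show ?thesis using big X_mono by (meson le_less_trans)
  next
    case False
    have "poly_in j r r' \<Longrightarrow> r \<in> low i" for r r'
      by (induction rule: horner.induct)
        (use False in \<open>auto intro!: low_intros intro: low_mono[of j] simp: low_X_iff\<close>)
    then have "z \<in> low i" using 2 False
      by (auto intro!: low_intros intro: low_mono[of j] simp: low_X_iff)
    with assms show ?thesis by simp
  qed
qed

end

section \<open>Definability of the generators\<close>

context tower begin

definition M :: "'r set" where "M = {z \<in> R. 0 \<le> z}"

lemma M_D: "z \<in> M \<Longrightarrow> z \<in> R" "z \<in> M \<Longrightarrow> 0 \<le> z"
  by (auto simp: M_def)

lemma M_add: "x \<in> M \<Longrightarrow> y \<in> M \<Longrightarrow> x + y \<in> M"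
  and M_mult: "x \<in> M \<Longrightarrow> y \<in> M \<Longrightarrow> x * y \<in> M"
  and M_0: "0 \<in> M" and M_1: "1 \<in> M"
  by (auto simp: M_def intro: R_intros)

lemma M_diff: "x \<in> M \<Longrightarrow> y \<in> M \<Longrightarrow> y \<le> x \<Longrightarrow> x - y \<in> M"
  by (auto simp: M_def intro: R_intros)

lemma M_X: "X i \<in> M"
  using X_pos[of i] by (auto simp: M_def intro: R_intros)

text \<open>For \<open>c = X i + b\<close> with \<open>b\<close> of lower order, \<open>y * y < c\<close> says that \<open>y\<close> has lower order than \<open>X i\<close>.
  Hence \<open>gen\<close> says that \<open>c\<close> is minimal among the elements of its order, modulo lower order; the
  condition \<open>5 < c\<close> excludes the small integers that accidentally satisfy the rest.\<close>

definition gen :: "'r \<Rightarrow> bool" where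
  "gen c \<longleftrightarrow> c \<in> M \<and> 5 < c \<and> (\<forall>y\<in>M. y \<le> c \<longrightarrow> y * y < c \<or> (c - y) * (c - y) < c)"

definition level :: "'r \<Rightarrow> rat \<Rightarrow> bool" where
  "level c j \<longleftrightarrow> c - X j \<in> low j"

lemma level_R: "level c j \<Longrightarrow> c \<in> R"
  unfolding level_def using R_add[OF low_R R_X, of "c - X j" j j] by simp

lemma level_low_iff: assumes "level c j" shows "c \<in> low k \<longleftrightarrow> j < k"
proof
  assume "j < k"
  then have "(c - X j) + X j \<in> low k"
    using assms by (intro low_add) (auto simp: level_def low_X_iff intro: low_mono[of j])
  then show "c \<in> low k" by simp
next
  assume c: "c \<in> low k"
  show "j < k"
  proof (rule ccontr)
    assume "\<not> j < k"
    then have "c \<in> low j" using low_mono[of k j c] c by simp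
    from low_diff[OF this] assms have "c - (c - X j) \<in> low j" unfolding level_def by blast
    then show False by (simp add: low_X_iff)
  qed
qed

lemma level_unique: "level c j \<Longrightarrow> level c k \<Longrightarrow> j = k"
  using level_low_iff[of c j j] level_low_iff[of c k j] level_low_iff[of c j k] level_low_iff[of c k k]
  by linarith

lemma level_X: "level (X i) i"
  by (simp add: level_def low_0)

lemma level_lead:
  assumes "level c j" "b \<in> low j" "r \<in> R" "r \<noteq> 0"
  shows "\<bar>b\<bar> < \<bar>c * r\<bar>"
  using low_lead[of "c - X j" j b r] assms R_discrete[of r] by (simp add: level_def)

lemma level_less: assumes "level c j" "b \<in> low j" shows "b < c"
proof -
  have "\<bar>b\<bar> + \<bar>c - X j\<bar> \<in> low j"
    using low_add[OF low_abs low_abs, of b j "c - X j"] assms by (simp add: level_def)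
  from low_less_X[OF this] show ?thesis by linarith
qed

text \<open>By the gap, an element that is not low exceeds half of \<open>X j\<close>, so its square
  is above \<open>c\<close>.\<close>

lemma level_sq_less:
  assumes "level c j" "z \<in> M"
  shows "z * z < c \<longleftrightarrow> z \<in> low j"
proof
  assume "z \<in> low j"
  then show "z * z < c" using level_less[OF assms(1) low_mult] by blast
next
  assume *: "z * z < c"
  show "z \<in> low j"
  proof (rule ccontr)
    assume "z \<notin> low j"
    then have z: "X j < 2 * z" using not_low_imp[of z j] assms(2) by (auto simp: M_def)
    have c: "c < 2 * X j" using low_less_X[of "c - X j" j] assms(1) by (auto simp: level_def)
    \<comment> \<open>Half of \<open>X j\<close> squared has to reach \<open>2 * X j\<close>, which
      is above \<open>c\<close>; this takes a factor 8.\<close>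
    have "8 * X j \<le> X j * X j"
      using X_gt_numeral[of "num.Bit0 (num.Bit0 (num.Bit0 num.One))" j] X_pos[of j]
      by (intro mult_right_mono) auto
    also have "\<dots> \<le> (2 * z) * (2 * z)" using z X_pos[of j] by (intro mult_mono) auto
    also have "\<dots> = 4 * (z * z)" by simp
    finally show False using * c X_pos[of j] by linarith
  qed
qed

lemma R_ge_2: "r \<in> R \<Longrightarrow> 0 < r \<Longrightarrow> r \<noteq> 1 \<Longrightarrow> 2 \<le> r"
  using R_discrete[of r] R_discrete[of "r - 1"] R_intros by fastforce

text \<open>If \<open>y \<le> c\<close> is not low, its top generator is \<open>X j\<close> with
  coefficient 1, since a higher generator or another coefficient would leave the interval from 0 to
  \<open>c\<close>. Then \<open>c - y\<close> is low.\<close>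

lemma level_gen: assumes "level c j" shows "gen c"
proof -
  have c5: "5 < c" using level_less[OF assms low_numeral] .
  have cM: "c \<in> M" using level_R[OF assms] c5 by (auto simp: M_def)
  have "(c - y) * (c - y) < c" if y: "y \<in> M" "y \<le> c" "y \<notin> low j" for y
  proof -
    have yR: "y \<in> R" "0 \<le> y" using y by (auto simp: M_def)
    have "c - y \<in> low j"
      using yR(1)
    proof (cases rule: R_cases)
      case (1 n) then show ?thesis using y low_of_int by simp
    next
      case (2 k a r)
      have rR: "r \<in> R" using 2 poly_in_R by blast
      have "X k < 2 * \<bar>y\<bar>" using X_le_2[OF 2(2) rR 2(4)] 2(1) by simp
      then have Xk: "X k < 2 * y" using yR by simp
      have c2: "c < 2 * X j" using low_less_X[of "c - X j" j] assms(1) by (auto simp: level_def)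
      have "k \<le> j"
      proof (rule ccontr)
        assume "\<not> k \<le> j"
        then have "4 * X j \<in> low k" by (auto intro!: low_intros simp: low_X_iff)
        from low_less_X[OF this] have "4 * X j < X k" by simp
        with Xk c2 y(2) show False by linarith
      qed
      moreover have "\<not> k < j"
      proof
        assume kj: "k < j"
        have "poly_in k s s' \<Longrightarrow> s \<in> low j" for s s'
          by (induction rule: horner.induct)
            (use kj in \<open>auto intro!: low_intros intro: low_mono[of k] simp: low_X_iff\<close>)
        then have "y \<in> low j" using 2 kj by (auto intro!: low_intros intro: low_mono[of k] simp: low_X_iff)
        with y show False by simp
      qed
      ultimately have kj: "k = j" by simp
      have "r = 1"
      proof (rule ccontr)
        assume "r \<noteq> 1"
        have "0 < r"
        proof (rule ccontr)
          assume "\<not> 0 < r"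
          then have "r \<le> - 1" using R_discrete[OF rR 2(4)] 2(4) by linarith
          then have "X j * r \<le> X j * (- 1)" using X_pos[of j] by (intro mult_left_mono) auto
          moreover have "a < X j" using low_less_X[of a j] 2(2) kj by simp
          ultimately show False using yR 2(1) kj by simp
        qed
        then have "2 \<le> r" using R_ge_2 rR \<open>r \<noteq> 1\<close> by blast
        then have "X j * 2 \<le> X j * r" using X_pos[of j] by (intro mult_left_mono) auto
        moreover have "(c - X j) - a \<in> low j"
          using low_diff[of "c - X j" j a] assms 2(2) kj by (simp add: level_def)
        from low_less_X[OF this] have "c - X j - a < X j" by simp
        ultimately show False using y(2) 2(1) kj by simp
      qed
      then have "c - y = (c - X j) - a" using 2(1) kj by simp
      moreover have "(c - X j) - a \<in> low j"
        using low_diff[of "c - X j" j a] assms 2(2) kj by (simp add: level_def)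
      ultimately show ?thesis by (simp only:)
    qed
    moreover have "c - y \<in> M" using y cM by (auto intro: M_diff)
    ultimately show ?thesis using level_sq_less[OF assms] by blast
  qed
  then show ?thesis using level_sq_less[OF assms] c5 cM unfolding gen_def by blast
qed

text \<open>Since \<open>y \<le> c - y\<close>, both squares are at least \<open>c\<close>.\<close>

lemma not_gen:
  assumes "y \<in> M" "2 * y \<le> c" "c \<le> y * y" "c \<in> M"
  shows "\<not> gen c"
proof
  assume "gen c"
  have y: "y \<le> c" "0 \<le> y" using assms by (auto simp: M_def)
  then have "(c - y) * (c - y) < c" using assms \<open>gen c\<close> unfolding gen_def by (meson leD)
  moreover have "y * y \<le> (c - y) * (c - y)" using assms y by (intro mult_mono) auto
  ultimately show False using assms by linarith
qed

text \<open>For every other shape of \<open>c\<close> a \<open>y\<close> as in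
  \<open>not_gen\<close> is named: for integers, for \<open>a + X j * r\<close> with a low
  \<open>r\<close> of at least 2, and for the remaining polynomials in \<open>X j\<close>.\<close>

lemma gen_level: assumes "gen c" shows "\<exists>j. level c j"
proof -
  have cM: "c \<in> M" "5 < c" using assms by (auto simp: gen_def)
  then have cR: "c \<in> R" by (simp add: M_def)
  then show ?thesis
  proof (cases rule: R_cases)
    case (1 n)
    \<comment> \<open>Half of the integer, rounded down; from \<open>n = 6\<close> on its square is
      at least \<open>n\<close>.\<close>
    define m where "m = n div 2"
    have "5 < n" using cM unfolding 1 by (metis of_int_less_iff of_int_numeral)
    then have "3 \<le> m" "2 * m \<le> n" "n \<le> 2 * m + 1" unfolding m_def by auto
    moreover from \<open>3 \<le> m\<close> have "3 * m \<le> m * m" by (intro mult_right_mono) auto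
    ultimately have "2 * m \<le> n" "n \<le> m * m" by linarith+
    then have "of_int (2 * m) \<le> c" "c \<le> of_int (m * m)" unfolding 1 using of_int_le_iff by blast+
    moreover have "(of_int m :: 'r) \<in> R" by (rule low_R[OF low_of_int])
    then have "of_int m \<in> M" using \<open>3 \<le> m\<close> by (simp add: M_def)
    ultimately show ?thesis using not_gen[of "of_int m" c] cM assms by simp
  next
    case (2 j a r)
    define Y where "Y = X j"
    have Ybig: "z < Y" "- z < Y" if "z \<in> low j" for z using low_less_X[OF that] Y_def by auto
    have Y: "0 < Y" "Y \<in> R" using X_pos Y_def by (auto intro: R_intros)
    have aR: "a \<in> R" using 2 low_R by blast
    have rR: "r \<in> R" using 2 poly_in_R by blast
    have pos: "0 < s" if "s \<in> R" "s \<noteq> 0" "b \<in> low j" "0 < b + Y * s" for s b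
    proof (rule ccontr)
      assume "\<not> 0 < s"
      then have "s \<le> - 1" using R_discrete[of s] that by linarith
      then have "Y * s \<le> Y * (- 1)" using Y by (intro mult_left_mono) auto
      moreover have "b < Y" using Ybig that by simp
      ultimately show False using that by simp
    qed
    have r0: "0 < r" using pos[OF rR 2(4) 2(2)] 2(1) cM Y_def by simp
    show ?thesis
    proof (cases "r = 1")
      case True
      then have "level c j" using 2(1,2) by (simp add: level_def)
      then show ?thesis ..
    next
      case False
      then have r2: "2 \<le> r" using R_ge_2 rR r0 by blast
      have small: False if rlow: "r \<in> low j"
      proof -
        \<comment> \<open>Subtracting \<open>|a|\<close> keeps \<open>2 * y\<close> below
          \<open>a + 2 * Y\<close>, while \<open>y * y\<close> still dominates \<open>Y * r\<close>
          for low \<open>r\<close>.\<close>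
        define y where "y = Y - \<bar>a\<bar>"
        have yM: "y \<in> M" using Ybig[OF 2(2)] Y aR unfolding y_def
          by (auto simp: M_def intro: R_intros)
        have "Y * 2 \<le> Y * r" using r2 Y by (intro mult_left_mono) auto
        moreover have c: "c = a + Y * r" using 2(1) by (simp only: Y_def)
        ultimately have "2 * y \<le> c"
          using abs_ge_minus_self[of a] abs_ge_zero[of a]
          by (simp only: y_def right_diff_distrib mult_2 mult_2_right)
        moreover have "c \<le> y * y"
        proof -
          have "r + 3 * \<bar>a\<bar> \<in> low j" using rlow 2(2) by (intro low_add low_mult low_numeral low_abs)
          from Ybig(1)[OF this] have "Y * (r + 3 * \<bar>a\<bar>) \<le> Y * Y" using Y by (intro mult_left_mono) auto
          then have "Y * r + \<bar>a\<bar> * Y \<le> Y * Y - 2 * (\<bar>a\<bar> * Y)" by (simp add: algebra_simps)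
          also have "\<dots> \<le> Y * Y - 2 * (\<bar>a\<bar> * Y) + \<bar>a\<bar> * \<bar>a\<bar>" by simp
          also have "\<dots> = y * y" unfolding y_def by (simp add: algebra_simps)
          finally have "Y * r + \<bar>a\<bar> * Y \<le> y * y" .
          moreover have "\<bar>a\<bar> * 1 \<le> \<bar>a\<bar> * Y" using Ybig(1)[OF low_1] by (intro mult_left_mono) auto
          ultimately show ?thesis using abs_ge_self[of a] unfolding c by linarith
        qed
        ultimately show False using not_gen[OF yM] cM assms by blast
      qed
      from 2(3) have False
      proof cases
        case base then show ?thesis using small by simp
      next
        case (step b b' s s')
        show ?thesis
        proof (cases "s = 0")
          case True then show ?thesis using small step by simp
        next
          case s0: False
          have sR: "s \<in> R" using poly_in_R[OF step(4)] .
          have b: "b \<in> low j" "b \<in> R" using step low_R by auto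
          have "0 < s" using pos[OF sR s0 b(1)] r0 step(1) Y_def by simp
          then have s1: "1 \<le> s" using R_discrete[OF sR s0] by simp
          \<comment> \<open>Here \<open>c\<close> has degree at least 2 in \<open>Y\<close>. The
            factor 2 is for the case \<open>s = 1\<close>, where the square of \<open>Y * s\<close>
            could miss the lower terms of \<open>c\<close>.\<close>
          define y where "y = 2 * (Y * s)"
          have yM: "y \<in> M" unfolding y_def using Y sR s1 by (auto simp: M_def intro!: R_intros)
          have c: "c = a + Y * b + Y * Y * s" unfolding 2(1) step(1) Y_def by (simp add: algebra_simps)
          have "5 + \<bar>b\<bar> \<in> low j" using b by (intro low_add low_numeral low_abs)
          then have "5 + \<bar>b\<bar> \<le> Y" using Ybig(1) less_imp_le by blast
          then have Yb: "Y * (5 + \<bar>b\<bar>) \<le> Y * Y" using Y by (intro mult_left_mono) auto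
          have b': "Y * \<bar>b\<bar> = \<bar>Y * b\<bar>" using Y by (simp add: abs_mult)
          have Y4: "4 \<le> Y" using Ybig(1)[OF low_numeral] less_imp_le by blast
          have a: "\<bar>a\<bar> < Y" using Ybig[OF 2(2)] by linarith
          have "(Y * Y - 4 * Y) * 1 \<le> (Y * Y - 4 * Y) * s"
            using s1 Y4 Y by (intro mult_left_mono) (auto intro!: mult_right_mono)
          then have F1: "Y * Y - 4 * Y \<le> Y * Y * s - 4 * (Y * s)"
            by (simp only: left_diff_distrib mult_1_right mult.assoc)
          have F2: "5 * Y + \<bar>Y * b\<bar> \<le> Y * Y" using Yb b' by (simp only: distrib_left mult.commute[of Y 5])
          have y2: "2 * y = 4 * (Y * s)" unfolding y_def by simp
          have "- a \<le> Y" "- (Y * b) \<le> \<bar>Y * b\<bar>" "a \<le> Y" "Y * b \<le> \<bar>Y * b\<bar>" using a by auto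
          note F3 = this
          then have "2 * y \<le> c" using F1 F2 unfolding c y2 by linarith
          moreover have "c \<le> y * y"
          proof -
            have "s * 1 \<le> s * s" using s1 by (intro mult_left_mono) auto
            then have "(Y * Y) * s \<le> (Y * Y) * (s * s)" using Y by (intro mult_left_mono) auto
            moreover have "y * y = 4 * ((Y * Y) * (s * s))" unfolding y_def by (simp add: algebra_simps)
            moreover have "Y * Y * 1 \<le> Y * Y * s" using s1 Y by (intro mult_left_mono) auto
            ultimately show ?thesis using F2 F3 Y(1) unfolding c by linarith
          qed
          ultimately show False using not_gen[OF yM] cM assms by blast
        qed
      qed
      then show ?thesis ..
    qed
  qed
qed

definition lev :: "'r \<Rightarrow> rat" where "lev c = (THE j. level c j)"

lemma lev_eq: "level c j \<Longrightarrow> lev c = j"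
  unfolding lev_def using level_unique by blast

lemma level_lev: "gen c \<Longrightarrow> level c (lev c)"
  using gen_level lev_eq by blast

lemma lev_X: "lev (X i) = i" and gen_X: "gen (X i)"
  using level_X lev_eq level_gen by blast+

text \<open>Thanks to the gap, squares can replace all powers, which makes the relation first-order
  and, like \<open>gen\<close>, expressible with bounded quantifiers.\<close>

definition ll :: "'r \<Rightarrow> 'r \<Rightarrow> bool" where
  "ll a w \<longleftrightarrow> gen w \<and> a * a < w"

lemma gen_M: "gen c \<Longrightarrow> c \<in> M"
  by (simp add: gen_def)

lemma ll_iff_low: "a \<in> M \<Longrightarrow> ll a w \<longleftrightarrow> gen w \<and> a \<in> low (lev w)"
  unfolding ll_def using level_sq_less level_lev by blast

lemma ll_gen_iff: "gen g \<Longrightarrow> ll g h \<longleftrightarrow> gen h \<and> lev g < lev h"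
  using ll_iff_low gen_M level_low_iff level_lev by blast

lemma R_low: assumes "z \<in> R" shows "\<exists>j. z \<in> low j"
proof -
  obtain A where A: "finite A" "ring_rel (XX ` A) z z" using R_finite assms by blast
  define j where "j = Max (insert 0 A) + 1"
  have "i < j" if "i \<in> A" for i using A that unfolding j_def
    by (metis Max_ge finite_insert insertCI less_add_one order_le_less_trans)
  then have "z \<in> low j" using ring_rel_low[OF A(2), of j j] by (force simp: XX_def low_X_iff)
  then show ?thesis by blast
qed

lemma finite_low: assumes "finite S" "S \<subseteq> R" shows "\<exists>j. S \<subseteq> low j"
  using assms
proof (induction rule: finite_induct)
  case (insert x S)
  then obtain j k where "S \<subseteq> low j" "x \<in> low k" using R_low by blast
  then have "insert x S \<subseteq> low (max j k)"
    using low_mono[of j "max j k"] low_mono[of k "max j k"] by auto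
  then show ?case ..
qed simp

end

section \<open>Extending correspondences of generators\<close>

context tower begin

text \<open>Agreement of the order of levels on both sides, phrased with \<open>ll\<close> so that
  it can be expressed inside the model. Distinct pairs are thereby different in both
  components.\<close>

definition apart :: "'r \<times> 'r \<Rightarrow> 'r \<times> 'r \<Rightarrow> bool" where
  "apart p q \<longleftrightarrow> ll (fst p) (fst q) \<and> ll (snd p) (snd q) \<or> ll (fst q) (fst p) \<and> ll (snd q) (snd p) \<or> p = q"

definition compat :: "('r \<times> 'r) set \<Rightarrow> bool" where
  "compat G \<longleftrightarrow> finite G \<and> (\<forall>p\<in>G. gen (fst p) \<and> gen (snd p)) \<and> (\<forall>p\<in>G. \<forall>q\<in>G. apart p q)"

lemma apart_iff:
  assumes "gen (fst p)" "gen (snd p)" "gen (fst q)" "gen (snd q)"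
  shows "apart p q \<longleftrightarrow> lev (fst p) < lev (fst q) \<and> lev (snd p) < lev (snd q) \<or>
    lev (fst q) < lev (fst p) \<and> lev (snd q) < lev (snd p) \<or> p = q"
  unfolding apart_def using assms by (simp add: ll_gen_iff)

lemma apart_converse: "apart (prod.swap p) (prod.swap q) \<longleftrightarrow> apart p q"
  by (cases p; cases q) (auto simp: apart_def)

lemma compat_converse: "compat G \<Longrightarrow> compat (G\<inverse>)"
proof -
  assume G: "compat G"
  have swap: "prod.swap p \<in> G" if "p \<in> G\<inverse>" for p
    using that by (cases p) simp
  show ?thesis unfolding compat_def
  proof (intro conjI ballI)
    fix p assume "p \<in> G\<inverse>"
    from swap[OF this] G show "gen (fst p)" "gen (snd p)" by (auto simp: compat_def)
    fix q assume "q \<in> G\<inverse>"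
    with swap \<open>p \<in> G\<inverse>\<close> G have "apart (prod.swap p) (prod.swap q)" by (simp add: compat_def)
    then show "apart p q" by (simp add: apart_converse)
  qed (use G in \<open>simp add: compat_def\<close>)
qed

lemma compat_subset: "compat G \<Longrightarrow> H \<subseteq> G \<Longrightarrow> compat H"
  unfolding compat_def by (meson finite_subset subsetD)

lemma sgn_add_dominated: "\<bar>a\<bar> < \<bar>b\<bar> \<Longrightarrow> sgn (a + b) = sgn (b::'r)"
  by (auto simp: sgn_if abs_if split: if_splits)

lemma horner_sgn:
  assumes "horner c c' S x x'" "level c j" "level c' j'"
    and S: "\<And>a a'. S a a' \<Longrightarrow> a \<in> low j \<and> a' \<in> low j' \<and> sgn a = sgn a'"
  shows "x \<in> R \<and> x' \<in> R \<and> sgn x = sgn x'"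
  using assms(1)
proof induction
  case (base a a')
  then show ?case using S low_R by blast
next
  case (step a a' r r')
  have a: "a \<in> low j" "a' \<in> low j'" "sgn a = sgn a'" using S step by auto
  then have "a \<in> R" "a' \<in> R" using low_R by auto
  moreover have "c \<in> R" "c' \<in> R" using assms level_R by auto
  ultimately have R: "a + c * r \<in> R" "a' + c' * r' \<in> R" using step.IH by (auto intro: R_add R_mult)
  show ?case
  proof (cases "r = 0")
    case True
    then have "r' = 0" using step.IH by (metis sgn_0_0)
    then show ?thesis using True a R by simp
  next
    case False
    then have "r' \<noteq> 0" using step.IH by (metis sgn_0_0)
    have "sgn (a + c * r) = sgn (c * r)" "sgn (a' + c' * r') = sgn (c' * r')"
      using sgn_add_dominated level_lead assms(2,3) a False \<open>r' \<noteq> 0\<close> step.IH by blast+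
    moreover have "0 < c" "0 < c'" using level_less[OF _ low_0] assms by auto
    ultimately show ?thesis using R step.IH by (simp add: sgn_mult)
  qed
qed

text \<open>Pairs are adjoined by rising level. The new generator dominates all that came before on
  either side, so both signs of a Horner form are decided by corresponding coefficients. Hence
  \<open>G\<close> generates a partial isomorphism of ordered rings.\<close>

lemma ring_rel_sgn:
  assumes "compat G" "ring_rel G x x'"
  shows "x \<in> R \<and> x' \<in> R \<and> sgn x = sgn x'"
proof -
  have "finite G" using assms by (auto simp: compat_def)
  then show ?thesis using assms
  proof (induction G arbitrary: x x' rule: finite_ranking_induct[where f = "\<lambda>p. lev (fst p)"])
    case empty
    have "ring_rel {} y y' \<Longrightarrow> y = y' \<and> y \<in> R" for y y'
      by (induction rule: ring_rel.induct) (auto intro: R_intros)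
    then show ?case using empty by blast
  next
    case (insert p G)
    show ?case
    proof (cases "p \<in> G")
      case True then show ?thesis using insert by (simp add: insert_absorb)
    next
      case False
      obtain c c' where p: "p = (c, c')" by (cases p)
      have cG: "compat G" using insert.prems compat_subset by blast
      have gens: "gen c" "gen c'" using insert.prems p by (auto simp: compat_def)
      have low: "g \<in> low (lev c) \<and> g' \<in> low (lev c')" if "(g, g') \<in> G" for g g'
      proof -
        have gg: "gen g" "gen g'" using that cG by (auto simp: compat_def)
        have "apart (g, g') (c, c')" using insert.prems that p by (auto simp: compat_def)
        moreover have "(g, g') \<noteq> (c, c')" using that False p by auto
        moreover have "lev g \<le> lev c" using insert.hyps that p by fastforce
        ultimately have "lev g < lev c" "lev g' < lev c'" using apart_iff gens gg by auto
        then show ?thesis using level_low_iff level_lev gg by blast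
      qed
      have S: "a \<in> low (lev c) \<and> a' \<in> low (lev c') \<and> sgn a = sgn a'" if "ring_rel G a a'" for a a'
        using ring_rel_low[OF that low] insert.IH[OF cG that] by blast
      have "horner c c' (ring_rel G) x x'" using ring_rel_insert insert.prems p by blast
      then show ?thesis by (rule horner_sgn[OF _ level_lev[OF gens(1)] level_lev[OF gens(2)] S])
    qed
  qed
qed

lemma ring_rel_less_iff:
  assumes "compat G" "ring_rel G x x'" "ring_rel G y y'"
  shows "x < y \<longleftrightarrow> x' < y'" "x = y \<longleftrightarrow> x' = y'"
proof -
  have *: "sgn (y - x) = sgn (y' - x')"
    using ring_rel_sgn[OF assms(1) ring_rel_diff[OF assms(3,2)]] by blast
  have less: "u < v \<longleftrightarrow> sgn (v - u) = 1" for u v :: 'r by (simp add: sgn_1_pos)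
  have eq: "u = v \<longleftrightarrow> sgn (v - u) = 0" for u v :: 'r by (auto simp: sgn_0_0)
  show "x < y \<longleftrightarrow> x' < y'" unfolding less * ..
  show "x = y \<longleftrightarrow> x' = y'" unfolding eq[of x y] eq[of x' y'] * ..
qed

lemma low_support_aux:
  assumes "finite A" "ring_rel (XX ` A) z z" "z \<in> low i"
  shows "\<exists>F\<subseteq>A. F \<subseteq> {..<i} \<and> ring_rel (XX ` F) z z"
  using assms
proof (induction A arbitrary: z rule: finite_linorder_max_induct)
  case empty
  then show ?case by (intro exI[of _ "{}"]) auto
next
  case (insert j A)
  show ?case
  proof (cases "j < i")
    case True
    then have "insert j A \<subseteq> {..<i}" using insert.hyps(2) by force
    then show ?thesis using insert.prems(1) by blast
  next
    case False
    have "horner (X j) (X j) (ring_rel (XX ` A)) z z"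
      using insert.prems by (intro ring_rel_insert) (simp add: XX_def)
    then have "ring_rel (XX ` A) z z"
    proof cases
      case base then show ?thesis .
    next
      case (step a a' r r')
      have id: "v' = v" "v \<in> R" if "ring_rel (XX ` A) v v'" for v v'
      proof -
        show "v' = v" by (rule ring_rel_Id_on[OF that]) (auto simp: XX_def)
        then show "v \<in> R" using that ring_rel_mono[OF that, of "range XX"] by (auto simp: R_def)
      qed
      have hR: "horner (X j) (X j) (ring_rel (XX ` A)) v v' \<Longrightarrow> v \<in> R" for v v'
      proof (induction rule: horner.induct)
        case base then show ?case by (rule id(2))
      next
        case step then show ?case by (intro R_add[OF id(2) R_mult[OF R_X]])
      qed
      have "a \<in> low j"
        using ring_rel_low[OF step(3), of j j] insert.hyps(2) by (force simp: XX_def low_X_iff)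
      have "r = 0"
      proof (rule ccontr)
        assume "r \<noteq> 0"
        from X_le_2[OF \<open>a \<in> low j\<close> hR[OF step(4)] this] have "X j < 2 * \<bar>z\<bar>" using step(1) by simp
        moreover have "2 * \<bar>z\<bar> \<in> low i" using insert.prems(2) by (intro low_mult low_numeral low_abs)
        then have "2 * \<bar>z\<bar> < X i" using low_less_X[of "2 * \<bar>z\<bar>" i] by simp
        moreover have "X i \<le> X j" using False by (intro X_mono) simp
        ultimately show False by linarith
      qed
      then have "z = a" using step(1) by simp
      then show ?thesis using step(3) id by metis
    qed
    from insert.IH[OF this insert.prems(2)] show ?thesis by blast
  qed
qed

lemma low_support:
  assumes "z \<in> low i"
  shows "\<exists>F. finite F \<and> F \<subseteq> {..<i} \<and> ring_rel (XX ` F) z z"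
proof -
  obtain A where A: "finite A" "ring_rel (XX ` A) z z" using R_finite low_R assms by blast
  from low_support_aux[OF this assms] A(1) show ?thesis by (meson finite_subset)
qed

text \<open>A generator \<open>g\<close> of \<open>G\<close> differs from \<open>X i\<close> by a polynomial in the \<open>X k\<close> with \<open>k < i\<close>, so
  that the \<open>X i\<close> are recovered one after the other.\<close>

lemma dom_complete:
  assumes "finite B"
    and G: "\<And>i. i \<in> B \<Longrightarrow> \<exists>g g'. (g, g') \<in> G \<and> ring_rel (XX ` {k\<in>B. k < i}) (g - X i) (g - X i)"
    and z: "ring_rel (XX ` B) z z"
  shows "\<exists>z'. ring_rel G z z'"
proof -
  have dom: "\<exists>v'. ring_rel G v v'"
    if "ring_rel (XX ` C) v u" "\<And>i. i \<in> C \<Longrightarrow> \<exists>x'. ring_rel G (X i) x'" for C v u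
    using that(1)
  proof induction
    case (gen g g')
    then show ?case using that(2) by (auto simp: XX_def)
  qed (blast intro: ring_rel.intros)+
  have "\<exists>x'. ring_rel G (X i) x'" if "i \<in> B" for i
  proof -
    have "card {k\<in>B. k < i} = n \<Longrightarrow> i \<in> B \<Longrightarrow> \<exists>x'. ring_rel G (X i) x'" for n i
    proof (induction n arbitrary: i rule: less_induct)
      case (less n)
      have IH: "\<exists>x'. ring_rel G (X k) x'" if "k \<in> {k\<in>B. k < i}" for k
      proof (rule less.IH[OF _ refl])
        have "{l\<in>B. l < k} \<subset> {l\<in>B. l < i}" using that by force
        then show "card {l\<in>B. l < k} < n"
          unfolding less.prems(1)[symmetric] using \<open>finite B\<close> by (intro psubset_card_mono) auto
      qed (use that in auto)
      obtain g g' where g: "(g, g') \<in> G" "ring_rel (XX ` {k\<in>B. k < i}) (g - X i) (g - X i)"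
        using G less.prems by blast
      obtain v' where "ring_rel G (g - X i) v'" using dom[OF g(2) IH] by blast
      from ring_rel_diff[OF ring_rel.gen[OF g(1)] this] show ?case by auto
    qed
    then show ?thesis using that by blast
  qed
  then show ?thesis using dom[OF z] by blast
qed

lemma compat_insert:
  assumes "compat G" "gen c" "gen c'" "\<And>p. p \<in> G \<Longrightarrow> apart (c, c') p"
  shows "compat (insert (c, c') G)"
  using assms unfolding compat_def apart_def by auto

text \<open>Here the choice of rational indices pays off: every gap can be filled, and there is
  always room at the lower end.\<close>

lemma finite_dense:
  fixes L U :: "rat set"
  assumes "finite L" "finite U" "U \<noteq> {}" "\<And>a b. a \<in> L \<Longrightarrow> b \<in> U \<Longrightarrow> a < b"
  shows "\<exists>j. (\<forall>a\<in>L. a < j) \<and> (\<forall>b\<in>U. j < b)"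
proof (cases "L = {}")
  case True
  have "Min U - 1 < b" if "b \<in> U" for b
    using Min_le[OF assms(2) that] by linarith
  then show ?thesis using True by blast
next
  case False
  then have "Max L < Min U" using assms by simp
  then obtain j where "Max L < j" "j < Min U" using dense by blast
  then show ?thesis using assms False by auto
qed

text \<open>\<open>L\<close> and \<open>U\<close> hold the levels that the new image must exceed and
  stay below; \<open>l\<close> is put into \<open>U\<close> so that the image also remains under a
  prescribed level.\<close>

lemma compat_step:
  assumes "compat G" "\<And>p. p \<in> G \<Longrightarrow> lev (snd p) < l" "\<And>p. p \<in> G \<Longrightarrow> lev (fst p) \<noteq> i"
  shows "\<exists>j<l. compat (insert (X i, X j) G)"
proof -
  define L where "L = (\<lambda>p. lev (snd p)) ` {p\<in>G. lev (fst p) < i}"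
  define U where "U = insert l ((\<lambda>p. lev (snd p)) ` {p\<in>G. i < lev (fst p)})"
  have G: "finite G" "\<And>p. p \<in> G \<Longrightarrow> gen (fst p) \<and> gen (snd p)" "\<And>p q. p \<in> G \<Longrightarrow> q \<in> G \<Longrightarrow> apart p q"
    using assms(1) by (auto simp: compat_def)
  have "\<exists>j. (\<forall>a\<in>L. a < j) \<and> (\<forall>b\<in>U. j < b)"
  proof (rule finite_dense)
    fix a b assume "a \<in> L" "b \<in> U"
    then obtain p where p: "p \<in> G" "lev (fst p) < i" "a = lev (snd p)" by (auto simp: L_def)
    from \<open>b \<in> U\<close> consider "b = l" | q where "q \<in> G" "i < lev (fst q)" "b = lev (snd q)"
      by (auto simp: U_def)
    then show "a < b"
    proof cases
      case 1 then show ?thesis using p assms(2) by simp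
    next
      case 2
      have "apart p q" using G p 2 by blast
      moreover have "lev (fst p) < lev (fst q)" using p 2 by simp
      ultimately show ?thesis using apart_iff[of p q] G(2) p 2 by auto
    qed
  qed (use G(1) in \<open>auto simp: L_def U_def\<close>)
  then obtain j where j: "\<forall>a\<in>L. a < j" "\<forall>b\<in>U. j < b" by blast
  have "apart (X i, X j) p" if p: "p \<in> G" for p
  proof -
    have "lev (fst p) < i \<and> lev (snd p) < j \<or> i < lev (fst p) \<and> j < lev (snd p)"
      using assms(3)[OF p]
    proof (rule linorder_neqE)
      assume "lev (fst p) < i"
      with p have "lev (snd p) \<in> L" unfolding L_def by blast
      with j \<open>lev (fst p) < i\<close> show ?thesis by blast
    next
      assume "i < lev (fst p)"
      with p have "lev (snd p) \<in> U" unfolding U_def by blast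
      with j \<open>i < lev (fst p)\<close> show ?thesis by blast
    qed
    then show ?thesis using apart_iff[of "(X i, X j)" p] G(2)[OF p] by (simp add: lev_X gen_X) blast
  qed
  then have "compat (insert (X i, X j) G)" using compat_insert assms(1) gen_X by blast
  moreover have "j < l" using j by (simp add: U_def)
  ultimately show ?thesis by blast
qed

lemma compat_step_id:
  assumes "compat G" "G \<subseteq> Id" "\<And>p. p \<in> G \<Longrightarrow> lev (fst p) \<noteq> i"
  shows "compat (insert (X i, X i) G)"
proof (rule compat_insert[OF assms(1) gen_X gen_X])
  fix p assume p: "p \<in> G"
  then obtain c where c: "p = (c, c)" using assms(2) by auto
  then have "gen c" "lev c \<noteq> i" using assms(1) assms(3)[OF p] p by (auto simp: compat_def)
  then show "apart (X i, X i) p" unfolding c apart_def by (auto simp: ll_gen_iff lev_X gen_X)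
qed

text \<open>\<open>P\<close> is an invariant chosen by the caller, \<open>I\<close> the set of
  indices at which a step is possible. A level already taken in \<open>G\<close> is skipped, because
  the generator found there stands in for \<open>X i\<close>.\<close>

lemma compat_extend:
  assumes "compat G" "P G" "finite B" "B \<subseteq> I"
    and step: "\<And>G i. compat G \<Longrightarrow> P G \<Longrightarrow> i \<in> I \<Longrightarrow> (\<And>p. p \<in> G \<Longrightarrow> lev (fst p) \<noteq> i) \<Longrightarrow>
      \<exists>j. compat (insert (X i, X j) G) \<and> P (insert (X i, X j) G)"
  shows "\<exists>G'. G \<subseteq> G' \<and> compat G' \<and> P G' \<and> G' \<subseteq> G \<union> {(X k, X l) | k l. True} \<and>
    (\<forall>i\<in>B. (\<exists>p\<in>G. lev (fst p) = i) \<or> (\<exists>j. (X i, X j) \<in> G'))"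
  using assms(3,4)
proof (induction rule: finite_induct)
  case empty
  then show ?case using assms(1,2) by blast
next
  case (insert i B)
  then obtain G' where G': "G \<subseteq> G'" "compat G'" "P G'" "G' \<subseteq> G \<union> {(X k, X l) | k l. True}"
    "\<And>i. i \<in> B \<Longrightarrow> (\<exists>p\<in>G. lev (fst p) = i) \<or> (\<exists>j. (X i, X j) \<in> G')" by auto
  show ?case
  proof (cases "(\<exists>p\<in>G. lev (fst p) = i) \<or> (\<exists>j. (X i, X j) \<in> G')")
    case True
    then show ?thesis using G' by (intro exI[of _ G']) blast
  next
    case False
    show ?thesis
    proof (cases "\<exists>p\<in>G'. lev (fst p) = i")
      case True
      then obtain p where p: "p \<in> G'" "p \<notin> G" "lev (fst p) = i" using False by blast
      then obtain k l where "p = (X k, X l)" using G'(4) by blast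
      then have False using p False by (auto simp: lev_X)
      then show ?thesis ..
    next
      case F2: False
      then obtain j where "compat (insert (X i, X j) G')" "P (insert (X i, X j) G')"
        using step[of G' i] G' insert.prems by blast
      then show ?thesis using G' by (intro exI[of _ "insert (X i, X j) G'"]) blast
    qed
  qed
qed

text \<open>Serves two purposes: moving images below a level (\<open>I = UNIV\<close>) and extending
  the identity below a level (\<open>I = {..<l}\<close>).\<close>

lemma ring_rel_extend:
  assumes G: "compat G" "P G" and y: "y \<in> R" "\<And>l. I = {..<l} \<Longrightarrow> y \<in> low l"
    and I: "I = UNIV \<or> (\<exists>l. I = {..<l} \<and> (\<forall>p\<in>G. lev (fst p) < l))"
    and step: "\<And>G i. compat G \<Longrightarrow> P G \<Longrightarrow> i \<in> I \<Longrightarrow> (\<And>p. p \<in> G \<Longrightarrow> lev (fst p) \<noteq> i) \<Longrightarrow>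
      \<exists>j. compat (insert (X i, X j) G) \<and> P (insert (X i, X j) G)"
  shows "\<exists>G' y'. G \<subseteq> G' \<and> compat G' \<and> P G' \<and> ring_rel G' y y'"
proof -
  have "\<exists>A. finite A \<and> A \<subseteq> I \<and> ring_rel (XX ` A) y y"
    using I
  proof
    assume "I = UNIV" then show ?thesis using R_finite[OF y(1)] by simp
  next
    assume "\<exists>l. I = {..<l} \<and> (\<forall>p\<in>G. lev (fst p) < l)"
    then obtain l where l: "I = {..<l}" by blast
    then show ?thesis using low_support[OF y(2)[OF l]] by simp
  qed
  then obtain A where A: "finite A" "A \<subseteq> I" "ring_rel (XX ` A) y y" by blast
  have gens: "gen (fst p)" if "p \<in> G" for p using G(1) that by (simp add: compat_def)
  have "\<exists>F. finite F \<and> F \<subseteq> {..<lev (fst p)} \<and> ring_rel (XX ` F) (fst p - X (lev (fst p))) (fst p - X (lev (fst p)))"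
    if "p \<in> G" for p
    using level_lev[OF gens[OF that]] low_support unfolding level_def by blast
  then obtain F where F: "\<And>p. p \<in> G \<Longrightarrow> finite (F p)" "\<And>p. p \<in> G \<Longrightarrow> F p \<subseteq> {..<lev (fst p)}"
    "\<And>p. p \<in> G \<Longrightarrow> ring_rel (XX ` F p) (fst p - X (lev (fst p))) (fst p - X (lev (fst p)))"
    by metis
  have lI: "lev (fst p) \<in> I" "F p \<subseteq> I" if "p \<in> G" for p
  proof -
    show "lev (fst p) \<in> I" using I that by blast
    show "F p \<subseteq> I" using I F(2)[OF that] that by (meson UNIV_I lessThan_iff less_trans subset_eq)
  qed
  \<comment> \<open>Besides the indices of \<open>y\<close>, those in the lower-order parts of the
    generators in \<open>G\<close> are included: without them \<open>X i\<close> could not be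
    recovered from the generator of level \<open>i\<close>.\<close>
  define B where "B = A \<union> (\<Union>p\<in>G. F p)"
  have finG: "finite G" using G(1) by (simp add: compat_def)
  have B: "finite B" unfolding B_def using A(1) F(1) finG by blast
  have BI: "B \<subseteq> I" unfolding B_def using A(2) lI(2) by blast
  have "\<exists>G'. G \<subseteq> G' \<and> compat G' \<and> P G' \<and> G' \<subseteq> G \<union> {(X k, X l) | k l. True} \<and>
    (\<forall>i\<in>B. (\<exists>p\<in>G. lev (fst p) = i) \<or> (\<exists>j. (X i, X j) \<in> G'))"
    by (rule compat_extend[where P = P and I = I, OF G B BI]) (rule step)
  then obtain G' where G': "G \<subseteq> G'" "compat G'" "P G'"
    "\<forall>i\<in>B. (\<exists>p\<in>G. lev (fst p) = i) \<or> (\<exists>j. (X i, X j) \<in> G')"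
    by (elim exE conjE)
  have "\<exists>g g'. (g, g') \<in> G' \<and> ring_rel (XX ` {k\<in>B. k < i}) (g - X i) (g - X i)" if i: "i \<in> B" for i
    using G'(4)[rule_format, OF i]
  proof
    assume "\<exists>p\<in>G. lev (fst p) = i"
    then obtain p where p: "p \<in> G" "lev (fst p) = i" by blast
    have "F p \<subseteq> {k\<in>B. k < i}" using F(2)[OF p(1)] p unfolding B_def by auto
    then have "ring_rel (XX ` {k\<in>B. k < i}) (fst p - X i) (fst p - X i)"
      using ring_rel_mono[OF F(3)[OF p(1)]] p(2) by (metis image_mono)
    then show ?thesis using p(1) G'(1) by (metis prod.collapse subsetD)
  next
    assume "\<exists>j. (X i, X j) \<in> G'"
    then obtain j where "(X i, X j) \<in> G'" by blast
    moreover have "ring_rel (XX ` {k\<in>B. k < i}) (X i - X i) (X i - X i)" by (simp add: ring_rel.zero)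
    ultimately show ?thesis by blast
  qed
  from dom_complete[OF B this] have "\<exists>y'. ring_rel G' y y'"
    using ring_rel_mono[OF A(3)] by (simp add: B_def image_mono)
  then show ?thesis using G'(1-3) by blast
qed

lemma move_extend:
  assumes "compat G" "\<And>p. p \<in> G \<Longrightarrow> lev (snd p) < l" "y \<in> R"
  shows "\<exists>G' y'. G \<subseteq> G' \<and> compat G' \<and> ring_rel G' y y' \<and> y' \<in> low l"
proof -
  have "\<exists>G' y'. G \<subseteq> G' \<and> compat G' \<and> (\<forall>p\<in>G'. lev (snd p) < l) \<and> ring_rel G' y y'"
  proof (rule ring_rel_extend[where I = UNIV])
    fix G i assume "compat G" "\<forall>p\<in>G. lev (snd p) < l" "\<And>p. p \<in> G \<Longrightarrow> lev (fst p) \<noteq> i"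
    then obtain j where "j < l" "compat (insert (X i, X j) G)" using compat_step by blast
    then show "\<exists>j. compat (insert (X i, X j) G) \<and> (\<forall>p\<in>insert (X i, X j) G. lev (snd p) < l)"
      using \<open>\<forall>p\<in>G. lev (snd p) < l\<close> by (auto simp: lev_X)
  next
    show "y \<in> low k" if "UNIV = {..<k}" for k
      using that by (metis UNIV_I lessThan_iff less_irrefl)
  qed (use assms in auto)
  then obtain G' y' where G': "G \<subseteq> G'" "compat G'" "\<forall>p\<in>G'. lev (snd p) < l" "ring_rel G' y y'"
    by blast
  have "g' \<in> low l" if "(g, g') \<in> G'" for g g'
    using that G'(2,3) level_low_iff level_lev unfolding compat_def by fastforce
  \<comment> \<open>\<open>ring_rel_low\<close> asks for a level on either side; on this side any
    level above all first components will do.\<close>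
  moreover have "g \<in> low (max l (Max (insert l ((\<lambda>p. lev (fst p)) ` G')) + 1))" if "(g, g') \<in> G'" for g g'
  proof -
    have "gen g" "finite G'" using that G'(2) by (auto simp: compat_def)
    have "lev g \<le> Max (insert l ((\<lambda>p. lev (fst p)) ` G'))"
      using that \<open>finite G'\<close> by (intro Max_ge) force+
    then have "lev g < max l (Max (insert l ((\<lambda>p. lev (fst p)) ` G')) + 1)" by linarith
    then show ?thesis using level_low_iff[OF level_lev[OF \<open>gen g\<close>]] by blast
  qed
  ultimately have "y' \<in> low l" using ring_rel_low[OF G'(4)] by blast
  then show ?thesis using G' by blast
qed

text \<open>A case of moving, with \<open>l\<close> above all images present.\<close>

lemma forth_extend:
  assumes "compat G" "y \<in> R"
  shows "\<exists>G' y'. G \<subseteq> G' \<and> compat G' \<and> ring_rel G' y y'"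
proof -
  define l where "l = Max (insert 0 ((\<lambda>p. lev (snd p)) ` G)) + 1"
  have "lev (snd p) < l" if "p \<in> G" for p
  proof -
    have "lev (snd p) \<le> Max (insert 0 ((\<lambda>p. lev (snd p)) ` G))"
      using that assms(1) by (intro Max_ge) (auto simp: compat_def)
    then show ?thesis by (simp add: l_def)
  qed
  from move_extend[OF assms(1) this assms(2)] show ?thesis by blast
qed

lemma back_extend:
  assumes "compat G" "y' \<in> R"
  shows "\<exists>G' y. G \<subseteq> G' \<and> compat G' \<and> ring_rel G' y y'"
proof -
  obtain G' y where "G\<inverse> \<subseteq> G'" "compat G'" "ring_rel G' y' y"
    using forth_extend[OF compat_converse[OF assms(1)] assms(2)] by blast
  then have "G \<subseteq> G'\<inverse>" "compat (G'\<inverse>)" "ring_rel (G'\<inverse>) y y'"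
    using compat_converse ring_rel_converse by auto
  then show ?thesis by blast
qed

lemma id_extend:
  assumes "compat G" "G \<subseteq> Id" "\<And>p. p \<in> G \<Longrightarrow> lev (fst p) < l" "y \<in> low l"
  shows "\<exists>G'. G \<subseteq> G' \<and> compat G' \<and> G' \<subseteq> Id \<and> (\<forall>p\<in>G'. lev (fst p) < l) \<and> ring_rel G' y y"
proof -
  have "\<exists>G' y'. G \<subseteq> G' \<and> compat G' \<and> (G' \<subseteq> Id \<and> (\<forall>p\<in>G'. lev (fst p) < l)) \<and> ring_rel G' y y'"
  proof (rule ring_rel_extend[where I = "{..<l}"])
    fix G i
    assume *: "compat G" "G \<subseteq> Id \<and> (\<forall>p\<in>G. lev (fst p) < l)" "i \<in> {..<l}"
      "\<And>p. p \<in> G \<Longrightarrow> lev (fst p) \<noteq> i"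
    then have "compat (insert (X i, X i) G)" using compat_step_id by blast
    then show "\<exists>j. compat (insert (X i, X j) G) \<and>
        (insert (X i, X j) G \<subseteq> Id \<and> (\<forall>p\<in>insert (X i, X j) G. lev (fst p) < l))"
      using * by (intro exI[of _ i]) (auto simp: lev_X)
  next
    fix k assume "{..<l} = {..<k}"
    then have "k = l" by (metis lessThan_iff less_irrefl linorder_less_linear)
    then show "y \<in> low k" using assms by simp
  qed (use assms low_R in auto)
  then obtain G' y' where G': "G \<subseteq> G'" "compat G'" "G' \<subseteq> Id" "\<forall>p\<in>G'. lev (fst p) < l" "ring_rel G' y y'"
    by blast
  then have "y' = y" using ring_rel_Id_on by blast
  then show ?thesis using G' by blast
qed

end

section \<open>Coding finite sets\<close>

text \<open>A pairing given by a term: as \<open>x'\<close> is at most \<open>x + x'\<close>, the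
  value lies between the square of \<open>x + x'\<close> and the next square.\<close>

definition pr :: "'r::comm_semiring_1 \<Rightarrow> 'r \<Rightarrow> 'r" where
  "pr x x' = (x + x') * (x + x') + x'"

context tower begin

lemma pr_M: "x \<in> M \<Longrightarrow> x' \<in> M \<Longrightarrow> pr x x' \<in> M"
  by (simp add: pr_def M_add M_mult)

lemma pr_low: "x \<in> low j \<Longrightarrow> x' \<in> low j \<Longrightarrow> pr x x' \<in> low j"
  by (simp add: pr_def low_add low_mult)

lemma pr_inj:
  assumes "x \<in> M" "x' \<in> M" "y \<in> M" "y' \<in> M" "pr x x' = pr y y'"
  shows "x = y \<and> x' = y'"
proof -
  have less: "pr u u' < pr v v'" if "u \<in> M" "u' \<in> M" "v \<in> M" "v' \<in> M" "u + u' < v + v'" for u u' v v'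
  proof -
    define s t where "s = u + u'" and "t = v + v'"
    have "(t - s) \<in> R" "t - s > 0" unfolding s_def t_def using that M_D(1) by (auto intro: R_add R_diff)
    then have st: "s + 1 \<le> t" using R_discrete[of "t - s"] by simp
    have s: "0 \<le> s" "u' \<le> s" "0 \<le> v'" using that by (auto simp: s_def M_def)
    have "(s + 1) * (s + 1) \<le> t * t" using st s by (intro mult_mono) auto
    then have "s * s + 2 * s + 1 \<le> t * t" by (simp add: algebra_simps)
    then show ?thesis using s unfolding pr_def s_def[symmetric] t_def[symmetric] by linarith
  qed
  have "x + x' = y + y'"
    using less[of x x' y y'] less[of y y' x x'] assms by (metis less_irrefl linorder_neqE)
  then show ?thesis using assms(5) by (simp add: pr_def)
qed

text \<open>A finite set is coded by a generator \<open>Y\<close> above its elements and the product \<open>P\<close> of all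
  \<open>Y + pr x x'\<close> with \<open>(x, x')\<close> in the set. Modulo \<open>Y + d\<close>, where \<open>d\<close> is far below \<open>Y\<close>, this product is
  congruent to the product of the \<open>pr x x' - d\<close>, which is too small to be divisible unless it is \<open>0\<close>.
  The last condition in \<open>tame\<close> bounds \<open>P\<close> by a power of \<open>Y\<close>, so that the coded set is finite.\<close>

definition mem :: "'r \<Rightarrow> 'r \<Rightarrow> 'r \<Rightarrow> 'r \<Rightarrow> bool" where
  "mem Y P x x' \<longleftrightarrow> ll x Y \<and> ll x' Y \<and> (\<exists>q\<in>M. (Y + pr x x') * q = P)"

definition tame :: "'r \<Rightarrow> 'r \<Rightarrow> bool" where
  "tame Y P \<longleftrightarrow> gen Y \<and> 0 < P \<and> (\<forall>g\<in>M. ll Y g \<longrightarrow> ll P g)"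

definition code_set :: "'r \<Rightarrow> 'r \<Rightarrow> ('r \<times> 'r) set" where
  "code_set Y P = {(x, x'). x \<in> M \<and> x' \<in> M \<and> mem Y P x x'}"

lemma prod_R: "finite S \<Longrightarrow> (\<And>s. s \<in> S \<Longrightarrow> f s \<in> R) \<Longrightarrow> prod f S \<in> R"
  by (induction rule: finite_induct) (auto intro: R_1 R_mult)

lemma prod_shift:
  assumes "finite S" "Y \<in> R" "d \<in> R" "\<And>s. s \<in> S \<Longrightarrow> f s \<in> R"
  shows "\<exists>q\<in>R. (\<Prod>s\<in>S. Y + f s) = (Y + d) * q + (\<Prod>s\<in>S. f s - d)"
  using assms(1,4)
proof (induction rule: finite_induct)
  case empty
  then show ?case using R_0 by (intro bexI[of _ 0]) auto
next
  case (insert s S)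
  then obtain q where q: "q \<in> R" "(\<Prod>s\<in>S. Y + f s) = (Y + d) * q + (\<Prod>s\<in>S. f s - d)" by auto
  define \<Pi> where "\<Pi> = (\<Prod>s\<in>S. f s - d)"
  have "\<Pi> \<in> R" unfolding \<Pi>_def using insert(1) insert.prems assms(3) by (intro prod_R R_diff) auto
  then have "(Y + f s) * q + \<Pi> \<in> R" using q insert.prems assms by (intro R_add R_mult) auto
  moreover have "(\<Prod>s\<in>insert s S. Y + f s) = (Y + d) * ((Y + f s) * q + \<Pi>) + (\<Prod>s\<in>insert s S. f s - d)"
    using insert(1,2) q(2) by (simp add: \<Pi>_def[symmetric] algebra_simps)
  ultimately show ?case by blast
qed

lemma prod_M: "finite S \<Longrightarrow> (\<And>s. s \<in> S \<Longrightarrow> f s \<in> M) \<Longrightarrow> prod f S \<in> M"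
  by (induction rule: finite_induct) (auto intro: M_1 M_mult)

lemma prod_low: "finite S \<Longrightarrow> (\<And>s. s \<in> S \<Longrightarrow> f s \<in> low j) \<Longrightarrow> prod f S \<in> low j"
  by (induction rule: finite_induct) (auto intro: low_1 low_mult)

lemma code_exists:
  assumes S: "finite S" "S \<subseteq> M \<times> M"
  shows "\<exists>Y\<in>M. \<exists>P\<in>M. tame Y P \<and> code_set Y P = S"
proof -
  have "finite (fst ` S \<union> snd ` S)" "fst ` S \<union> snd ` S \<subseteq> R" using S M_D(1) by auto
  from finite_low[OF this] obtain k where k: "fst ` S \<union> snd ` S \<subseteq> low k" by blast
  define f where "f = (\<lambda>p::'r \<times> 'r. pr (fst p) (snd p))"
  define Y where "Y = X k"
  define P where "P = (\<Prod>p\<in>S. Y + f p)"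
  have f: "f p \<in> M" "f p \<in> low k" "fst p \<in> low k" "snd p \<in> low k" "fst p \<in> M" "snd p \<in> M" if p: "p \<in> S" for p
  proof -
    show *: "fst p \<in> low k" "snd p \<in> low k" "fst p \<in> M" "snd p \<in> M" using k S p by auto
    show "f p \<in> M" "f p \<in> low k" unfolding f_def using pr_M pr_low * by auto
  qed
  have Y: "gen Y" "lev Y = k" "Y \<in> M" unfolding Y_def by (simp_all add: gen_X lev_X M_X)
  have lY: "level Y k" unfolding Y_def by (rule level_X)
  have YfM: "Y + f p \<in> M" if "p \<in> S" for p using M_add[OF Y(3) f(1)[OF that]] .
  then have PM: "P \<in> M" unfolding P_def using S(1) YfM by (intro prod_M)
  have "0 < Y" using X_pos by (simp add: Y_def)
  then have "0 < Y + f p" if "p \<in> S" for p using f(1)[OF that] M_D(2) by (simp add: add_pos_nonneg)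
  then have P0: "0 < P" unfolding P_def by (intro prod_pos) auto
  have "ll P g" if "g \<in> M" "ll Y g" for g
  proof -
    have "gen g" "Y \<in> low (lev g)" using ll_iff_low[OF Y(3)] that by auto
    then have "k < lev g" using level_low_iff[OF lY] by simp
    then have "f p \<in> low (lev g)" if "p \<in> S" for p using f(2)[OF that] low_mono less_imp_le by blast
    then have "P \<in> low (lev g)" unfolding P_def using S(1) \<open>Y \<in> low (lev g)\<close>
      by (intro prod_low low_add)
    then show ?thesis using ll_iff_low[OF PM] \<open>gen g\<close> by blast
  qed
  then have "tame Y P" using Y P0 by (auto simp: tame_def)
  moreover have "code_set Y P = S"
  proof (intro set_eqI iffI)
    fix p assume p: "p \<in> S"
    have "P = (Y + f p) * (\<Prod>q\<in>S - {p}. Y + f q)" unfolding P_def using S p by (simp add: prod.remove)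
    moreover have "(\<Prod>q\<in>S - {p}. Y + f q) \<in> M" using S(1) YfM by (intro prod_M) auto
    moreover have "ll (fst p) Y" "ll (snd p) Y"
      using f(3-6)[OF p] ll_iff_low Y(1,2) by simp_all
    ultimately show "p \<in> code_set Y P" using f(5,6)[OF p] unfolding code_set_def mem_def f_def
      by (simp add: case_prod_beta) metis
  next
    fix p assume "p \<in> code_set Y P"
    then have p: "fst p \<in> M" "snd p \<in> M" "ll (fst p) Y" "ll (snd p) Y" "\<exists>q\<in>M. (Y + f p) * q = P"
      by (auto simp: code_set_def mem_def f_def)
    then obtain q where q: "q \<in> M" "(Y + f p) * q = P" by blast
    have "fst p \<in> low k" "snd p \<in> low k" using p ll_iff_low Y by auto
    then have d: "f p \<in> low k" unfolding f_def by (rule pr_low)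
    obtain r where r: "r \<in> R" "P = (Y + f p) * r + (\<Prod>s\<in>S. f s - f p)"
      unfolding P_def using prod_shift[OF S(1), of Y "f p" f] Y(3) f(1) M_D(1) low_R[OF d] by blast
    have \<Pi>: "(\<Prod>s\<in>S. f s - f p) \<in> low k" using S(1) f(2) d by (intro prod_low low_diff)
    have eq: "(Y + f p) * (q - r) = (\<Prod>s\<in>S. f s - f p)" using q(2) r(2) by (simp add: algebra_simps)
    have lev: "level (Y + f p) k" using d unfolding level_def Y_def by simp
    have "q - r = 0"
    proof (rule ccontr)
      assume "q - r \<noteq> 0"
      from level_lead[OF lev \<Pi> _ this] show False using eq q(1) r(1) M_D(1) R_diff by auto
    qed
    then have "(\<Prod>s\<in>S. f s - f p) = 0" using eq by simp
    then obtain s where s: "s \<in> S" "f s = f p" using S(1) by auto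
    then have "s = p" using pr_inj[of "fst s" "snd s" "fst p" "snd p"] f(5,6)[OF s(1)] p unfolding f_def
      by (simp add: prod_eq_iff)
    then show "p \<in> S" using s by simp
  qed
  ultimately show ?thesis using Y(3) PM by blast
qed

text \<open>Dividing by one factor \<open>Y + d1\<close> lowers the exponent \<open>n\<close>, but
  the other \<open>Y + d\<close> remain divisors only up to the low multiplier
  \<open>d1 - d\<close>. For this reason multipliers \<epsilon> are carried along, and
  \<open>e\<close> absorbs their size.\<close>

lemma finite_divisors_aux:
  assumes Y: "level Y j"
  shows "Q \<in> R \<Longrightarrow> Q \<noteq> 0 \<Longrightarrow> e \<in> low j \<Longrightarrow> \<bar>Q\<bar> \<le> e * X j ^ n \<Longrightarrow> finite D \<Longrightarrow> D \<subseteq> low j \<inter> M \<Longrightarrow>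
    (\<And>d. d \<in> D \<Longrightarrow> \<exists>\<epsilon>\<in>low j. \<epsilon> \<noteq> 0 \<and> (\<exists>q\<in>R. (Y + d) * q = \<epsilon> * Q)) \<Longrightarrow> card D \<le> n"
proof (induction n arbitrary: Q e D)
  case 0
  have "Q \<in> low j" by (rule low_convex[OF 0(1) _ 0(3)]) (use 0(4) in auto)
  have "d \<notin> D" for d
  proof
    assume d: "d \<in> D"
    obtain \<epsilon> q where \<epsilon>: "\<epsilon> \<in> low j" "\<epsilon> \<noteq> 0" "q \<in> R" "(Y + d) * q = \<epsilon> * Q" using 0(7)[OF d] by blast
    have "d \<in> low j" using 0(6) d by blast
    then have "level (Y + d) j" using Y low_add[of "Y - X j" j d] unfolding level_def
      by (simp add: algebra_simps)
    moreover have "q \<noteq> 0" using \<epsilon> 0(2) by auto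
    ultimately have "\<bar>\<epsilon> * Q\<bar> < \<bar>(Y + d) * q\<bar>"
      using level_lead low_mult[OF \<epsilon>(1) \<open>Q \<in> low j\<close>] \<epsilon>(3) by blast
    then show False using \<epsilon>(4) by simp
  qed
  then have "D = {}" by blast
  then show ?case by simp
next
  case (Suc n)
  show ?case
  proof (cases "D = {}")
    case False
    then obtain d1 where d1: "d1 \<in> D" by blast
    obtain \<epsilon>1 Q1 where e1: "\<epsilon>1 \<in> low j" "\<epsilon>1 \<noteq> 0" "Q1 \<in> R" "(Y + d1) * Q1 = \<epsilon>1 * Q"
      using Suc.prems(7)[OF d1] by blast
    have Q1: "Q1 \<noteq> 0" using e1 Suc.prems(2) by auto
    have d1l: "d1 \<in> low j" "0 \<le> d1" using Suc.prems(6) d1 M_D(2) by auto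
    have "X j \<le> 2 * (Y + d1)"
    proof -
      have "\<bar>2 * (Y - X j)\<bar> < X j"
        using Y low_less_X[OF low_mult[OF low_numeral]] unfolding level_def by blast
      then have "- (2 * Y - 2 * X j) < X j" unfolding right_diff_distrib by linarith
      then show ?thesis using d1l(2) by simp
    qed
    then have "X j * \<bar>Q1\<bar> \<le> 2 * (Y + d1) * \<bar>Q1\<bar>" by (intro mult_right_mono) auto
    also have "\<dots> = 2 * (\<bar>\<epsilon>1\<bar> * \<bar>Q\<bar>)"
    proof -
      have "0 < 2 * (Y + d1)" using less_le_trans[OF X_pos \<open>X j \<le> 2 * (Y + d1)\<close>] .
      then have "0 < Y + d1" by (simp only: zero_less_mult_iff) auto
      then have "(Y + d1) * \<bar>Q1\<bar> = \<bar>(Y + d1) * Q1\<bar>" by (simp only: abs_mult abs_of_pos)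
      then have "(Y + d1) * \<bar>Q1\<bar> = \<bar>\<epsilon>1\<bar> * \<bar>Q\<bar>" by (simp only: e1(4) abs_mult)
      then show ?thesis by (simp only: mult.assoc)
    qed
    also have "\<dots> \<le> 2 * (\<bar>\<epsilon>1\<bar> * (e * X j ^ Suc n))"
      using Suc.prems(4) by (intro mult_left_mono) auto
    also have "\<dots> = X j * (2 * \<bar>\<epsilon>1\<bar> * e * X j ^ n)" by (simp add: algebra_simps)
    finally have bound: "\<bar>Q1\<bar> \<le> 2 * \<bar>\<epsilon>1\<bar> * e * X j ^ n" using X_pos[of j] by simp
    have "card (D - {d1}) \<le> n"
    proof (rule Suc.IH[OF e1(3) Q1 _ bound])
      show "2 * \<bar>\<epsilon>1\<bar> * e \<in> low j" using e1(1) Suc.prems(3) by (intro low_mult low_numeral low_abs)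
      show "finite (D - {d1})" "D - {d1} \<subseteq> low j \<inter> M" using Suc.prems(5,6) by auto
      fix d assume d: "d \<in> D - {d1}"
      then obtain \<epsilon> q where e: "\<epsilon> \<in> low j" "\<epsilon> \<noteq> 0" "q \<in> R" "(Y + d) * q = \<epsilon> * Q"
        using Suc.prems(7)[of d] by blast
      have dl: "d \<in> low j" using Suc.prems(6) d by blast
      have "\<epsilon> * (d1 - d) \<in> low j" using e(1) dl d1l(1) by (intro low_mult low_diff)
      moreover have "\<epsilon> * (d1 - d) \<noteq> 0" using e(2) d by simp
      moreover have "\<epsilon>1 * q - \<epsilon> * Q1 \<in> R" using low_R e1 e by (intro R_diff R_mult) auto
      \<comment> \<open>Eliminates \<open>Q\<close> from the divisibility equations for
        \<open>d\<close> and \<open>d1\<close>.\<close>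
      moreover have "(Y + d) * (\<epsilon>1 * q - \<epsilon> * Q1) = \<epsilon> * (d1 - d) * Q1"
      proof -
        have "(Y + d) * (\<epsilon>1 * q) = \<epsilon>1 * (\<epsilon> * Q)" using e(4) by (metis mult.left_commute)
        also have "\<dots> = \<epsilon> * ((Y + d1) * Q1)" using e1(4) by (metis mult.left_commute)
        finally show ?thesis by (simp add: algebra_simps)
      qed
      ultimately show "\<exists>\<epsilon>\<in>low j. \<epsilon> \<noteq> 0 \<and> (\<exists>q\<in>R. (Y + d) * q = \<epsilon> * Q1)" by blast
    qed
    then show ?thesis using d1 Suc.prems(5) by (simp add: card_Diff_singleton)
  qed simp
qed

text \<open>The top generator of \<open>P\<close> has index at most \<open>j\<close>: otherwise
  \<open>P\<close> would exceed half of it and yet lie in \<open>low k\<close> for some smaller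
  \<open>k\<close> above \<open>j\<close>.\<close>

lemma power_bound:
  assumes "P \<in> R" "\<And>k. j < k \<Longrightarrow> P \<in> low k"
  shows "\<exists>n. \<bar>P\<bar> \<le> X j ^ n"
  using assms(1)
proof (cases rule: R_cases)
  case (1 n)
  then have "\<bar>P\<bar> < X j ^ 1" using low_less_X[OF low_of_int] by simp
  then show ?thesis using less_imp_le by blast
next
  case (2 i a r)
  have "i \<le> j"
  proof (rule ccontr)
    assume "\<not> i \<le> j"
    then have "j < i" by simp
    then obtain k where k: "j < k" "k < i" using dense[of j i] by blast
    have "X i < 2 * \<bar>P\<bar>" using X_le_2[OF 2(2) poly_in_R[OF 2(3)] 2(4)] 2(1) by simp
    moreover have "2 * \<bar>P\<bar> \<in> low k" using assms(2)[OF k(1)] by (intro low_mult low_numeral low_abs)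
    from low_less_X[OF this] have "2 * \<bar>P\<bar> < X k" by simp
    moreover have "X k \<le> X i" using k by (intro X_mono) simp
    ultimately show False by linarith
  qed
  have lowb: "\<exists>n. \<bar>b\<bar> \<le> X j ^ n" if "b \<in> low i" for b
  proof -
    have "\<bar>b\<bar> \<le> X j ^ 1" using low_less_X[OF that] X_mono[OF \<open>i \<le> j\<close>] by simp
    then show ?thesis by blast
  qed
  have *: "\<exists>n. \<bar>b + X i * s\<bar> \<le> X j ^ n" if b: "b \<in> low i" and s: "\<bar>s\<bar> \<le> X j ^ m" for b s m
  proof -
    obtain n where n: "\<bar>b\<bar> \<le> X j ^ n" using lowb[OF b] by blast
    have 1: "\<bar>b + X i * s\<bar> \<le> \<bar>b\<bar> + X i * \<bar>s\<bar>"
      using abs_triangle_ineq[of b "X i * s"] X_pos[of i] by (simp add: abs_mult)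
    have 2: "X i * \<bar>s\<bar> \<le> X j * X j ^ m"
      using s X_mono[OF \<open>i \<le> j\<close>] X_pos[of j] by (intro mult_mono) auto
    have "\<bar>b + X i * s\<bar> \<le> \<bar>b\<bar> + X j * X j ^ m" using 1 2 by linarith
    also have "\<bar>b\<bar> + X j * X j ^ m \<le> X j ^ max n (Suc m) + X j ^ max n (Suc m)"
      using n X_power_mono[of j j n "max n (Suc m)"] X_power_mono[of j j "Suc m" "max n (Suc m)"]
      by simp
    also have "\<dots> = 2 * X j ^ max n (Suc m)" by simp
    also have "\<dots> \<le> X j * X j ^ max n (Suc m)"
      using X_gt_numeral[of "num.Bit0 num.One" j] X_pos[of j] by (intro mult_right_mono) auto
    also have "\<dots> = X j ^ Suc (max n (Suc m))" by simp
    finally show ?thesis by blast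
  qed
  have "poly_in i s s' \<Longrightarrow> \<exists>n. \<bar>s\<bar> \<le> X j ^ n" for s s'
  proof (induction rule: horner.induct)
    case base then show ?case using lowb by blast
  next
    case (step a a' r r') then show ?case using * by blast
  qed
  then obtain m where "\<bar>r\<bar> \<le> X j ^ m" using 2(3) by blast
  from *[OF 2(2) this] show ?thesis unfolding 2(1) .
qed

text \<open>Tameness puts \<open>P\<close> into \<open>low k\<close> for every \<open>k\<close>
  above the level \<open>j\<close> of \<open>Y\<close>, hence below a power of \<open>X j\<close>;
  its exponent bounds the number of divisors of the form \<open>Y + d\<close>.\<close>

lemma code_finite:
  assumes "tame Y P" "P \<in> M"
  shows "finite (code_set Y P)"
proof -
  define j where "j = lev Y"
  have Y: "gen Y" "level Y j" "Y \<in> M" and P: "0 < P" "P \<in> R"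
    using assms level_lev by (auto simp: tame_def j_def gen_M M_D)
  have "P \<in> low k" if "j < k" for k
  proof -
    have "ll Y (X k)" using ll_gen_iff[OF Y(1)] that by (simp add: gen_X lev_X j_def)
    then have "ll P (X k)" using assms(1) M_X by (auto simp: tame_def)
    then show ?thesis using ll_iff_low[OF assms(2)] by (simp add: lev_X)
  qed
  from power_bound[OF P(2) this] obtain n where n: "\<bar>P\<bar> \<le> 1 * X j ^ n" by auto
  define f where "f = (\<lambda>p::'r \<times> 'r. pr (fst p) (snd p))"
  have inj: "inj_on f (code_set Y P)"
  proof (rule inj_onI)
    fix p q assume "p \<in> code_set Y P" "q \<in> code_set Y P" "f p = f q"
    then show "p = q" using pr_inj[of "fst p" "snd p" "fst q" "snd q"]
      by (simp add: code_set_def f_def case_prod_beta prod_eq_iff)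
  qed
  have "finite (f ` code_set Y P)"
  proof (rule ccontr)
    assume "infinite (f ` code_set Y P)"
    from infinite_arbitrarily_large[OF this, of "Suc n"]
    obtain D where D: "finite D" "card D = Suc n" "D \<subseteq> f ` code_set Y P" by blast
    have d: "d \<in> low j \<inter> M \<and> (\<exists>q\<in>R. (Y + d) * q = 1 * P)" if d: "d \<in> D" for d
    proof -
      obtain p where p: "p \<in> code_set Y P" "d = f p" using D d by blast
      then have *: "fst p \<in> M" "snd p \<in> M" "ll (fst p) Y" "ll (snd p) Y" "\<exists>q\<in>M. (Y + d) * q = P"
        by (auto simp: code_set_def mem_def f_def)
      then have "fst p \<in> low j" "snd p \<in> low j" using ll_iff_low j_def by auto
      then have "d \<in> low j" "d \<in> M" using p(2) pr_low pr_M * unfolding f_def by auto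
      moreover have "\<exists>q\<in>R. (Y + d) * q = 1 * P" using *(5) M_D(1) by auto
      ultimately show ?thesis by blast
    qed
    have "card D \<le> n"
    proof (rule finite_divisors_aux[OF Y(2) P(2) _ low_1 n D(1)])
      show "P \<noteq> 0" using P by simp
      show "D \<subseteq> low j \<inter> M" using d by blast
      show "\<exists>\<epsilon>\<in>low j. \<epsilon> \<noteq> 0 \<and> (\<exists>q\<in>R. (Y + d) * q = \<epsilon> * P)" if "d \<in> D" for d
        using d[OF that] by (intro bexI[OF _ low_1] conjI) simp_all
    qed
    then show False using D by simp
  qed
  then show ?thesis using inj finite_imageD by blast
qed

end

text \<open>A first-order substitute for the inductive definition of \<open>ring_rel\<close>: every pair in the finite
  set \<open>J\<close> comes from pairs in \<open>J\<close> with smaller first components. Subtraction would spoil this, so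
  it is postponed to the very end.\<close>

definition derived :: "('r::linordered_idom \<times> 'r) set \<Rightarrow> 'r \<Rightarrow> 'r \<Rightarrow> bool" where
  "derived J u u' \<longleftrightarrow> (\<exists>a a' b b'. (a, a') \<in> J \<and> (b, b') \<in> J \<and> a < u \<and> b < u \<and>
    (u = a + b \<and> u' = a' + b' \<or> u = a * b \<and> u' = a' * b'))"

definition justified :: "('r::linordered_idom \<times> 'r) set \<Rightarrow> ('r \<times> 'r) set \<Rightarrow> bool" where
  "justified J G \<longleftrightarrow> (\<forall>u u'. (u, u') \<in> J \<longrightarrow>
     u = 0 \<and> u' = 0 \<or> u = 1 \<and> u' = 1 \<or> (u, u') \<in> G \<or> derived J u u')"

lemma derived_mono: "derived J u u' \<Longrightarrow> J \<subseteq> K \<Longrightarrow> derived K u u'"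
  unfolding derived_def by (elim exE, intro exI) (elim conjE, intro conjI; (rule subsetD)?; assumption)

lemma justified_Un: "justified J G \<Longrightarrow> justified K G \<Longrightarrow> justified (J \<union> K) G"
  unfolding justified_def
  using derived_mono[of J _ _ "J \<union> K"] derived_mono[of K _ _ "J \<union> K"] by (metis Un_iff Un_upper1 Un_upper2)

lemma justified_insert:
  assumes "justified J G" "derived J u u'"
  shows "justified (insert (u, u') J) G"
proof -
  have *: "derived J v v' \<Longrightarrow> derived (insert (u, u') J) v v'" for v v'
    by (erule derived_mono) blast
  then show ?thesis using assms unfolding justified_def by blast
qed

text \<open>As \<open>J\<close> is finite, some counterexample would have the least first component,
  but its justification refers only to smaller ones.\<close>

lemma justified_ring_rel:
  assumes "finite J" "justified J G" "(u, u') \<in> J"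
  shows "ring_rel G u u'"
proof (rule ccontr)
  assume no: "\<not> ring_rel G u u'"
  define B where "B = {p\<in>J. \<not> ring_rel G (fst p) (snd p)}"
  have B: "finite B" "B \<noteq> {}" using assms no by (auto simp: B_def)
  obtain p where p: "p \<in> B" "\<And>q. q \<in> B \<Longrightarrow> fst p \<le> fst q"
    using ex_min_if_finite[of "fst ` B"] B by (auto simp: not_less)
  have small: "ring_rel G a a'" if "(a, a') \<in> J" "a < fst p" for a a'
    using p(2)[of "(a, a')"] that by (auto simp: B_def)
  have "p \<in> J" "\<not> ring_rel G (fst p) (snd p)" using p by (auto simp: B_def)
  moreover from this(1) assms(2) consider "fst p = 0" "snd p = 0" | "fst p = 1" "snd p = 1" | "p \<in> G"
    | a a' b b' where "(a, a') \<in> J" "(b, b') \<in> J" "a < fst p" "b < fst p"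
        "fst p = a + b \<and> snd p = a' + b' \<or> fst p = a * b \<and> snd p = a' * b'"
    unfolding justified_def derived_def by (metis prod.collapse)
  then have "ring_rel G (fst p) (snd p)"
  proof cases
    case 3 then show ?thesis by (cases p) (auto intro: ring_rel.gen)
  next
    case 4
    then have "ring_rel G a a'" "ring_rel G b b'" using small by auto
    then show ?thesis using 4(5) by (auto intro: ring_rel.intros)
  qed (auto intro: ring_rel.intros)
  ultimately show False by simp
qed

text \<open>The subtraction-free part of \<open>ring_rel\<close>, whose derivations can be recorded
  as justified sets.\<close>

inductive semiring_rel :: "('r::comm_semiring_1 \<times> 'r) set \<Rightarrow> 'r \<Rightarrow> 'r \<Rightarrow> bool" for G where
  zero: "semiring_rel G 0 0"
| one: "semiring_rel G 1 1"
| gen: "(g, g') \<in> G \<Longrightarrow> semiring_rel G g g'"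
| add: "semiring_rel G x x' \<Longrightarrow> semiring_rel G y y' \<Longrightarrow> semiring_rel G (x + y) (x' + y')"
| mult: "semiring_rel G x x' \<Longrightarrow> semiring_rel G y y' \<Longrightarrow> semiring_rel G (x * y) (x' * y')"

lemma semiring_rel_ring_rel: "semiring_rel G x x' \<Longrightarrow> ring_rel G x x'"
  by (induction rule: semiring_rel.induct) (auto intro: ring_rel.intros)

lemma ring_rel_difference:
  assumes "ring_rel G x x'"
  shows "\<exists>u u' v v'. semiring_rel G u u' \<and> semiring_rel G v v' \<and> x = u - v \<and> x' = u' - v'"
  using assms
proof induction
  case zero
  then show ?case using semiring_rel.zero[of G] by (metis diff_0_right)
next
  case one
  then show ?case using semiring_rel.zero[of G] semiring_rel.one[of G] by (metis diff_0_right)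
next
  case (gen g g')
  then show ?case using semiring_rel.zero[of G] semiring_rel.gen[of g g' G] by (metis diff_0_right)
next
  case (add x x' y y')
  then obtain u u' v v' s s' t t' where
    "semiring_rel G u u'" "semiring_rel G v v'" "x = u - v" "x' = u' - v'"
    "semiring_rel G s s'" "semiring_rel G t t'" "y = s - t" "y' = s' - t'" by blast
  then show ?case
    by (intro exI[of _ "u + s"] exI[of _ "u' + s'"] exI[of _ "v + t"] exI[of _ "v' + t'"])
      (auto intro: semiring_rel.add)
next
  case (mult x x' y y')
  then obtain u u' v v' s s' t t' where
    "semiring_rel G u u'" "semiring_rel G v v'" "x = u - v" "x' = u' - v'"
    "semiring_rel G s s'" "semiring_rel G t t'" "y = s - t" "y' = s' - t'" by blast
  then show ?case
    by (intro exI[of _ "u * s + v * t"] exI[of _ "u' * s' + v' * t'"]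
        exI[of _ "u * t + v * s"] exI[of _ "u' * t' + v' * s'"])
      (auto intro: semiring_rel.add semiring_rel.mult simp: algebra_simps)
next
  case (minus x x')
  then show ?case by (metis minus_diff_eq)
qed

context tower begin

lemma compat_M: "compat G \<Longrightarrow> G \<subseteq> M \<times> M"
  unfolding compat_def using gen_M by fastforce

text \<open>Sums with 0 and products with 0 or 1 do not raise the first component and are treated
  apart; by \<open>compat\<close>, the second component degenerates together with the first.\<close>

lemma semiring_rel_justified:
  assumes G: "compat G" and "semiring_rel G x x'"
  shows "\<exists>J. finite J \<and> J \<subseteq> M \<times> M \<and> justified J G \<and> (x, x') \<in> J"
  using assms(2)
proof induction
  case zero
  have "justified {(0, 0)} G" by (simp add: justified_def)
  then show ?case using M_0 by blast
next
  case one
  have "justified {(1, 1)} G" by (simp add: justified_def)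
  then show ?case using M_1 by blast
next
  case (gen g g')
  have "justified {(g, g')} G" using gen by (simp add: justified_def)
  moreover have "{(g, g')} \<subseteq> M \<times> M" using gen compat_M[OF G] by blast
  ultimately show ?case by (intro exI[of _ "{(g, g')}"]) simp
next
  case (add x x' y y')
  obtain J K where JK: "finite J" "J \<subseteq> M \<times> M" "justified J G" "(x, x') \<in> J"
    "finite K" "K \<subseteq> M \<times> M" "justified K G" "(y, y') \<in> K" using add.IH by blast
  have M: "x \<in> M" "x' \<in> M" "y \<in> M" "y' \<in> M" using JK by auto
  have zero: "ring_rel G 0 0" by (rule ring_rel.zero)
  have eq0: "x = 0 \<longleftrightarrow> x' = 0" "y = 0 \<longleftrightarrow> y' = 0"
    using ring_rel_less_iff(2)[OF G _ zero] add.hyps semiring_rel_ring_rel by blast+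
  consider "x = 0" | "y = 0" | "0 < x" "0 < y" using M M_D(2) by force
  then show ?case
  proof cases
    case 1 then show ?thesis using eq0 JK by auto
  next
    case 2 then show ?thesis using eq0 JK by auto
  next
    case 3
    have "justified (insert (x + y, x' + y') (J \<union> K)) G"
      by (rule justified_insert[OF justified_Un[OF JK(3,7)]], unfold derived_def,
        rule exI[of _ x], rule exI[of _ x'], rule exI[of _ y], rule exI[of _ y']) (use JK(4,8) 3 in simp)
    then show ?thesis using JK M M_add
      by (intro exI[of _ "insert (x + y, x' + y') (J \<union> K)"]) auto
  qed
next
  case (mult x x' y y')
  obtain J K where JK: "finite J" "J \<subseteq> M \<times> M" "justified J G" "(x, x') \<in> J"
    "finite K" "K \<subseteq> M \<times> M" "justified K G" "(y, y') \<in> K" using mult.IH by blast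
  have M: "x \<in> M" "x' \<in> M" "y \<in> M" "y' \<in> M" using JK by auto
  have zo: "ring_rel G 0 0" "ring_rel G 1 1" by (rule ring_rel.zero ring_rel.one)+
  have eq: "x = 0 \<longleftrightarrow> x' = 0" "y = 0 \<longleftrightarrow> y' = 0" "x = 1 \<longleftrightarrow> x' = 1" "y = 1 \<longleftrightarrow> y' = 1"
    using ring_rel_less_iff(2)[OF G _ zo(1)] ring_rel_less_iff(2)[OF G _ zo(2)]
      mult.hyps semiring_rel_ring_rel by blast+
  have J0: "justified {(0, 0)} G" by (simp add: justified_def)
  have "1 < z" if "z \<in> M" "z \<noteq> 0" "z \<noteq> 1" for z
    using R_discrete[of z] that M_D[of z] by (simp add: less_le)
  then consider "x = 0" | "y = 0" | "x = 1" | "y = 1" | "1 < x" "1 < y" using M by blast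
  then show ?case
  proof cases
    case 1 then show ?thesis using eq J0 M_0 by (intro exI[of _ "{(0, 0)}"]) auto
  next
    case 2 then show ?thesis using eq J0 M_0 by (intro exI[of _ "{(0, 0)}"]) auto
  next
    case 3 then show ?thesis using eq JK by auto
  next
    case 4 then show ?thesis using eq JK by auto
  next
    case 5
    have "justified (insert (x * y, x' * y') (J \<union> K)) G"
      by (rule justified_insert[OF justified_Un[OF JK(3,7)]], unfold derived_def,
        rule exI[of _ x], rule exI[of _ x'], rule exI[of _ y], rule exI[of _ y']) (use JK(4,8) 5 in simp)
    then show ?thesis using JK M M_mult
      by (intro exI[of _ "insert (x * y, x' * y') (J \<union> K)"]) auto
  qed
qed

text \<open>\<open>(Z, Q)\<close> codes derivations of two pairs whose difference is
  \<open>(x, x')\<close>; the difference is written additively, as \<open>M\<close> has no negative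
  elements.\<close>

definition coded_rel :: "'r \<Rightarrow> 'r \<Rightarrow> 'r \<Rightarrow> 'r \<Rightarrow> bool" where
  "coded_rel Y P x x' \<longleftrightarrow> (\<exists>Z\<in>M. \<exists>Q\<in>M. tame Z Q \<and> justified (code_set Z Q) (code_set Y P) \<and>
    (\<exists>u\<in>M. \<exists>u'\<in>M. \<exists>v\<in>M. \<exists>v'\<in>M. mem Z Q u u' \<and> mem Z Q v v' \<and> x + v = u \<and> x' + v' = u'))"

lemma coded_rel_iff:
  assumes "compat (code_set Y P)" "x \<in> M" "x' \<in> M"
  shows "coded_rel Y P x x' \<longleftrightarrow> ring_rel (code_set Y P) x x'"
proof
  assume "coded_rel Y P x x'"
  then obtain Z Q u u' v v' where *: "Z \<in> M" "Q \<in> M" "tame Z Q" "justified (code_set Z Q) (code_set Y P)"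
    "(u, u') \<in> code_set Z Q" "(v, v') \<in> code_set Z Q" "x + v = u" "x' + v' = u'"
    unfolding coded_rel_def code_set_def by auto
  then have "ring_rel (code_set Y P) u u'" "ring_rel (code_set Y P) v v'"
    using justified_ring_rel code_finite by blast+
  from ring_rel_diff[OF this] show "ring_rel (code_set Y P) x x'"
    unfolding *(7)[symmetric] *(8)[symmetric] by simp
next
  assume "ring_rel (code_set Y P) x x'"
  from ring_rel_difference[OF this] obtain u u' v v' where
    uv: "semiring_rel (code_set Y P) u u'" "semiring_rel (code_set Y P) v v'" "x = u - v" "x' = u' - v'"
    by blast
  obtain J where J: "finite J" "J \<subseteq> M \<times> M" "justified J (code_set Y P)" "(u, u') \<in> J"
    using semiring_rel_justified[OF assms(1) uv(1)] by blast
  obtain K where K: "finite K" "K \<subseteq> M \<times> M" "justified K (code_set Y P)" "(v, v') \<in> K"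
    using semiring_rel_justified[OF assms(1) uv(2)] by blast
  obtain Z Q where Z: "Z \<in> M" "Q \<in> M" "tame Z Q" "code_set Z Q = J \<union> K"
    using code_exists[of "J \<union> K"] J K by auto
  have "justified (code_set Z Q) (code_set Y P)" unfolding Z(4) using J K justified_Un by blast
  moreover have "(u, u') \<in> code_set Z Q" "(v, v') \<in> code_set Z Q" using J K Z by auto
  then have "mem Z Q u u'" "mem Z Q v v'" "u \<in> M" "u' \<in> M" "v \<in> M" "v' \<in> M"
    by (simp_all add: code_set_def)
  moreover have "x + v = u" "x' + v' = u'" using uv by simp_all
  ultimately show "coded_rel Y P x x'" unfolding coded_rel_def using Z(1-3) by blast
qed

end

section \<open>Soundness and completeness\<close>

lemma subst_tm_cong: "(\<And>n. n < free_bound_tm t \<Longrightarrow> \<sigma> n = \<tau> n) \<Longrightarrow> subst_tm \<sigma> t = subst_tm \<tau> t"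
  by (induction t) auto

lemma under_binder_simps [simp]:
  "under_binder \<sigma> 0 = Var 0" "under_binder \<sigma> (Suc n) = subst_tm (\<lambda>m. Var (Suc m)) (\<sigma> n)"
  by (simp_all add: under_binder_def)

lemma subst_fm_cong: "(\<And>n. n < free_bound p \<Longrightarrow> \<sigma> n = \<tau> n) \<Longrightarrow> subst_fm \<sigma> p = subst_fm \<tau> p"
proof (induction p arbitrary: \<sigma> \<tau>)
  case (Forall p)
  have "under_binder \<sigma> n = under_binder \<tau> n" if "n < free_bound p" for n
    using that Forall.prems by (cases n) auto
  then show ?case using Forall.IH[of "under_binder \<sigma>" "under_binder \<tau>"] by (simp only: subst_fm.simps)
next
  case (Eql s t)
  then show ?case using subst_tm_cong[of s \<sigma> \<tau>] subst_tm_cong[of t \<sigma> \<tau>] by simp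
next
  case (Less s t)
  then show ?case using subst_tm_cong[of s \<sigma> \<tau>] subst_tm_cong[of t \<sigma> \<tau>] by simp
next
  case (Imp p q)
  show ?case using Imp.IH(1)[of \<sigma> \<tau>] Imp.IH(2)[of \<sigma> \<tau>] Imp.prems by simp
qed simp

lemma subst_tm_Var [simp]: "subst_tm Var t = t"
  by (induction t) auto

lemma under_binder_Var [simp]: "under_binder Var = Var"
  by (rule ext) (simp add: under_binder_def split: nat.split)

lemma subst_fm_Var [simp]: "subst_fm Var p = p"
  by (induction p) auto

lemma subst_tm_comp: "subst_tm \<sigma> (subst_tm \<tau> t) = subst_tm (\<lambda>n. subst_tm \<sigma> (\<tau> n)) t"
  by (induction t) auto

lemma under_binder_comp:
  "(\<lambda>n. subst_tm (under_binder \<sigma>) (under_binder \<tau> n)) = under_binder (\<lambda>n. subst_tm \<sigma> (\<tau> n))"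
  by (rule ext) (simp add: under_binder_def subst_tm_comp split: nat.split)

lemma subst_fm_comp: "subst_fm \<sigma> (subst_fm \<tau> p) = subst_fm (\<lambda>n. subst_tm \<sigma> (\<tau> n)) p"
  by (induction p arbitrary: \<sigma> \<tau>) (auto simp: subst_tm_comp under_binder_comp)

lemma inst_subst: "inst (subst_fm (under_binder \<sigma>) p) t = subst_fm (case_nat t \<sigma>) p"
  unfolding inst_def subst_fm_comp
  by (rule arg_cong[where f = "\<lambda>\<rho>. subst_fm \<rho> p"])
    (auto simp: fun_eq_iff under_binder_def subst_tm_comp split: nat.split)

lemma subst_inst: "subst_fm \<sigma> (inst p t) = inst (subst_fm (under_binder \<sigma>) p) (subst_tm \<sigma> t)"
  unfolding inst_subst unfolding inst_def subst_fm_comp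
  by (rule arg_cong[where f = "\<lambda>\<rho>. subst_fm \<rho> p"]) (auto simp: fun_eq_iff split: nat.split)

lemma subst_shift: "subst_fm (under_binder \<sigma>) (shift p) = shift (subst_fm \<sigma> p)"
  by (simp add: shift_def subst_fm_comp)

lemma derives_mono: "\<Gamma> \<turnstile> p \<Longrightarrow> \<Gamma> \<subseteq> \<Delta> \<Longrightarrow> \<Delta> \<turnstile> p"
proof (induction arbitrary: \<Delta> rule: derives.induct)
  case (ImpI p \<Gamma> q)
  then show ?case by (meson derives.ImpI insert_mono)
next
  case (Contr p \<Gamma>)
  then show ?case by (meson derives.Contr insert_mono)
next
  case (ForallI \<Gamma> p)
  then show ?case by (meson derives.ForallI image_mono)
qed (blast intro: derives.intros)+

lemma derives_subst: "\<Gamma> \<turnstile> p \<Longrightarrow> subst_fm \<sigma> ` \<Gamma> \<turnstile> subst_fm \<sigma> p"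
proof (induction arbitrary: \<sigma> rule: derives.induct)
  case (ForallI \<Gamma> p)
  have "subst_fm (under_binder \<sigma>) ` shift ` \<Gamma> = shift ` subst_fm \<sigma> ` \<Gamma>"
    by (simp add: image_image subst_shift)
  with ForallI.IH[of "under_binder \<sigma>"] show ?case by (simp add: derives.ForallI)
next
  case (ForallE \<Gamma> p t)
  from ForallE.IH[of \<sigma>] show ?case by (simp add: subst_inst derives.ForallE)
next
  case (EqlE \<Gamma> s t p)
  from EqlE.IH[of \<sigma>] show ?case by (simp add: subst_inst) (rule derives.EqlE)
next
  case (ImpI p \<Gamma> q)
  from ImpI.IH[of \<sigma>] show ?case by (simp add: derives.ImpI)
next
  case (Contr p \<Gamma>)
  from Contr.IH[of \<sigma>] show ?case by (simp add: derives.Contr)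
next
  case (ImpE \<Gamma> p q)
  then show ?case by (metis derives.ImpE subst_fm.simps(4))
qed (auto intro: derives.intros)

lemma derives_finite: "\<Gamma> \<turnstile> p \<Longrightarrow> \<exists>\<Gamma>'. finite \<Gamma>' \<and> \<Gamma>' \<subseteq> \<Gamma> \<and> (\<Gamma>' \<turnstile> p)"
proof (induction rule: derives.induct)
  case (Hyp p \<Gamma>)
  then show ?case by (intro exI[of _ "{p}"]) (auto intro: derives.Hyp)
next
  case (ImpI p \<Gamma> q)
  then obtain \<Gamma>' where *: "finite \<Gamma>'" "\<Gamma>' \<subseteq> insert p \<Gamma>" "\<Gamma>' \<turnstile> q" by blast
  then have "insert p (\<Gamma>' - {p}) \<turnstile> q" by (auto elim: derives_mono)
  with * show ?case by (intro exI[of _ "\<Gamma>' - {p}"]) (auto intro: derives.ImpI)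
next
  case (Contr p \<Gamma>)
  then obtain \<Gamma>' where *: "finite \<Gamma>'" "\<Gamma>' \<subseteq> insert (\<^bold>\<not> p) \<Gamma>" "\<Gamma>' \<turnstile> \<^bold>\<bottom>" by blast
  then have "insert (\<^bold>\<not> p) (\<Gamma>' - {\<^bold>\<not> p}) \<turnstile> \<^bold>\<bottom>" by (auto elim: derives_mono)
  with * show ?case by (intro exI[of _ "\<Gamma>' - {\<^bold>\<not> p}"]) (auto intro: derives.Contr)
next
  case (ImpE \<Gamma> p q)
  then obtain \<Gamma>1 \<Gamma>2 where "finite \<Gamma>1" "\<Gamma>1 \<subseteq> \<Gamma>" "\<Gamma>1 \<turnstile> p \<^bold>\<longrightarrow> q" "finite \<Gamma>2" "\<Gamma>2 \<subseteq> \<Gamma>" "\<Gamma>2 \<turnstile> p" by blast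
  then show ?case
    by (intro exI[of _ "\<Gamma>1 \<union> \<Gamma>2"]) (auto intro: derives.ImpE elim: derives_mono)
next
  case (EqlE \<Gamma> s t p)
  then obtain \<Gamma>1 \<Gamma>2 where *: "finite \<Gamma>1" "\<Gamma>1 \<subseteq> \<Gamma>" "\<Gamma>1 \<turnstile> s \<^bold>= t" "finite \<Gamma>2" "\<Gamma>2 \<subseteq> \<Gamma>" "\<Gamma>2 \<turnstile> inst p s" by blast
  then have "\<Gamma>1 \<union> \<Gamma>2 \<turnstile> s \<^bold>= t" "\<Gamma>1 \<union> \<Gamma>2 \<turnstile> inst p s" by (auto elim: derives_mono)
  then have "\<Gamma>1 \<union> \<Gamma>2 \<turnstile> inst p t" by (rule derives.EqlE)
  with * show ?case by (intro exI[of _ "\<Gamma>1 \<union> \<Gamma>2"]) auto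
next
  case (ForallI \<Gamma> p)
  then obtain \<Gamma>' where "finite \<Gamma>'" "\<Gamma>' \<subseteq> shift ` \<Gamma>" "\<Gamma>' \<turnstile> p" by blast
  then obtain \<Delta> where "finite \<Delta>" "\<Delta> \<subseteq> \<Gamma>" "\<Gamma>' = shift ` \<Delta>" by (meson finite_subset_image)
  with \<open>\<Gamma>' \<turnstile> p\<close> show ?case by (auto intro: derives.ForallI)
next
  case (EqlI \<Gamma> t)
  then show ?case by (intro exI[of _ "{}"]) (auto intro: derives.EqlI)
qed (blast intro: derives.ForallE)

lemma derives_cut: "insert p \<Gamma> \<turnstile> q \<Longrightarrow> \<Gamma> \<turnstile> p \<Longrightarrow> \<Gamma> \<turnstile> q"
  using derives.ImpI derives.ImpE by blast

lemma derives_explosion: "\<Gamma> \<turnstile> \<^bold>\<bottom> \<Longrightarrow> \<Gamma> \<turnstile> p"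
  by (rule derives.Contr) (erule derives_mono, blast)

text \<open>The renaming sends \<open>Var n\<close> to the bound position and shifts all other
  variables; on the hypotheses, where \<open>Var n\<close> does not occur, it is
  \<open>shift\<close>.\<close>

lemma derives_generalize:
  assumes "\<Gamma> \<turnstile> inst p (Var n)" "free_bound p \<le> Suc n" "\<And>q. q \<in> \<Gamma> \<Longrightarrow> free_bound q \<le> n"
  shows "\<Gamma> \<turnstile> Forall p"
proof (rule derives.ForallI)
  define \<sigma> where "\<sigma> = (\<lambda>m. if m = n then Var 0 else Var (Suc m))"
  have "subst_fm \<sigma> q = shift q" if "q \<in> \<Gamma>" for q
    unfolding shift_def using assms(3)[OF that] by (intro subst_fm_cong) (auto simp: \<sigma>_def)
  then have "subst_fm \<sigma> ` \<Gamma> = shift ` \<Gamma>" by simp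
  moreover have "subst_fm \<sigma> (inst p (Var n)) = p"
  proof -
    have "subst_fm \<sigma> (inst p (Var n)) = subst_fm Var p"
      unfolding inst_def subst_fm_comp using assms(2)
      by (intro subst_fm_cong) (auto simp: \<sigma>_def split: nat.split)
    then show ?thesis by simp
  qed
  ultimately show "shift ` \<Gamma> \<turnstile> p" using derives_subst[OF assms(1), of \<sigma>] by simp
qed


section \<open>Tarski semantics and soundness\<close>

record 'a struct =
  carr :: "'a set"
  zer :: 'a
  one :: 'a
  add :: "'a \<Rightarrow> 'a \<Rightarrow> 'a"
  mul :: "'a \<Rightarrow> 'a \<Rightarrow> 'a"
  lt :: "'a \<Rightarrow> 'a \<Rightarrow> bool"

definition is_struct :: "'a struct \<Rightarrow> bool" where
  "is_struct S \<longleftrightarrow> zer S \<in> carr S \<and> one S \<in> carr S \<and>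
    (\<forall>x\<in>carr S. \<forall>y\<in>carr S. add S x y \<in> carr S \<and> mul S x y \<in> carr S)"

primrec val :: "'a struct \<Rightarrow> (nat \<Rightarrow> 'a) \<Rightarrow> tm \<Rightarrow> 'a" where
  "val S e (Var n) = e n"
| "val S e \<^bold>0 = zer S"
| "val S e \<^bold>1 = one S"
| "val S e (s \<^bold>+ t) = add S (val S e s) (val S e t)"
| "val S e (s \<^bold>* t) = mul S (val S e s) (val S e t)"

primrec sat :: "'a struct \<Rightarrow> (nat \<Rightarrow> 'a) \<Rightarrow> fm \<Rightarrow> bool" where
  "sat S e \<^bold>\<bottom> = False"
| "sat S e (s \<^bold>= t) = (val S e s = val S e t)"
| "sat S e (s \<^bold>< t) = lt S (val S e s) (val S e t)"
| "sat S e (p \<^bold>\<longrightarrow> q) = (sat S e p \<longrightarrow> sat S e q)"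
| "sat S e (Forall p) = (\<forall>x\<in>carr S. sat S (case_nat x e) p)"

lemma val_cong: "(\<And>n. n < free_bound_tm t \<Longrightarrow> e n = e' n) \<Longrightarrow> val S e t = val S e' t"
  by (induction t) auto

lemma sat_cong: "(\<And>n. n < free_bound p \<Longrightarrow> e n = e' n) \<Longrightarrow> sat S e p = sat S e' p"
proof (induction p arbitrary: e e')
  case (Eql s t)
  then show ?case using val_cong[of s e e' S] val_cong[of t e e' S] by simp
next
  case (Less s t)
  then show ?case using val_cong[of s e e' S] val_cong[of t e e' S] by simp
next
  case (Imp p q)
  show ?case using Imp.IH(1)[of e e'] Imp.IH(2)[of e e'] Imp.prems by simp
next
  case (Forall p)
  have "sat S (case_nat x e) p = sat S (case_nat x e') p" for x
    using Forall.prems by (intro Forall.IH) (auto split: nat.split)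
  then show ?case by simp
qed simp

lemma sat_sentence: "sentence p \<Longrightarrow> sat S e p = sat S e' p"
  by (rule sat_cong) (simp add: sentence_def)

lemma val_subst: "val S e (subst_tm \<sigma> t) = val S (\<lambda>n. val S e (\<sigma> n)) t"
  by (induction t) auto

lemma sat_subst: "sat S e (subst_fm \<sigma> p) = sat S (\<lambda>n. val S e (\<sigma> n)) p"
proof (induction p arbitrary: e \<sigma>)
  case (Forall p)
  have "(\<lambda>n. val S (case_nat x e) (under_binder \<sigma> n)) = case_nat x (\<lambda>n. val S e (\<sigma> n))" for x
    by (rule ext) (simp add: under_binder_def val_subst split: nat.split)
  then show ?case by (simp add: Forall.IH)
qed (auto simp: val_subst)

lemma sat_inst: "sat S e (inst p t) = sat S (case_nat (val S e t) e) p"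
proof -
  have "(\<lambda>n. val S e (case_nat t Var n)) = case_nat (val S e t) e"
    by (rule ext) (simp split: nat.split)
  then show ?thesis by (simp add: inst_def sat_subst)
qed

lemma sat_shift: "sat S (case_nat x e) (shift p) = sat S e p"
  by (simp add: shift_def sat_subst)

lemma val_carr: "is_struct S \<Longrightarrow> range e \<subseteq> carr S \<Longrightarrow> val S e t \<in> carr S"
  by (induction t) (auto simp: is_struct_def)

lemma soundness:
  assumes "\<Gamma> \<turnstile> p" "is_struct S" "range e \<subseteq> carr S" "\<And>q. q \<in> \<Gamma> \<Longrightarrow> sat S e q"
  shows "sat S e p"
  using assms(1,3,4)
proof (induction arbitrary: e rule: derives.induct)
  case (ForallI \<Gamma> p)
  have "sat S (case_nat x e) p" if "x \<in> carr S" for x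
    using that ForallI.prems by (intro ForallI.IH) (auto simp: sat_shift image_subset_iff split: nat.split)
  then show ?case by simp
next
  case (ForallE \<Gamma> p t)
  then show ?case by (auto simp: sat_inst val_carr[OF assms(2)])
next
  case (EqlE \<Gamma> s t p)
  then show ?case by (fastforce simp: sat_inst)
next
  case (ImpI p \<Gamma> q)
  then show ?case by auto
next
  case (Contr p \<Gamma>)
  show ?case
  proof (rule ccontr)
    assume no: "\<not> sat S e p"
    have "sat S e \<^bold>\<bottom>"
    proof (rule Contr.IH[OF Contr.prems(1)])
      fix q assume "q \<in> insert (\<^bold>\<not> p) \<Gamma>"
      then show "sat S e q" using no Contr.prems(2) by (cases "q = (\<^bold>\<not> p)") simp_all
    qed
    then show False by simp
  qed
qed auto


section \<open>Henkin sets and term models\<close>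

instance tm :: countable by countable_datatype
instance fm :: countable by countable_datatype

definition fresh :: "fm set \<Rightarrow> fm \<Rightarrow> nat" where
  "fresh \<Delta> p = Max (insert (free_bound p) (free_bound ` \<Delta>))"

text \<open>The hypotheses will be sentences, so free variables can act as Henkin constants and the
  language stays the same. In its universal form the axiom says that the chosen variable is a
  counterexample to \<open>p\<close> if there is one.\<close>

primrec henkin :: "nat \<Rightarrow> fm set" where
  "henkin 0 = {}"
| "henkin (Suc n) = (let p = from_nat n in
    insert (inst p (Var (fresh (henkin n) p)) \<^bold>\<longrightarrow> Forall p) (henkin n))"

lemma finite_henkin: "finite (henkin n)"
  by (induction n) (auto simp: Let_def)

lemma free_bound_fresh:
  assumes "finite \<Delta>"
  shows "free_bound p \<le> fresh \<Delta> p" "q \<in> \<Delta> \<Longrightarrow> free_bound q \<le> fresh \<Delta> p"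
  unfolding fresh_def using assms by auto

text \<open>If the new axiom were refutable, \<open>Forall p\<close> would be refutable and
  \<open>inst p (Var k)\<close> provable; as \<open>k\<close> is fresh, generalisation produces a
  contradiction.\<close>

lemma henkin_consistent:
  assumes "consistent \<Gamma>" "\<And>p. p \<in> \<Gamma> \<Longrightarrow> sentence p"
  shows "consistent (\<Gamma> \<union> henkin n)"
proof (induction n)
  case (Suc n)
  define p :: fm where "p = from_nat n"
  define k where "k = fresh (henkin n) p"
  define \<Delta> where "\<Delta> = \<Gamma> \<union> henkin n"
  have le: "free_bound q \<le> k" if "q \<in> \<Delta>" for q
    using that assms(2) free_bound_fresh(2)[OF finite_henkin] by (auto simp: \<Delta>_def k_def sentence_def)
  have "\<not> (\<Gamma> \<union> henkin (Suc n) \<turnstile> \<^bold>\<bottom>)"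
  proof
    assume "\<Gamma> \<union> henkin (Suc n) \<turnstile> \<^bold>\<bottom>"
    then have 1: "insert (inst p (Var k) \<^bold>\<longrightarrow> Forall p) \<Delta> \<turnstile> \<^bold>\<bottom>"
      by (simp add: p_def[symmetric] k_def \<Delta>_def Let_def)
    have "insert (Forall p) \<Delta> \<turnstile> inst p (Var k) \<^bold>\<longrightarrow> Forall p"
      by (intro derives.ImpI derives.Hyp) simp
    moreover have "insert (inst p (Var k) \<^bold>\<longrightarrow> Forall p) (insert (Forall p) \<Delta>) \<turnstile> \<^bold>\<bottom>"
      using 1 by (rule derives_mono) blast
    ultimately have 2: "insert (Forall p) \<Delta> \<turnstile> \<^bold>\<bottom>" by (rule derives_cut[rotated])
    let ?\<Delta>' = "insert (\<^bold>\<not> inst p (Var k)) \<Delta>"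
    have "insert (inst p (Var k)) ?\<Delta>' \<turnstile> \<^bold>\<bottom>"
      by (rule derives.ImpE[of _ "inst p (Var k)"]) (auto intro: derives.Hyp)
    then have "?\<Delta>' \<turnstile> inst p (Var k) \<^bold>\<longrightarrow> Forall p"
      by (rule derives.ImpI[OF derives_explosion])
    moreover have "insert (inst p (Var k) \<^bold>\<longrightarrow> Forall p) ?\<Delta>' \<turnstile> \<^bold>\<bottom>"
      using 1 by (rule derives_mono) blast
    ultimately have "?\<Delta>' \<turnstile> \<^bold>\<bottom>" by (rule derives_cut[rotated])
    then have "\<Delta> \<turnstile> inst p (Var k)" by (rule derives.Contr)
    then have "\<Delta> \<turnstile> Forall p"
    proof (rule derives_generalize)
      show "free_bound p \<le> Suc k" using free_bound_fresh(1)[OF finite_henkin, of p n] by (simp add: k_def)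
    qed (rule le)
    with 2 have "\<Delta> \<turnstile> \<^bold>\<bottom>" by (rule derives_cut)
    then show False using Suc by (simp add: consistent_def \<Delta>_def)
  qed
  then show ?case by (simp add: consistent_def)
qed (use assms in simp)

lemma henkin_mono: "m \<le> n \<Longrightarrow> henkin m \<subseteq> henkin n"
  by (rule lift_Suc_mono_le[of henkin]) (auto simp: Let_def)

lemma consistent_chain:
  assumes "subset.chain {\<Delta>. consistent \<Delta>} C" "C \<noteq> {}"
  shows "consistent (\<Union>C)"
  unfolding consistent_def
proof
  assume "\<Union>C \<turnstile> \<^bold>\<bottom>"
  then obtain F where F: "finite F" "F \<subseteq> \<Union>C" "F \<turnstile> \<^bold>\<bottom>" using derives_finite by blast
  then obtain \<Delta> where "\<Delta> \<in> C" "F \<subseteq> \<Delta>"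
    using finite_subset_Union_chain[of F C "{\<Delta>. consistent \<Delta>}"] assms by blast
  then have "\<Delta> \<turnstile> \<^bold>\<bottom>" "consistent \<Delta>" using derives_mono F(3) assms(1) by (auto simp: subset.chain_def)
  then show False by (simp add: consistent_def)
qed

text \<open>Zorn's lemma is applied above the hypotheses together with all Henkin axioms;
  consistency passes to unions of chains because derivations use finitely many hypotheses.\<close>

lemma henkin_extension:
  assumes "consistent \<Gamma>" "\<And>p. p \<in> \<Gamma> \<Longrightarrow> sentence p"
  obtains \<Delta> where "\<Gamma> \<subseteq> \<Delta>" "consistent \<Delta>" "\<And>\<Delta>'. consistent \<Delta>' \<Longrightarrow> \<Delta> \<subseteq> \<Delta>' \<Longrightarrow> \<Delta>' = \<Delta>"
    "\<And>p. \<exists>n. (inst p (Var n) \<^bold>\<longrightarrow> Forall p) \<in> \<Delta>"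
proof -
  define B where "B = \<Gamma> \<union> (\<Union>n. henkin n)"
  have B: "consistent B"
    unfolding consistent_def
  proof
    assume "B \<turnstile> \<^bold>\<bottom>"
    then obtain F where F: "finite F" "F \<subseteq> B" "F \<turnstile> \<^bold>\<bottom>" using derives_finite by blast
    have "\<exists>n. F \<subseteq> \<Gamma> \<union> henkin n" using F(1,2)
    proof (induction F rule: finite_induct)
      case (insert q F)
      then obtain n m where "F \<subseteq> \<Gamma> \<union> henkin n" "q \<in> \<Gamma> \<union> henkin m" by (auto simp: B_def)
      then show ?case using henkin_mono[of n "max n m"] henkin_mono[of m "max n m"]
        by (intro exI[of _ "max n m"]) auto
    qed simp
    then show False using henkin_consistent[OF assms] F(3) derives_mono unfolding consistent_def by blast
  qed
  have "\<exists>M\<in>{\<Delta>. consistent \<Delta> \<and> B \<subseteq> \<Delta>}. \<forall>X\<in>{\<Delta>. consistent \<Delta> \<and> B \<subseteq> \<Delta>}. M \<subseteq> X \<longrightarrow> X = M"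
  proof (rule subset_Zorn_nonempty)
    show "{\<Delta>. consistent \<Delta> \<and> B \<subseteq> \<Delta>} \<noteq> {}" using B by blast
    fix C assume C: "C \<noteq> {}" "subset.chain {\<Delta>. consistent \<Delta> \<and> B \<subseteq> \<Delta>} C"
    then have "subset.chain {\<Delta>. consistent \<Delta>} C" by (auto simp: subset.chain_def)
    from consistent_chain[OF this C(1)] have "consistent (\<Union>C)" .
    moreover have "B \<subseteq> \<Union>C" using C unfolding subset.chain_def by blast
    ultimately show "\<Union>C \<in> {\<Delta>. consistent \<Delta> \<and> B \<subseteq> \<Delta>}" by blast
  qed
  then obtain \<Delta> where "\<Delta> \<in> {\<Delta>. consistent \<Delta> \<and> B \<subseteq> \<Delta>}"
    and max: "\<forall>X\<in>{\<Delta>. consistent \<Delta> \<and> B \<subseteq> \<Delta>}. \<Delta> \<subseteq> X \<longrightarrow> X = \<Delta>" by (rule bexE)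
  then have \<Delta>: "consistent \<Delta>" "B \<subseteq> \<Delta>" by simp_all
  have maximal: "X = \<Delta>" if "consistent X" "\<Delta> \<subseteq> X" for X
    using max that \<Delta>(2) by simp
  have "\<exists>n. (inst p (Var n) \<^bold>\<longrightarrow> Forall p) \<in> \<Delta>" for p
  proof -
    have "\<exists>k. (inst p (Var k) \<^bold>\<longrightarrow> Forall p) \<in> henkin (Suc (to_nat p))" by (auto simp: Let_def)
    then show ?thesis using \<Delta>(2) unfolding B_def by blast
  qed
  moreover have "\<Gamma> \<subseteq> \<Delta>" using \<Delta>(2) by (auto simp: B_def)
  ultimately show ?thesis using that[of \<Delta>] \<Delta>(1) maximal by simp
qed

locale henkin_set =
  fixes \<Delta> :: "fm set"
  assumes cons: "consistent \<Delta>"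
    and maximal: "consistent \<Delta>' \<Longrightarrow> \<Delta> \<subseteq> \<Delta>' \<Longrightarrow> \<Delta>' = \<Delta>"
    and witness: "\<exists>n. (inst p (Var n) \<^bold>\<longrightarrow> Forall p) \<in> \<Delta>"
begin

lemma mem_iff: "p \<in> \<Delta> \<longleftrightarrow> (\<Delta> \<turnstile> p)"
proof
  assume p: "\<Delta> \<turnstile> p"
  have "consistent (insert p \<Delta>)"
    using derives_cut[OF _ p] cons unfolding consistent_def by blast
  then show "p \<in> \<Delta>" using maximal by blast
qed (rule derives.Hyp)

lemma mem_Bot: "\<^bold>\<bottom> \<notin> \<Delta>"
  using cons by (simp add: mem_iff consistent_def)

lemma mem_Neg: "p \<notin> \<Delta> \<Longrightarrow> (\<^bold>\<not> p) \<in> \<Delta>"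
proof -
  assume "p \<notin> \<Delta>"
  then have "\<not> consistent (insert p \<Delta>)" using maximal by blast
  then show ?thesis unfolding mem_iff consistent_def using derives.ImpI by blast
qed

lemma mem_Imp: "(p \<^bold>\<longrightarrow> q) \<in> \<Delta> \<longleftrightarrow> (p \<in> \<Delta> \<longrightarrow> q \<in> \<Delta>)"
proof
  show "(p \<^bold>\<longrightarrow> q) \<in> \<Delta> \<Longrightarrow> p \<in> \<Delta> \<longrightarrow> q \<in> \<Delta>" unfolding mem_iff using derives.ImpE by blast
next
  assume *: "p \<in> \<Delta> \<longrightarrow> q \<in> \<Delta>"
  show "(p \<^bold>\<longrightarrow> q) \<in> \<Delta>"
  proof (cases "p \<in> \<Delta>")
    case True
    then have "\<Delta> \<turnstile> q" using * mem_iff by blast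
    then have "insert p \<Delta> \<turnstile> q" by (rule derives_mono) blast
    then show ?thesis unfolding mem_iff by (rule derives.ImpI)
  next
    case False
    then have "\<Delta> \<turnstile> \<^bold>\<not> p" using mem_Neg mem_iff by blast
    then have "insert p \<Delta> \<turnstile> \<^bold>\<not> p" by (rule derives_mono) blast
    then have "insert p \<Delta> \<turnstile> \<^bold>\<bottom>" by (rule derives.ImpE) (simp add: derives.Hyp)
    then show ?thesis unfolding mem_iff by (rule derives.ImpI[OF derives_explosion])
  qed
qed

lemma mem_Forall: "Forall p \<in> \<Delta> \<longleftrightarrow> (\<forall>t. inst p t \<in> \<Delta>)"
proof
  show "Forall p \<in> \<Delta> \<Longrightarrow> \<forall>t. inst p t \<in> \<Delta>" unfolding mem_iff using derives.ForallE by blast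
next
  assume "\<forall>t. inst p t \<in> \<Delta>"
  then show "Forall p \<in> \<Delta>" using witness[of p] mem_Imp by blast
qed

definition eqv :: "tm \<Rightarrow> tm \<Rightarrow> bool" where "eqv s t \<longleftrightarrow> (s \<^bold>= t) \<in> \<Delta>"

definition cls :: "tm \<Rightarrow> tm set" where "cls t = {s. eqv t s}"

text \<open>Apart from reflexivity this is the only rule for equality; symmetry, transitivity and
  congruence come from suitable formulas with \<open>Var 0\<close> as the hole.\<close>

lemma eqv_inst: "eqv s t \<Longrightarrow> inst p s \<in> \<Delta> \<Longrightarrow> inst p t \<in> \<Delta>"
  unfolding eqv_def mem_iff by (rule derives.EqlE)

lemma inst_weak [simp]: "subst_tm (case_nat t Var) (subst_tm (\<lambda>m. Var (Suc m)) s) = s"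
  by (simp add: subst_tm_comp)

lemma eqv_refl: "eqv t t"
  unfolding eqv_def mem_iff by (rule derives.EqlI)

lemma eqv_sym: assumes "eqv s t" shows "eqv t s"
  using eqv_inst[OF assms, of "Var 0 \<^bold>= subst_tm (\<lambda>m. Var (Suc m)) s"] eqv_refl[of s]
  by (simp add: inst_def eqv_def)

lemma eqv_trans: assumes "eqv s t" "eqv t u" shows "eqv s u"
  using eqv_inst[OF assms(2), of "subst_tm (\<lambda>m. Var (Suc m)) s \<^bold>= Var 0"] assms(1)
  by (simp add: inst_def eqv_def)

lemma cls_eq_iff: "cls s = cls t \<longleftrightarrow> eqv s t"
  unfolding cls_def using eqv_refl eqv_sym eqv_trans by blast

lemma eqv_Add: assumes "eqv s s'" "eqv t t'" shows "eqv (s \<^bold>+ t) (s' \<^bold>+ t')"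
proof -
  let ?w = "subst_tm (\<lambda>m. Var (Suc m))"
  have "eqv (s \<^bold>+ t) (s' \<^bold>+ t)"
    using eqv_inst[OF assms(1), of "?w (s \<^bold>+ t) \<^bold>= Var 0 \<^bold>+ ?w t"] eqv_refl[of "s \<^bold>+ t"]
    by (simp add: inst_def eqv_def)
  then show ?thesis
    using eqv_inst[OF assms(2), of "?w (s \<^bold>+ t) \<^bold>= ?w s' \<^bold>+ Var 0"]
    by (simp add: inst_def eqv_def)
qed

lemma eqv_Mul: assumes "eqv s s'" "eqv t t'" shows "eqv (s \<^bold>* t) (s' \<^bold>* t')"
proof -
  let ?w = "subst_tm (\<lambda>m. Var (Suc m))"
  have "eqv (s \<^bold>* t) (s' \<^bold>* t)"
    using eqv_inst[OF assms(1), of "?w (s \<^bold>* t) \<^bold>= Var 0 \<^bold>* ?w t"] eqv_refl[of "s \<^bold>* t"]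
    by (simp add: inst_def eqv_def)
  then show ?thesis
    using eqv_inst[OF assms(2), of "?w (s \<^bold>* t) \<^bold>= ?w s' \<^bold>* Var 0"]
    by (simp add: inst_def eqv_def)
qed

lemma mem_Less_cong: assumes "eqv s s'" "eqv t t'" "(s \<^bold>< t) \<in> \<Delta>" shows "(s' \<^bold>< t') \<in> \<Delta>"
proof -
  let ?w = "subst_tm (\<lambda>m. Var (Suc m))"
  have "(s' \<^bold>< t) \<in> \<Delta>"
    using eqv_inst[OF assms(1), of "Var 0 \<^bold>< ?w t"] assms(3) by (simp add: inst_def)
  then show ?thesis
    using eqv_inst[OF assms(2), of "?w s' \<^bold>< Var 0"] by (simp add: inst_def)
qed

definition rep :: "tm set \<Rightarrow> tm" where "rep C = (SOME t. cls t = C)"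

lemma eqv_rep: "eqv (rep (cls t)) t"
  unfolding cls_eq_iff[symmetric] rep_def by (rule someI[of "\<lambda>s. cls s = cls t"]) (rule refl)

lemma mem_Less_rep: "(rep (cls s) \<^bold>< rep (cls t)) \<in> \<Delta> \<longleftrightarrow> (s \<^bold>< t) \<in> \<Delta>"
  using mem_Less_cong[OF eqv_rep[of s] eqv_rep[of t]]
    mem_Less_cong[OF eqv_sym[OF eqv_rep[of s]] eqv_sym[OF eqv_rep[of t]]] by (rule iffI)

definition term_model :: "tm set struct" where
  "term_model = \<lparr>carr = range cls, zer = cls \<^bold>0, one = cls \<^bold>1,
     add = (\<lambda>a b. cls (rep a \<^bold>+ rep b)), mul = (\<lambda>a b. cls (rep a \<^bold>* rep b)),
     lt = (\<lambda>a b. (rep a \<^bold>< rep b) \<in> \<Delta>)\<rparr>"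

lemma is_struct_term_model: "is_struct term_model"
  by (auto simp: is_struct_def term_model_def)

lemma val_term_model: "val term_model (\<lambda>n. cls (\<sigma> n)) t = cls (subst_tm \<sigma> t)"
  by (induction t) (auto simp: term_model_def cls_eq_iff eqv_rep intro!: eqv_Add eqv_Mul)

text \<open>The truth lemma. An arbitrary \<sigma> is needed under a quantifier, where
  \<open>Var 0\<close> denotes the class of any term.\<close>

lemma sat_term_model: "sat term_model (\<lambda>n. cls (\<sigma> n)) p \<longleftrightarrow> subst_fm \<sigma> p \<in> \<Delta>"
proof (induction p arbitrary: \<sigma>)
  case (Eql s t)
  then show ?case by (simp add: val_term_model cls_eq_iff eqv_def)
next
  case (Less s t)
  then show ?case
    by (simp add: val_term_model) (simp add: term_model_def mem_Less_rep)
next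
  case (Forall p)
  have e: "case_nat (cls t) (\<lambda>n. cls (\<sigma> n)) = (\<lambda>n. cls (case_nat t \<sigma> n))" for t
    by (rule ext) (simp split: nat.split)
  have "sat term_model (\<lambda>n. cls (\<sigma> n)) (Forall p)
    \<longleftrightarrow> (\<forall>t. sat term_model (\<lambda>n. cls (case_nat t \<sigma> n)) p)"
    by (simp add: e[symmetric]) (simp add: term_model_def)
  also have "\<dots> \<longleftrightarrow> (\<forall>t. inst (subst_fm (under_binder \<sigma>) p) t \<in> \<Delta>)"
    by (simp add: Forall.IH inst_subst)
  finally show ?case by (simp add: mem_Forall)
qed (auto simp: mem_Bot mem_Imp)

end

text \<open>Testing structures over the single type \<open>tm set\<close> suffices, as the term
  models live there; an assumption cannot quantify over types.\<close>

theorem completeness: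
  assumes "\<And>q. q \<in> \<Gamma> \<Longrightarrow> sentence q" "sentence p"
    and "\<And>(S :: tm set struct) e. is_struct S \<Longrightarrow> range e \<subseteq> carr S \<Longrightarrow> (\<And>q. q \<in> \<Gamma> \<Longrightarrow> sat S e q) \<Longrightarrow> sat S e p"
  shows "\<Gamma> \<turnstile> p"
proof (rule ccontr)
  assume "\<not> (\<Gamma> \<turnstile> p)"
  then have "consistent (insert (\<^bold>\<not> p) \<Gamma>)" unfolding consistent_def using derives.Contr by blast
  moreover have "sentence q" if "q \<in> insert (\<^bold>\<not> p) \<Gamma>" for q
    using that assms(1,2) by (auto simp: sentence_def)
  ultimately show False
  proof (rule henkin_extension)
    fix \<Delta>
    assume \<Delta>: "insert (\<^bold>\<not> p) \<Gamma> \<subseteq> \<Delta>" "consistent \<Delta>"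
      "\<And>\<Delta>'. consistent \<Delta>' \<Longrightarrow> \<Delta> \<subseteq> \<Delta>' \<Longrightarrow> \<Delta>' = \<Delta>"
      "\<And>p. \<exists>n. (inst p (Var n) \<^bold>\<longrightarrow> Forall p) \<in> \<Delta>"
    interpret henkin_set \<Delta> by standard (fact \<Delta>)+
    define e where "e = (\<lambda>n. cls (Var n))"
    have sat: "sat term_model e q" if "q \<in> \<Delta>" for q
      unfolding e_def sat_term_model using that by simp
    have "sat term_model e p"
      by (rule assms(3)[OF is_struct_term_model]) (use sat \<Delta>(1) in \<open>auto simp: e_def term_model_def\<close>)
    moreover have "sat term_model e (\<^bold>\<not> p)" using sat \<Delta>(1) by blast
    ultimately show False by simp
  qed
qed

section \<open>Homogeneous structures\<close>

lemma free_bound_funpow_Forall: "free_bound ((Forall ^^ n) p) = free_bound p - n"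
  by (induction n) auto

lemma sentence_universal_closure: "sentence (universal_closure p)"
  by (simp add: sentence_def universal_closure_def free_bound_funpow_Forall)

lemma sat_universal_closure:
  assumes "\<And>e. range e \<subseteq> carr S \<Longrightarrow> sat S e p" "range e \<subseteq> carr S"
  shows "sat S e (universal_closure p)"
proof -
  have "range e \<subseteq> carr S \<Longrightarrow> sat S e ((Forall ^^ n) p)" for n
  proof (induction n arbitrary: e)
    case (Suc n)
    have "sat S (case_nat x e) ((Forall ^^ n) p)" if "x \<in> carr S" for x
      using that Suc.prems by (intro Suc.IH) (auto simp: image_subset_iff split: nat.split)
    then show ?case by simp
  qed (use assms(1) in simp)
  then show ?thesis using assms(2) by (simp add: universal_closure_def)
qed

abbreviation exists_pow :: "nat \<Rightarrow> fm \<Rightarrow> fm" where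
  "exists_pow n \<equiv> (\<lambda>p. Exists p) ^^ n"

lemma free_bound_exists_pow: "free_bound (exists_pow n p) = free_bound p - n"
  by (induction n) auto

lemma Sigma1_exists_pow: "Delta0 p \<Longrightarrow> Sigma1 (exists_pow n p)"
  by (induction n) (auto intro: Sigma1.intros)

lemma sat_exists_pow:
  "sat S e (exists_pow n p) \<longleftrightarrow>
    (\<exists>e'. (\<forall>i<n. e' i \<in> carr S) \<and> (\<forall>i. e' (n + i) = e i) \<and> sat S e' p)"
proof (induction n arbitrary: e)
  case 0
  have "e' = e" if "\<forall>i. e' i = e i" for e' using that by (auto simp: fun_eq_iff)
  then show ?case by auto
next
  case (Suc n)
  have *: "(\<forall>i. e' (n + i) = case_nat x e i) \<longleftrightarrow> e' n = x \<and> (\<forall>i. e' (Suc n + i) = e i)" for e' x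
  proof -
    have "(\<forall>i. P i) \<longleftrightarrow> P 0 \<and> (\<forall>i. P (Suc i))" for P by (metis not0_implies_Suc)
    from this[of "\<lambda>i. e' (n + i) = case_nat x e i"] show ?thesis by simp
  qed
  have "sat S e (exists_pow (Suc n) p) \<longleftrightarrow> (\<exists>x\<in>carr S. sat S (case_nat x e) (exists_pow n p))"
    by simp
  also have "\<dots> \<longleftrightarrow> (\<exists>e'. (\<forall>i<Suc n. e' i \<in> carr S) \<and> (\<forall>i. e' (Suc n + i) = e i) \<and> sat S e' p)"
    unfolding Suc.IH * by (auto simp: less_Suc_eq)
  finally show ?case .
qed

primrec depth :: "fm \<Rightarrow> nat" where
  "depth \<^bold>\<bottom> = 0"
| "depth (s \<^bold>= t) = 0"
| "depth (s \<^bold>< t) = 0"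
| "depth (p \<^bold>\<longrightarrow> q) = max (depth p) (depth q)"
| "depth (Forall p) = Suc (depth p)"

text \<open>A position \<open>p\<close> plays the role of a code for the partial isomorphism
  \<open>F p\<close>. With pairs of elements as positions each assumption is first-order, so it can
  be imposed on structures whose codes no longer stand for finite sets.\<close>

locale homogeneous =
  fixes S :: "'a struct" and Pos :: "'p set" and F :: "'p \<Rightarrow> 'a \<Rightarrow> 'a \<Rightarrow> bool"
    and ll :: "'a \<Rightarrow> 'a \<Rightarrow> bool"
  assumes is_struct: "is_struct S"
    and F_zer: "p \<in> Pos \<Longrightarrow> F p (zer S) (zer S)"
    and F_one: "p \<in> Pos \<Longrightarrow> F p (one S) (one S)"
    and F_ops: "p \<in> Pos \<Longrightarrow> x \<in> carr S \<Longrightarrow> x' \<in> carr S \<Longrightarrow> y \<in> carr S \<Longrightarrow> y' \<in> carr S \<Longrightarrow>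
      F p x x' \<Longrightarrow> F p y y' \<Longrightarrow> F p (add S x y) (add S x' y') \<and> F p (mul S x y) (mul S x' y') \<and>
        (lt S x y \<longleftrightarrow> lt S x' y') \<and> (x = y \<longleftrightarrow> x' = y')"
    and forth_step: "p \<in> Pos \<Longrightarrow> y \<in> carr S \<Longrightarrow> \<exists>q\<in>Pos. \<exists>y'\<in>carr S.
      (\<forall>x\<in>carr S. \<forall>x'\<in>carr S. F p x x' \<longrightarrow> F q x x') \<and> F q y y'"
    and back_step: "p \<in> Pos \<Longrightarrow> y' \<in> carr S \<Longrightarrow> \<exists>q\<in>Pos. \<exists>y\<in>carr S.
      (\<forall>x\<in>carr S. \<forall>x'\<in>carr S. F p x x' \<longrightarrow> F q x x') \<and> F q y y'"
    and id_start: "a \<in> carr S \<Longrightarrow> w \<in> carr S \<Longrightarrow> ll a w \<Longrightarrow> \<exists>p\<in>Pos.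
      \<forall>x\<in>carr S. \<forall>x'\<in>carr S. F p x x' \<longrightarrow> x' = x \<and> ll x w"
    and id_step: "p \<in> Pos \<Longrightarrow> w \<in> carr S \<Longrightarrow> \<forall>x\<in>carr S. \<forall>x'\<in>carr S. F p x x' \<longrightarrow> x' = x \<and> ll x w \<Longrightarrow>
      y \<in> carr S \<Longrightarrow> ll y w \<Longrightarrow> \<exists>q\<in>Pos.
      (\<forall>x\<in>carr S. \<forall>x'\<in>carr S. F p x x' \<longrightarrow> F q x x') \<and> F q y y \<and>
      (\<forall>x\<in>carr S. \<forall>x'\<in>carr S. F q x x' \<longrightarrow> x' = x \<and> ll x w)"
    and move_step: "p \<in> Pos \<Longrightarrow> w \<in> carr S \<Longrightarrow> \<forall>x\<in>carr S. \<forall>x'\<in>carr S. F p x x' \<longrightarrow> x' = x \<and> ll x w \<Longrightarrow>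
      y \<in> carr S \<Longrightarrow> \<exists>q\<in>Pos. \<exists>y'\<in>carr S.
      (\<forall>x\<in>carr S. \<forall>x'\<in>carr S. F p x x' \<longrightarrow> F q x x') \<and> F q y y' \<and> ll y' w"
    and ll_bound: "a \<in> carr S \<Longrightarrow> b \<in> carr S \<Longrightarrow> \<exists>w\<in>carr S. ll a w \<and> ll b w"
    and ll_trans: "a \<in> carr S \<Longrightarrow> b \<in> carr S \<Longrightarrow> c \<in> carr S \<Longrightarrow> ll a b \<Longrightarrow> ll b c \<Longrightarrow> ll a c"
    and ll_less: "a \<in> carr S \<Longrightarrow> w \<in> carr S \<Longrightarrow> ll a w \<Longrightarrow> lt S a w"
    and less_ll: "a \<in> carr S \<Longrightarrow> b \<in> carr S \<Longrightarrow> w \<in> carr S \<Longrightarrow> lt S a b \<Longrightarrow> ll b w \<Longrightarrow> ll a w"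
begin

lemma val_F:
  assumes "p \<in> Pos" "\<And>n. n < free_bound_tm t \<Longrightarrow> e n \<in> carr S \<and> e' n \<in> carr S \<and> F p (e n) (e' n)"
  shows "val S e t \<in> carr S \<and> val S e' t \<in> carr S \<and> F p (val S e t) (val S e' t)"
  using assms(2)
proof (induction t)
  case (Add s t)
  then have "val S e s \<in> carr S \<and> val S e' s \<in> carr S \<and> F p (val S e s) (val S e' s)"
    "val S e t \<in> carr S \<and> val S e' t \<in> carr S \<and> F p (val S e t) (val S e' t)" by simp_all
  then show ?case using F_ops[OF assms(1)] is_struct by (simp add: is_struct_def)
next
  case (Mul s t)
  then have "val S e s \<in> carr S \<and> val S e' s \<in> carr S \<and> F p (val S e s) (val S e' s)"
    "val S e t \<in> carr S \<and> val S e' t \<in> carr S \<and> F p (val S e t) (val S e' t)" by simp_all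
  then show ?case using F_ops[OF assms(1)] is_struct by (simp add: is_struct_def)
qed (use F_zer[OF assms(1)] F_one[OF assms(1)] is_struct in \<open>simp_all add: is_struct_def\<close>)

text \<open>The usual back-and-forth argument: at a quantifier the position is extended by the new
  value.\<close>

lemma sat_F:
  assumes "p \<in> Pos" "\<And>n. n < free_bound \<phi> \<Longrightarrow> e n \<in> carr S \<and> e' n \<in> carr S \<and> F p (e n) (e' n)"
  shows "sat S e \<phi> \<longleftrightarrow> sat S e' \<phi>"
  using assms
proof (induction \<phi> arbitrary: p e e')
  case (Eql s t)
  have "val S e s \<in> carr S \<and> val S e' s \<in> carr S \<and> F p (val S e s) (val S e' s)"
    "val S e t \<in> carr S \<and> val S e' t \<in> carr S \<and> F p (val S e t) (val S e' t)"
    by (rule val_F[OF Eql.prems(1)]; use Eql.prems(2) in simp)+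
  then show ?case using F_ops[OF Eql.prems(1)] by simp
next
  case (Less s t)
  have "val S e s \<in> carr S \<and> val S e' s \<in> carr S \<and> F p (val S e s) (val S e' s)"
    "val S e t \<in> carr S \<and> val S e' t \<in> carr S \<and> F p (val S e t) (val S e' t)"
    by (rule val_F[OF Less.prems(1)]; use Less.prems(2) in simp)+
  then show ?case using F_ops[OF Less.prems(1)] by simp
next
  case (Imp \<phi> \<psi>)
  have "sat S e \<phi> \<longleftrightarrow> sat S e' \<phi>" by (rule Imp.IH(1)[OF Imp.prems(1)]) (use Imp.prems(2) in simp)
  moreover have "sat S e \<psi> \<longleftrightarrow> sat S e' \<psi>" by (rule Imp.IH(2)[OF Imp.prems(1)]) (use Imp.prems(2) in simp)
  ultimately show ?case by simp
next
  case (Forall \<phi>)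
  have step: "sat S (case_nat y e) \<phi> \<longleftrightarrow> sat S (case_nat y' e') \<phi>"
    if q: "q \<in> Pos" "\<forall>x\<in>carr S. \<forall>x'\<in>carr S. F p x x' \<longrightarrow> F q x x'" "F q y y'" "y \<in> carr S" "y' \<in> carr S"
    for q y y'
  proof (rule Forall.IH[OF q(1)])
    fix n assume "n < free_bound \<phi>"
    then show "case_nat y e n \<in> carr S \<and> case_nat y' e' n \<in> carr S \<and> F q (case_nat y e n) (case_nat y' e' n)"
      using q Forall.prems(2)[of "n - 1"] by (cases n) auto
  qed
  have "sat S (case_nat y' e') \<phi>" if "y' \<in> carr S" "sat S e (Forall \<phi>)" for y'
    using back_step[OF Forall.prems(1) that(1)] step that by auto
  moreover have "sat S (case_nat y e) \<phi>" if "y \<in> carr S" "sat S e' (Forall \<phi>)" for y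
    using forth_step[OF Forall.prems(1) that(1)] step that by auto
  ultimately show ?case by simp blast
qed simp

text \<open>One \<open>id_step\<close> for each parameter. The separate \<open>a\<close> gives
  \<open>id_start\<close> an element far below \<open>w\<close> even if
  \<open>k = 0\<close>.\<close>

lemma id_position:
  fixes k :: nat
  assumes w: "a \<in> carr S" "w \<in> carr S" "ll a w" and "\<And>n. n < k \<Longrightarrow> e n \<in> carr S \<and> ll (e n) w"
  shows "\<exists>p\<in>Pos. (\<forall>x\<in>carr S. \<forall>x'\<in>carr S. F p x x' \<longrightarrow> x' = x \<and> ll x w) \<and> (\<forall>n<k. F p (e n) (e n))"
  using assms(4)
proof (induction k)
  case 0
  then show ?case using id_start[OF w] by simp
next
  case (Suc k)
  then obtain p where p: "p \<in> Pos" "\<forall>x\<in>carr S. \<forall>x'\<in>carr S. F p x x' \<longrightarrow> x' = x \<and> ll x w"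
    "\<forall>n<k. F p (e n) (e n)" by (metis less_Suc_eq)
  have k: "e k \<in> carr S" "ll (e k) w" using Suc.prems by auto
  from id_step[OF p(1) w(2) p(2) k] obtain q where q: "q \<in> Pos"
    "\<forall>x\<in>carr S. \<forall>x'\<in>carr S. F p x x' \<longrightarrow> F q x x'" "F q (e k) (e k)"
    "\<forall>x\<in>carr S. \<forall>x'\<in>carr S. F q x x' \<longrightarrow> x' = x \<and> ll x w" by (elim bexE conjE)
  have "\<forall>n<Suc k. F q (e n) (e n)" using q(2,3) p(3) Suc.prems by (simp add: less_Suc_eq)
  with q show ?case by blast
qed

text \<open>A position that fixes the parameters is extended so as to carry \<open>y\<close> far
  below \<open>w\<close>; by \<open>sat_F\<close> the truth of \<phi> is carried along.\<close>

lemma witness_below: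
  assumes w: "a \<in> carr S" "w \<in> carr S" "ll a w" and e: "\<And>n. n < k \<Longrightarrow> e n \<in> carr S \<and> ll (e n) w"
    and \<phi>: "free_bound \<phi> \<le> Suc k" "y \<in> carr S" "sat S (case_nat y e) \<phi>"
  shows "\<exists>y'\<in>carr S. ll y' w \<and> sat S (case_nat y' e) \<phi>"
proof -
  obtain p where p: "p \<in> Pos" "\<forall>x\<in>carr S. \<forall>x'\<in>carr S. F p x x' \<longrightarrow> x' = x \<and> ll x w"
    "\<forall>n<k. F p (e n) (e n)" using id_position[where k = k and e = e, OF w e] by blast
  from move_step[OF p(1) w(2) p(2) \<phi>(2)] obtain q y' where q: "q \<in> Pos" "y' \<in> carr S"
    "\<forall>x\<in>carr S. \<forall>x'\<in>carr S. F p x x' \<longrightarrow> F q x x'" "F q y y'" "ll y' w" by (elim bexE conjE)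
  have "sat S (case_nat y e) \<phi> \<longleftrightarrow> sat S (case_nat y' e) \<phi>"
  proof (rule sat_F[OF q(1)])
    fix n assume "n < free_bound \<phi>"
    then show "case_nat y e n \<in> carr S \<and> case_nat y' e n \<in> carr S \<and> F q (case_nat y e n) (case_nat y' e n)"
      using q \<phi>(1,2) p(3) e[of "n - 1"] by (cases n) simp_all
  qed
  then show ?thesis using q \<phi>(3) by blast
qed

lemma bound_exists:
  fixes k :: nat
  assumes "\<And>n. e n \<in> carr S"
  shows "\<exists>w\<in>carr S. \<forall>n<Suc k. ll (e n) w"
proof (induction k)
  case 0
  then show ?case using ll_bound[OF assms[of 0] assms[of 0]] by auto
next
  case (Suc k)
  then obtain w where w: "w \<in> carr S" "\<forall>n<Suc k. ll (e n) w" by blast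
  obtain w' where w': "w' \<in> carr S" "ll w w'" "ll (e (Suc k)) w'"
    using ll_bound[OF w(1) assms] by blast
  then have "\<forall>n<Suc (Suc k). ll (e n) w'" using w ll_trans[OF assms w(1) w'(1)] by (simp add: less_Suc_eq)
  then show ?case using w'(1) by blast
qed

text \<open>One \<open>w\<close> far above \<open>v\<close> and the parameters serves all
  \<open>x < v\<close>, since these are then far below \<open>w\<close> as well.\<close>

lemma sat_collection:
  assumes "range e \<subseteq> carr S"
  shows "sat S e (collection p)"
proof -
  have e: "e n \<in> carr S" for n using assms by auto
  define c where "c = (\<lambda>n. e (Suc n))"
  have env1: "(\<lambda>n. val S (case_nat y (case_nat x e)) (Var (if n < 2 then n else n + 1)))
      = case_nat y (case_nat x c)" for x y
    by (rule ext) (auto simp: c_def numeral_2_eq_2 split: nat.split)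
  have env2: "(\<lambda>n. val S (case_nat y (case_nat x (case_nat w e))) (Var (if n < 2 then n else n + 2)))
      = case_nat y (case_nat x c)" for x y w
    by (rule ext) (auto simp: c_def numeral_2_eq_2 split: nat.split)
  have "\<exists>w\<in>carr S. \<forall>x\<in>carr S. lt S x (e 0) \<longrightarrow>
      (\<exists>y\<in>carr S. lt S y w \<and> sat S (case_nat y (case_nat x c)) p)"
    if hyp: "\<forall>x\<in>carr S. lt S x (e 0) \<longrightarrow> (\<exists>y\<in>carr S. sat S (case_nat y (case_nat x c)) p)"
  proof -
    \<comment> \<open>The \<open>Suc\<close> ensures that \<open>v\<close>, which is
      \<open>e 0\<close>, is among the elements below \<open>w\<close>.\<close>
    obtain w where w: "w \<in> carr S" "\<forall>n<Suc (free_bound p). ll (e n) w"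
      using bound_exists[where k = "free_bound p" and e = e, OF e] by (rule bexE)
    have "\<exists>y\<in>carr S. lt S y w \<and> sat S (case_nat y (case_nat x c)) p" if x: "x \<in> carr S" "lt S x (e 0)" for x
    proof -
      obtain y where y: "y \<in> carr S" "sat S (case_nat y (case_nat x c)) p" using hyp x by blast
      have e0: "ll (e 0) w" using w(2) by simp
      have "\<exists>y'\<in>carr S. ll y' w \<and> sat S (case_nat y' (case_nat x c)) p"
      proof (rule witness_below[OF e w(1) e0 _ _ y])
        fix n assume "n < free_bound p"
        then show "case_nat x c n \<in> carr S \<and> ll (case_nat x c n) w"
          using w x e less_ll[OF x(1) e w(1) x(2) e0] by (cases n) (simp_all add: c_def)
      qed simp
      then show ?thesis using ll_less w(1) by blast
    qed
    then show ?thesis using w(1) by blast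
  qed
  moreover have "sat S e (collection p) \<longleftrightarrow>
    ((\<forall>x\<in>carr S. lt S x (e 0) \<longrightarrow> (\<exists>y\<in>carr S. sat S (case_nat y (case_nat x c)) p)) \<longrightarrow>
    (\<exists>w\<in>carr S. \<forall>x\<in>carr S. lt S x (e 0) \<longrightarrow>
      (\<exists>y\<in>carr S. lt S y w \<and> sat S (case_nat y (case_nat x c)) p)))"
    unfolding collection_def sat.simps sat_subst env1 env2 by (simp add: numeral_2_eq_2)
  ultimately show ?thesis by blast
qed

end

text \<open>
  Below, \<open>lf i j\<close> is a bounded formula for \<open>Var i\<close> being far below \<open>Var j\<close>. Under \<open>k\<close> quantifiers
  the bounds \<open>w 0, w 1, \<dots>\<close> are the variables with indices \<open>k, k + 1, \<dots>\<close>, and a quantifier below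
  \<open>k\<close> others is bounded by \<open>w (Suc k)\<close>.
\<close>

primrec relativise :: "(nat \<Rightarrow> nat \<Rightarrow> fm) \<Rightarrow> fm \<Rightarrow> nat \<Rightarrow> fm" where
  "relativise lf \<^bold>\<bottom> k = \<^bold>\<bottom>"
| "relativise lf (s \<^bold>= t) k = (s \<^bold>= t)"
| "relativise lf (s \<^bold>< t) k = (s \<^bold>< t)"
| "relativise lf (p \<^bold>\<longrightarrow> q) k = (relativise lf p k \<^bold>\<longrightarrow> relativise lf q k)"
| "relativise lf (Forall p) k = Forall (Var 0 \<^bold>\<le> Var (Suc (k + Suc k)) \<^bold>\<longrightarrow>
     (lf 0 (Suc (k + Suc k)) \<^bold>\<longrightarrow> relativise lf p (Suc k)))"

primrec chain :: "(nat \<Rightarrow> nat \<Rightarrow> fm) \<Rightarrow> nat \<Rightarrow> fm" where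
  "chain lf 0 = (\<^bold>\<bottom> \<^bold>\<longrightarrow> \<^bold>\<bottom>)"
| "chain lf (Suc n) = (lf n (Suc n) \<^bold>\<and> chain lf n)"

text \<open>One bound for each level of nesting, and \<open>w 0\<close>, which bounds no quantifier:
  it is the element far below \<open>w 1\<close> that \<open>witness_below\<close> asks for.\<close>

definition sigma :: "(nat \<Rightarrow> nat \<Rightarrow> fm) \<Rightarrow> fm \<Rightarrow> fm" where
  "sigma lf p = exists_pow (Suc (depth p)) (chain lf (depth p) \<^bold>\<and> relativise lf p 0)"

lemma Delta0_Con: "Delta0 p \<Longrightarrow> Delta0 q \<Longrightarrow> Delta0 (p \<^bold>\<and> q)"
  and Delta0_Dis: "Delta0 p \<Longrightarrow> Delta0 q \<Longrightarrow> Delta0 (p \<^bold>\<or> q)"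
  by (intro Delta0.intros; assumption)+

lemma Sigma1_sigma:
  assumes "\<And>i j. Delta0 (lf i j)"
  shows "Sigma1 (sigma lf p)"
proof -
  have "Delta0 (chain lf n)" for n
    by (induction n) (auto intro!: Delta0_Con assms Delta0.intros(1,4))
  moreover have "Delta0 (relativise lf p k)" for k
    by (induction p arbitrary: k) (simp_all add: Delta0.intros assms)
  ultimately show ?thesis unfolding sigma_def by (intro Sigma1_exists_pow Delta0_Con)
qed

lemma sentence_sigma:
  assumes lf: "\<And>i j. free_bound (lf i j) \<le> Suc (max i j)" and "sentence p"
  shows "sentence (sigma lf p)"
proof -
  have "free_bound (chain lf n) \<le> Suc n" for n
  proof (induction n)
    case (Suc n)
    then show ?case using lf[of n "Suc n"] by simp
  qed simp
  \<comment> \<open>The last bound occurring under \<open>k\<close> quantifiers is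
    \<open>w (k + depth p)\<close>, the variable with index
    \<open>k + (k + depth p)\<close>.\<close>
  moreover have "free_bound p \<le> k \<Longrightarrow> free_bound (relativise lf p k) \<le> Suc (k + (k + depth p))" for k
  proof (induction p arbitrary: k)
    case (Forall p)
    have "free_bound (relativise lf p (Suc k)) \<le> Suc (Suc k + (Suc k + depth p))"
      by (rule Forall.IH) (use Forall.prems in simp)
    then show ?case using lf[of 0 "Suc (k + Suc k)"] by simp
  next
    case (Imp p q)
    have "free_bound (relativise lf p k) \<le> Suc (k + (k + depth p))"
      "free_bound (relativise lf q k) \<le> Suc (k + (k + depth q))"
      using Imp.IH[of k] Imp.prems by simp_all
    then show ?case by (simp add: max_def)
  qed simp_all
  from this[of 0] have "free_bound (relativise lf p 0) \<le> Suc (depth p)"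
    using assms(2) by (simp add: sentence_def)
  ultimately show ?thesis unfolding sentence_def sigma_def free_bound_exists_pow by simp
qed

context homogeneous begin

text \<open>The invariant is that the values of the free variables are far below \<open>w k\<close>,
  which is \<open>e (k + k)\<close>. They are then far below \<open>w (Suc k)\<close>, and by
  \<open>witness_below\<close> a counterexample to a universal formula can be found far below
  \<open>w (Suc k)\<close>.\<close>

lemma sat_relativise:
  assumes lf: "\<And>e i j. e i \<in> carr S \<Longrightarrow> e j \<in> carr S \<Longrightarrow> sat S e (lf i j) \<longleftrightarrow> ll (e i) (e j)"
  shows "free_bound p \<le> k \<Longrightarrow> k + depth p \<le> d \<Longrightarrow> (\<And>i. i < k \<Longrightarrow> e i \<in> carr S \<and> ll (e i) (e (k + k)))
    \<Longrightarrow> (\<And>j. j \<le> d \<Longrightarrow> e (k + j) \<in> carr S) \<Longrightarrow> (\<And>j. j < d \<Longrightarrow> ll (e (k + j)) (e (k + Suc j)))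
    \<Longrightarrow> sat S e (relativise lf p k) \<longleftrightarrow> sat S e p"
proof (induction p arbitrary: k e)
  case (Imp p q)
  have "sat S e (relativise lf p k) \<longleftrightarrow> sat S e p"
    by (rule Imp.IH(1)) (use Imp.prems in simp_all)
  moreover have "sat S e (relativise lf q k) \<longleftrightarrow> sat S e q"
    by (rule Imp.IH(2)) (use Imp.prems in simp_all)
  ultimately show ?case by simp
next
  case (Forall p)
  define w where "w = e (k + Suc k)"
  have fb: "free_bound p \<le> Suc k" using Forall.prems(1) by simp
  have kd: "k < d" "Suc k \<le> d" using Forall.prems(2) by simp_all
  have w: "w \<in> carr S" unfolding w_def using Forall.prems(4) kd by blast
  have v: "e (k + k) \<in> carr S" "ll (e (k + k)) w" unfolding w_def using Forall.prems(4,5) kd by simp_all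
  have e: "e i \<in> carr S \<and> ll (e i) w" if "i < k" for i
    using Forall.prems(3)[OF that] ll_trans[OF _ v(1) w _ v(2)] by blast
  have IH: "sat S (case_nat y e) (relativise lf p (Suc k)) \<longleftrightarrow> sat S (case_nat y e) p"
    if y: "y \<in> carr S" "ll y w" for y
  proof (rule Forall.IH)
    fix i assume "i < Suc k"
    then show "case_nat y e i \<in> carr S \<and> ll (case_nat y e i) (case_nat y e (Suc k + Suc k))"
      using y e[of "i - 1"] by (cases i) (simp_all add: w_def)
  qed (use Forall.prems in simp_all)
  have lf0: "sat S (case_nat y e) (lf 0 (Suc (k + Suc k))) \<longleftrightarrow> ll y w" if "y \<in> carr S" for y
    using lf[of "case_nat y e" 0 "Suc (k + Suc k)"] that w by (simp add: w_def)
  have pointwise: "sat S (case_nat y e) (Var 0 \<^bold>\<le> Var (Suc (k + Suc k)) \<^bold>\<longrightarrow>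
        (lf 0 (Suc (k + Suc k)) \<^bold>\<longrightarrow> relativise lf p (Suc k))) \<longleftrightarrow>
      (lt S y w \<or> y = w \<longrightarrow> ll y w \<longrightarrow> sat S (case_nat y e) (relativise lf p (Suc k)))"
    if "y \<in> carr S" for y
    unfolding sat.simps lf0[OF that] by (auto simp: w_def)
  have "sat S e (relativise lf (Forall p) k) \<longleftrightarrow>
      (\<forall>y\<in>carr S. lt S y w \<or> y = w \<longrightarrow> ll y w \<longrightarrow> sat S (case_nat y e) (relativise lf p (Suc k)))"
    unfolding relativise.simps sat.simps(5) by (rule ball_cong[OF refl pointwise])
  \<comment> \<open>The comparison with \<open>w\<close>, present for the syntactic form of a
    bounded quantifier, follows from \<open>ll y w\<close>.\<close>
  also have "\<dots> \<longleftrightarrow> (\<forall>y\<in>carr S. ll y w \<longrightarrow> sat S (case_nat y e) p)"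
    using IH ll_less[OF _ w] by blast
  also have "\<dots> \<longleftrightarrow> (\<forall>y\<in>carr S. sat S (case_nat y e) p)"
  proof (intro iffI ballI impI)
    fix y assume *: "\<forall>y\<in>carr S. ll y w \<longrightarrow> sat S (case_nat y e) p" "y \<in> carr S"
    show "sat S (case_nat y e) p"
    proof (rule ccontr)
      assume "\<not> sat S (case_nat y e) p"
      then have "\<exists>y'\<in>carr S. ll y' w \<and> sat S (case_nat y' e) (\<^bold>\<not> p)"
        using *(2) fb by (intro witness_below[OF v(1) w v(2) e]) simp_all
      then show False using *(1) by auto
    qed
  qed blast
  finally show ?case by simp
qed simp_all

lemma chain_exists: "\<exists>e. (\<forall>i. e i \<in> carr S) \<and> (\<forall>i. ll (e i) (e (Suc i)))"
proof -
  have "\<exists>f. f 0 = zer S \<and> (\<forall>n. f n \<in> carr S \<and> ll (f n) (f (Suc n)))"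
  proof -
    obtain g where g: "\<And>a. a \<in> carr S \<Longrightarrow> g a \<in> carr S \<and> ll a (g a)"
      using ll_bound by metis
    have "(g ^^ n) (zer S) \<in> carr S" for n
      using is_struct g by (induction n) (auto simp: is_struct_def)
    then show ?thesis using g by (intro exI[of _ "\<lambda>n. (g ^^ n) (zer S)"]) simp
  qed
  then show ?thesis by blast
qed

text \<open>Along any chain of bounds the relativised formula has the truth value of
  \<open>p\<close>, and such chains exist.\<close>

lemma sat_sigma:
  assumes lf: "\<And>e i j. e i \<in> carr S \<Longrightarrow> e j \<in> carr S \<Longrightarrow> sat S e (lf i j) \<longleftrightarrow> ll (e i) (e j)"
    and p: "sentence p"
  shows "sat S e (sigma lf p) \<longleftrightarrow> sat S e p"
proof -
  define d where "d = depth p"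
  have chain: "sat S e' (chain lf n) \<longleftrightarrow> (\<forall>j<n. ll (e' j) (e' (Suc j)))"
    if "\<And>j. j \<le> n \<Longrightarrow> e' j \<in> carr S" for e' n
    using that
  proof (induction n)
    case (Suc n)
    have "sat S e' (chain lf n) \<longleftrightarrow> (\<forall>j<n. ll (e' j) (e' (Suc j)))" by (rule Suc.IH) (simp add: Suc.prems)
    moreover have "sat S e' (lf n (Suc n)) \<longleftrightarrow> ll (e' n) (e' (Suc n))" by (rule lf) (simp_all add: Suc.prems)
    ultimately show ?case by (auto simp: less_Suc_eq)
  qed simp
  have rel: "sat S e' (relativise lf p 0) \<longleftrightarrow> sat S e p"
    if "\<forall>i<Suc d. e' i \<in> carr S" "\<forall>j<d. ll (e' j) (e' (Suc j))" for e'
  proof -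
    have "sat S e' (relativise lf p 0) \<longleftrightarrow> sat S e' p"
      by (rule sat_relativise[OF lf, where d = d]) (use that p in \<open>simp_all add: sentence_def d_def\<close>)
    also have "\<dots> \<longleftrightarrow> sat S e p" by (rule sat_sentence[OF p])
    finally show ?thesis .
  qed
  obtain f where f: "\<forall>i. f i \<in> carr S" "\<forall>i. ll (f i) (f (Suc i))" using chain_exists by blast
  show ?thesis
  proof
    assume "sat S e (sigma lf p)"
    then obtain e' where e': "\<forall>i<Suc d. e' i \<in> carr S" "sat S e' (chain lf d)" "sat S e' (relativise lf p 0)"
      unfolding sigma_def sat_exists_pow d_def[symmetric] by auto
    then show "sat S e p" using rel[OF e'(1)] chain[of d e'] by simp
  next
    assume "sat S e p"
    define e' where "e' = (\<lambda>i. if i < Suc d then f i else e (i - Suc d))"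
    have 1: "\<forall>i<Suc d. e' i \<in> carr S" "\<forall>j<d. ll (e' j) (e' (Suc j))" using f by (simp_all add: e'_def)
    then have "sat S e' (chain lf d \<^bold>\<and> relativise lf p 0)"
      using rel[OF 1] \<open>sat S e p\<close> chain[of d e'] by simp
    then show "sat S e (sigma lf p)"
      unfolding sigma_def sat_exists_pow d_def[symmetric] using 1
      by (intro exI[of _ e']) (simp add: e'_def)
  qed
qed

end

section \<open>The axiom of homogeneity\<close>

text \<open>\<open>gen\<close> for arbitrary structures, which lack subtraction:
  \<open>c - y\<close> becomes a \<open>z\<close> with \<open>y + z = c\<close>, itself bounded by
  \<open>c\<close> so that the formula is bounded.\<close>

definition s_gen :: "'a struct \<Rightarrow> 'a \<Rightarrow> bool" where
  "s_gen S c \<longleftrightarrow> lt S (add S (add S (add S (add S (one S) (one S)) (one S)) (one S)) (one S)) c \<and>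
    (\<forall>y\<in>carr S. lt S y c \<or> y = c \<longrightarrow> lt S (mul S y y) c \<or>
      (\<exists>z\<in>carr S. (lt S z c \<or> z = c) \<and> add S y z = c \<and> lt S (mul S z z) c))"

definition gen_fm :: "nat \<Rightarrow> fm" where
  "gen_fm c = (\<^bold>1 \<^bold>+ \<^bold>1 \<^bold>+ \<^bold>1 \<^bold>+ \<^bold>1 \<^bold>+ \<^bold>1 \<^bold>< Var c \<^bold>\<and>
    Forall (Var 0 \<^bold>\<le> Var (Suc c) \<^bold>\<longrightarrow> (Var 0 \<^bold>* Var 0 \<^bold>< Var (Suc c) \<^bold>\<or>
      Exists (Var 0 \<^bold>\<le> Var (Suc (Suc c)) \<^bold>\<and> (Var 1 \<^bold>+ Var 0 \<^bold>= Var (Suc (Suc c)) \<^bold>\<and>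
        Var 0 \<^bold>* Var 0 \<^bold>< Var (Suc (Suc c)))))))"

lemma sat_gen_fm: "sat S e (gen_fm c) \<longleftrightarrow> s_gen S (e c)"
  unfolding gen_fm_def s_gen_def by simp blast

definition s_ll :: "'a struct \<Rightarrow> 'a \<Rightarrow> 'a \<Rightarrow> bool" where
  "s_ll S a w \<longleftrightarrow> s_gen S w \<and> lt S (mul S a a) w"

definition ll_fm :: "nat \<Rightarrow> nat \<Rightarrow> fm" where
  "ll_fm a w = (gen_fm w \<^bold>\<and> Var a \<^bold>* Var a \<^bold>< Var w)"

lemma sat_ll_fm: "sat S e (ll_fm a w) \<longleftrightarrow> s_ll S (e a) (e w)"
  by (simp add: ll_fm_def s_ll_def sat_gen_fm)

lemma Delta0_ll_fm: "Delta0 (ll_fm a w)"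
  unfolding ll_fm_def gen_fm_def by (intro Delta0_Con Delta0_Dis Delta0.intros)

lemma free_bound_ll_fm: "free_bound (ll_fm a w) \<le> Suc (max a w)"
  by (simp add: ll_fm_def gen_fm_def)

definition s_mem :: "'a struct \<Rightarrow> 'a \<Rightarrow> 'a \<Rightarrow> 'a \<Rightarrow> 'a \<Rightarrow> bool" where
  "s_mem S Y P x x' \<longleftrightarrow> s_ll S x Y \<and> s_ll S x' Y \<and>
    (\<exists>q\<in>carr S. mul S (add S Y (add S (mul S (add S x x') (add S x x')) x')) q = P)"

definition mem_fm :: "nat \<Rightarrow> nat \<Rightarrow> nat \<Rightarrow> nat \<Rightarrow> fm" where
  "mem_fm Y P x x' = (ll_fm x Y \<^bold>\<and> ll_fm x' Y \<^bold>\<and>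
    Exists ((Var (Suc Y) \<^bold>+ ((Var (Suc x) \<^bold>+ Var (Suc x')) \<^bold>* (Var (Suc x) \<^bold>+ Var (Suc x')) \<^bold>+ Var (Suc x')))
      \<^bold>* Var 0 \<^bold>= Var (Suc P)))"

lemma sat_mem_fm: "sat S e (mem_fm Y P x x') \<longleftrightarrow> s_mem S (e Y) (e P) (e x) (e x')"
  by (simp add: mem_fm_def s_mem_def sat_ll_fm)

definition s_tame :: "'a struct \<Rightarrow> 'a \<Rightarrow> 'a \<Rightarrow> bool" where
  "s_tame S Y P \<longleftrightarrow> s_gen S Y \<and> lt S (zer S) P \<and> (\<forall>g\<in>carr S. s_ll S Y g \<longrightarrow> s_ll S P g)"

definition tame_fm :: "nat \<Rightarrow> nat \<Rightarrow> fm" where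
  "tame_fm Y P = (gen_fm Y \<^bold>\<and> \<^bold>0 \<^bold>< Var P \<^bold>\<and> Forall (ll_fm (Suc Y) 0 \<^bold>\<longrightarrow> ll_fm (Suc P) 0))"

lemma sat_tame_fm: "sat S e (tame_fm Y P) \<longleftrightarrow> s_tame S (e Y) (e P)"
  by (simp add: tame_fm_def s_tame_def sat_ll_fm sat_gen_fm)

text \<open>Indices of outer variables under two, four or six additional quantifiers.\<close>

abbreviation "up2 n \<equiv> Suc (Suc n)"
abbreviation "up4 n \<equiv> up2 (up2 n)"
abbreviation "up6 n \<equiv> up4 (up2 n)"

definition s_just :: "'a struct \<Rightarrow> 'a \<Rightarrow> 'a \<Rightarrow> 'a \<Rightarrow> 'a \<Rightarrow> bool" where
  "s_just S Z Q Y P \<longleftrightarrow> (\<forall>u\<in>carr S. \<forall>u'\<in>carr S. s_mem S Z Q u u' \<longrightarrow>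
    u = zer S \<and> u' = zer S \<or> u = one S \<and> u' = one S \<or> s_mem S Y P u u' \<or>
    (\<exists>a\<in>carr S. \<exists>a'\<in>carr S. \<exists>b\<in>carr S. \<exists>b'\<in>carr S. s_mem S Z Q a a' \<and> s_mem S Z Q b b' \<and>
      lt S a u \<and> lt S b u \<and>
      (u = add S a b \<and> u' = add S a' b' \<or> u = mul S a b \<and> u' = mul S a' b')))"

definition just_fm :: "nat \<Rightarrow> nat \<Rightarrow> nat \<Rightarrow> nat \<Rightarrow> fm" where
  "just_fm Z Q Y P = Forall (Forall (mem_fm (up2 Z) (up2 Q) 1 0 \<^bold>\<longrightarrow>
    (Var 1 \<^bold>= \<^bold>0 \<^bold>\<and> Var 0 \<^bold>= \<^bold>0) \<^bold>\<or> (Var 1 \<^bold>= \<^bold>1 \<^bold>\<and> Var 0 \<^bold>= \<^bold>1) \<^bold>\<or> mem_fm (up2 Y) (up2 P) 1 0 \<^bold>\<or>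
    Exists (Exists (Exists (Exists (mem_fm (up6 Z) (up6 Q) 3 2 \<^bold>\<and> mem_fm (up6 Z) (up6 Q) 1 0 \<^bold>\<and>
      Var 3 \<^bold>< Var 5 \<^bold>\<and> Var 1 \<^bold>< Var 5 \<^bold>\<and>
      ((Var 5 \<^bold>= Var 3 \<^bold>+ Var 1 \<^bold>\<and> Var 4 \<^bold>= Var 2 \<^bold>+ Var 0) \<^bold>\<or>
       (Var 5 \<^bold>= Var 3 \<^bold>* Var 1 \<^bold>\<and> Var 4 \<^bold>= Var 2 \<^bold>* Var 0))))))))"

text \<open>Conjunction, disjunction and \<open>Exists\<close> abbreviate combinations of \<open>Imp\<close>, \<open>Bot\<close> and \<open>Forall\<close>,
  so that expanding the corresponding connectives of HOL in the same way on the semantic side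
  makes both sides of the following equations syntactically equal.\<close>

lemma conj_as_imp: "(a \<and> b) = ((a \<longrightarrow> b \<longrightarrow> False) \<longrightarrow> False)"
  and disj_as_imp: "(a \<or> b) = ((a \<longrightarrow> False) \<longrightarrow> b)"
  and Bex_as_imp: "(\<exists>x\<in>A. P x) = ((\<forall>x\<in>A. P x \<longrightarrow> False) \<longrightarrow> False)"
  by auto

lemmas sat_imp_simps = sat.simps val.simps nat.case One_nat_def eval_nat_numeral BitM.simps
  conj_as_imp disj_as_imp Bex_as_imp

lemma sat_just_fm: "sat S e (just_fm Z Q Y P) \<longleftrightarrow> s_just S (e Z) (e Q) (e Y) (e P)"
  unfolding just_fm_def s_just_def
  by (simp only: sat_imp_simps sat_mem_fm)

definition s_rel :: "'a struct \<Rightarrow> 'a \<Rightarrow> 'a \<Rightarrow> 'a \<Rightarrow> 'a \<Rightarrow> bool" where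
  "s_rel S Y P x x' \<longleftrightarrow> (\<exists>Z\<in>carr S. \<exists>Q\<in>carr S. s_tame S Z Q \<and> s_just S Z Q Y P \<and>
    (\<exists>u\<in>carr S. \<exists>u'\<in>carr S. \<exists>v\<in>carr S. \<exists>v'\<in>carr S.
      s_mem S Z Q u u' \<and> s_mem S Z Q v v' \<and> add S x v = u \<and> add S x' v' = u'))"

definition rel_fm :: "nat \<Rightarrow> nat \<Rightarrow> nat \<Rightarrow> nat \<Rightarrow> fm" where
  "rel_fm Y P x x' = Exists (Exists (tame_fm 1 0 \<^bold>\<and> just_fm 1 0 (up2 Y) (up2 P) \<^bold>\<and>
    Exists (Exists (Exists (Exists (mem_fm 5 4 3 2 \<^bold>\<and> mem_fm 5 4 1 0 \<^bold>\<and>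
      Var (up6 x) \<^bold>+ Var 1 \<^bold>= Var 3 \<^bold>\<and> Var (up6 x') \<^bold>+ Var 0 \<^bold>= Var 2))))))"

lemma sat_rel_fm: "sat S e (rel_fm Y P x x') \<longleftrightarrow> s_rel S (e Y) (e P) (e x) (e x')"
  unfolding rel_fm_def s_rel_def
  by (simp only: sat_imp_simps sat_mem_fm sat_tame_fm sat_just_fm)

definition s_pos :: "'a struct \<Rightarrow> 'a \<Rightarrow> 'a \<Rightarrow> bool" where
  "s_pos S Y P \<longleftrightarrow> s_tame S Y P \<and> (\<forall>g\<in>carr S. \<forall>g'\<in>carr S. s_mem S Y P g g' \<longrightarrow> s_gen S g \<and> s_gen S g' \<and>
    (\<forall>h\<in>carr S. \<forall>h'\<in>carr S. s_mem S Y P h h' \<longrightarrow>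
      s_ll S g h \<and> s_ll S g' h' \<or> s_ll S h g \<and> s_ll S h' g' \<or> g = h \<and> g' = h'))"

definition pos_fm :: "nat \<Rightarrow> nat \<Rightarrow> fm" where
  "pos_fm Y P = (tame_fm Y P \<^bold>\<and> Forall (Forall (mem_fm (up2 Y) (up2 P) 1 0 \<^bold>\<longrightarrow> gen_fm 1 \<^bold>\<and> gen_fm 0 \<^bold>\<and>
    Forall (Forall (mem_fm (up4 Y) (up4 P) 1 0 \<^bold>\<longrightarrow>
      (ll_fm 3 1 \<^bold>\<and> ll_fm 2 0) \<^bold>\<or> (ll_fm 1 3 \<^bold>\<and> ll_fm 0 2) \<^bold>\<or> (Var 3 \<^bold>= Var 1 \<^bold>\<and> Var 2 \<^bold>= Var 0))))))"

lemma sat_pos_fm: "sat S e (pos_fm Y P) \<longleftrightarrow> s_pos S (e Y) (e P)"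
  unfolding pos_fm_def s_pos_def
  by (simp only: sat_imp_simps sat_mem_fm sat_tame_fm sat_gen_fm sat_ll_fm)

text \<open>Extension is demanded of the generated relations rather than of the coded generators, as
  only the former enter the back-and-forth argument.\<close>

definition s_ext :: "'a struct \<Rightarrow> 'a \<Rightarrow> 'a \<Rightarrow> 'a \<Rightarrow> 'a \<Rightarrow> bool" where
  "s_ext S Y P Z Q \<longleftrightarrow> s_pos S Z Q \<and>
    (\<forall>x\<in>carr S. \<forall>x'\<in>carr S. s_rel S Y P x x' \<longrightarrow> s_rel S Z Q x x')"

definition ext_fm :: "nat \<Rightarrow> nat \<Rightarrow> nat \<Rightarrow> nat \<Rightarrow> fm" where
  "ext_fm Y P Z Q = (pos_fm Z Q \<^bold>\<and>
    Forall (Forall (rel_fm (up2 Y) (up2 P) 1 0 \<^bold>\<longrightarrow> rel_fm (up2 Z) (up2 Q) 1 0)))"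

lemma sat_ext_fm: "sat S e (ext_fm Y P Z Q) \<longleftrightarrow> s_ext S (e Y) (e P) (e Z) (e Q)"
  unfolding ext_fm_def s_ext_def by (simp only: sat_imp_simps sat_pos_fm sat_rel_fm)

definition s_id :: "'a struct \<Rightarrow> 'a \<Rightarrow> 'a \<Rightarrow> 'a \<Rightarrow> bool" where
  "s_id S Y P w \<longleftrightarrow> s_pos S Y P \<and>
    (\<forall>x\<in>carr S. \<forall>x'\<in>carr S. s_rel S Y P x x' \<longrightarrow> x' = x \<and> s_ll S x w)"

definition id_fm :: "nat \<Rightarrow> nat \<Rightarrow> nat \<Rightarrow> fm" where
  "id_fm Y P w = (pos_fm Y P \<^bold>\<and>
    Forall (Forall (rel_fm (up2 Y) (up2 P) 1 0 \<^bold>\<longrightarrow> Var 0 \<^bold>= Var 1 \<^bold>\<and> ll_fm 1 (up2 w))))"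

lemma sat_id_fm: "sat S e (id_fm Y P w) \<longleftrightarrow> s_id S (e Y) (e P) (e w)"
  unfolding id_fm_def s_id_def by (simp only: sat_imp_simps sat_pos_fm sat_rel_fm sat_ll_fm)

text \<open>The assumptions of \<open>homogeneous\<close> for coded positions, with some of them
  merged: the fourth clause also gives \<open>ll_less\<close>, the last one both
  \<open>ll_trans\<close> and \<open>less_ll\<close>.\<close>

definition s_homogeneous :: "'a struct \<Rightarrow> bool" where
  "s_homogeneous S \<longleftrightarrow>
    (\<forall>Y\<in>carr S. \<forall>P\<in>carr S. s_pos S Y P \<longrightarrow> (\<forall>z\<in>carr S. z = zer S \<or> z = one S \<longrightarrow> s_rel S Y P z z)) \<and>
    (\<forall>Y\<in>carr S. \<forall>P\<in>carr S. s_pos S Y P \<longrightarrow>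
      (\<forall>x\<in>carr S. \<forall>x'\<in>carr S. \<forall>y\<in>carr S. \<forall>y'\<in>carr S. s_rel S Y P x x' \<and> s_rel S Y P y y' \<longrightarrow>
        (lt S x y \<longrightarrow> lt S x' y') \<and> (lt S x' y' \<longrightarrow> lt S x y) \<and> (x = y \<longrightarrow> x' = y') \<and> (x' = y' \<longrightarrow> x = y) \<and>
        (\<forall>s\<in>carr S. \<forall>s'\<in>carr S. s = add S x y \<and> s' = add S x' y' \<or> s = mul S x y \<and> s' = mul S x' y' \<longrightarrow>
          s_rel S Y P s s'))) \<and>
    (\<forall>Y\<in>carr S. \<forall>P\<in>carr S. s_pos S Y P \<longrightarrow>
      (\<forall>y\<in>carr S. (\<exists>Z\<in>carr S. \<exists>Q\<in>carr S. s_ext S Y P Z Q \<and> (\<exists>z\<in>carr S. s_rel S Z Q y z)) \<and>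
        (\<exists>Z\<in>carr S. \<exists>Q\<in>carr S. s_ext S Y P Z Q \<and> (\<exists>z\<in>carr S. s_rel S Z Q z y)))) \<and>
    (\<forall>a\<in>carr S. \<forall>w\<in>carr S. s_ll S a w \<longrightarrow> lt S a w \<and> (\<exists>Y\<in>carr S. \<exists>P\<in>carr S. s_id S Y P w)) \<and>
    (\<forall>Y\<in>carr S. \<forall>P\<in>carr S. \<forall>w\<in>carr S. s_id S Y P w \<longrightarrow> (\<forall>y\<in>carr S.
      (s_ll S y w \<longrightarrow> (\<exists>Z\<in>carr S. \<exists>Q\<in>carr S. s_ext S Y P Z Q \<and> s_rel S Z Q y y \<and> s_id S Z Q w)) \<and>
      (\<exists>Z\<in>carr S. \<exists>Q\<in>carr S. s_ext S Y P Z Q \<and> (\<exists>z\<in>carr S. s_rel S Z Q y z \<and> s_ll S z w)))) \<and>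
    (\<forall>a\<in>carr S. \<forall>b\<in>carr S. (\<exists>w\<in>carr S. s_ll S a w \<and> s_ll S b w) \<and>
      (\<forall>c\<in>carr S. (s_ll S a b \<or> lt S a b) \<and> s_ll S b c \<longrightarrow> s_ll S a c))"

definition homogeneous_fm :: fm where
  "homogeneous_fm =
    (Forall (Forall (pos_fm 1 0 \<^bold>\<longrightarrow> Forall (Var 0 \<^bold>= \<^bold>0 \<^bold>\<or> Var 0 \<^bold>= \<^bold>1 \<^bold>\<longrightarrow> rel_fm 2 1 0 0))) \<^bold>\<and>
    Forall (Forall (pos_fm 1 0 \<^bold>\<longrightarrow> Forall (Forall (Forall (Forall (rel_fm 5 4 3 2 \<^bold>\<and> rel_fm 5 4 1 0 \<^bold>\<longrightarrow>
        (Var 3 \<^bold>< Var 1 \<^bold>\<longrightarrow> Var 2 \<^bold>< Var 0) \<^bold>\<and> (Var 2 \<^bold>< Var 0 \<^bold>\<longrightarrow> Var 3 \<^bold>< Var 1) \<^bold>\<and>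
        (Var 3 \<^bold>= Var 1 \<^bold>\<longrightarrow> Var 2 \<^bold>= Var 0) \<^bold>\<and> (Var 2 \<^bold>= Var 0 \<^bold>\<longrightarrow> Var 3 \<^bold>= Var 1) \<^bold>\<and>
        Forall (Forall ((Var 1 \<^bold>= Var 5 \<^bold>+ Var 3 \<^bold>\<and> Var 0 \<^bold>= Var 4 \<^bold>+ Var 2) \<^bold>\<or>
          (Var 1 \<^bold>= Var 5 \<^bold>* Var 3 \<^bold>\<and> Var 0 \<^bold>= Var 4 \<^bold>* Var 2) \<^bold>\<longrightarrow> rel_fm 7 6 1 0)))))))) \<^bold>\<and>
    Forall (Forall (pos_fm 1 0 \<^bold>\<longrightarrow>
      Forall (Exists (Exists (ext_fm 4 3 1 0 \<^bold>\<and> Exists (rel_fm 2 1 3 0))) \<^bold>\<and>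
        Exists (Exists (ext_fm 4 3 1 0 \<^bold>\<and> Exists (rel_fm 2 1 0 3)))))) \<^bold>\<and>
    Forall (Forall (ll_fm 1 0 \<^bold>\<longrightarrow> Var 1 \<^bold>< Var 0 \<^bold>\<and> Exists (Exists (id_fm 1 0 2)))) \<^bold>\<and>
    Forall (Forall (Forall (id_fm 2 1 0 \<^bold>\<longrightarrow> Forall (
      (ll_fm 0 1 \<^bold>\<longrightarrow> Exists (Exists (ext_fm 5 4 1 0 \<^bold>\<and> rel_fm 1 0 2 2 \<^bold>\<and> id_fm 1 0 3))) \<^bold>\<and>
      Exists (Exists (ext_fm 5 4 1 0 \<^bold>\<and> Exists (rel_fm 2 1 3 0 \<^bold>\<and> ll_fm 0 4))))))) \<^bold>\<and>
    Forall (Forall (Exists (ll_fm 2 0 \<^bold>\<and> ll_fm 1 0) \<^bold>\<and>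
      Forall ((ll_fm 2 1 \<^bold>\<or> Var 2 \<^bold>< Var 1) \<^bold>\<and> ll_fm 1 0 \<^bold>\<longrightarrow> ll_fm 2 0))))"

lemma sat_homogeneous_fm: "sat S e homogeneous_fm \<longleftrightarrow> s_homogeneous S"
  unfolding homogeneous_fm_def s_homogeneous_def
  by (simp only: sat_imp_simps sat_pos_fm sat_rel_fm sat_ext_fm sat_id_fm sat_ll_fm)

lemma s_homogeneous_imp_homogeneous:
  assumes "is_struct S" "s_homogeneous S"
  shows "homogeneous S {(Y, P). Y \<in> carr S \<and> P \<in> carr S \<and> s_pos S Y P} (\<lambda>(Y, P). s_rel S Y P) (s_ll S)"
proof -
  note h = assms(2)[unfolded s_homogeneous_def s_ext_def]
  note h6 = h[THEN conjunct2, THEN conjunct2, THEN conjunct2, THEN conjunct2, THEN conjunct2, rule_format]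
  have struct: "zer S \<in> carr S" "one S \<in> carr S"
    "\<And>x y. x \<in> carr S \<Longrightarrow> y \<in> carr S \<Longrightarrow> add S x y \<in> carr S \<and> mul S x y \<in> carr S"
    using assms(1) by (auto simp: is_struct_def)
  show ?thesis
  proof (unfold_locales, goal_cases)
    case 1 show ?case by (rule assms(1))
  next
    case (2 p) then show ?case using h[THEN conjunct1] struct by (cases p) simp
  next
    case (3 p) then show ?case using h[THEN conjunct1] struct by (cases p) simp
  next
    case (4 p x x' y y')
    obtain Y P where p: "p = (Y, P)" by (cases p)
    with 4 have YP: "Y \<in> carr S" "P \<in> carr S" "s_pos S Y P" "s_rel S Y P x x'" "s_rel S Y P y y'" by simp_all
    from h[THEN conjunct2, THEN conjunct1, rule_format, OF YP(1-3) 4(2-5) conjI[OF YP(4,5)]]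
    show ?case using p struct(3)[OF 4(2,4)] struct(3)[OF 4(3,5)] by (simp add: p) blast
  next
    case (5 p y)
    obtain Y P where p: "p = (Y, P)" by (cases p)
    with 5 have YP: "Y \<in> carr S" "P \<in> carr S" "s_pos S Y P" by simp_all
    from h[THEN conjunct2, THEN conjunct2, THEN conjunct1, rule_format, OF YP 5(2), THEN conjunct1]
    obtain Z Q z where "Z \<in> carr S" "Q \<in> carr S" "s_pos S Z Q" "z \<in> carr S" "s_rel S Z Q y z"
      "\<forall>x\<in>carr S. \<forall>x'\<in>carr S. s_rel S Y P x x' \<longrightarrow> s_rel S Z Q x x'" by (elim bexE conjE)
    then show ?case unfolding p by (intro bexI[of _ "(Z, Q)"] bexI[of _ z]) simp_all
  next
    case (6 p y)
    obtain Y P where p: "p = (Y, P)" by (cases p)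
    with 6 have YP: "Y \<in> carr S" "P \<in> carr S" "s_pos S Y P" by simp_all
    from h[THEN conjunct2, THEN conjunct2, THEN conjunct1, rule_format, OF YP 6(2), THEN conjunct2]
    obtain Z Q z where "Z \<in> carr S" "Q \<in> carr S" "s_pos S Z Q" "z \<in> carr S" "s_rel S Z Q z y"
      "\<forall>x\<in>carr S. \<forall>x'\<in>carr S. s_rel S Y P x x' \<longrightarrow> s_rel S Z Q x x'" by (elim bexE conjE)
    then show ?case unfolding p by (intro bexI[of _ "(Z, Q)"] bexI[of _ z]) simp_all
  next
    case (7 a w)
    from h[THEN conjunct2, THEN conjunct2, THEN conjunct2, THEN conjunct1, rule_format, OF 7, THEN conjunct2]
    obtain Y P where "Y \<in> carr S" "P \<in> carr S" "s_pos S Y P"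
      "\<forall>x\<in>carr S. \<forall>x'\<in>carr S. s_rel S Y P x x' \<longrightarrow> x' = x \<and> s_ll S x w"
      unfolding s_id_def by (elim bexE conjE)
    then show ?case by (intro bexI[of _ "(Y, P)"]) simp_all
  next
    case (8 p w y)
    obtain Y P where p: "p = (Y, P)" by (cases p)
    with 8 have YP: "Y \<in> carr S" "P \<in> carr S" "s_id S Y P w" by (simp_all add: s_id_def)
    from h[THEN conjunct2, THEN conjunct2, THEN conjunct2, THEN conjunct2, THEN conjunct1, rule_format,
        OF YP(1,2) 8(2) YP(3) 8(4), THEN conjunct1, rule_format, OF 8(5)]
    obtain Z Q where "Z \<in> carr S" "Q \<in> carr S" "s_pos S Z Q" "s_rel S Z Q y y" "s_id S Z Q w"
      "\<forall>x\<in>carr S. \<forall>x'\<in>carr S. s_rel S Y P x x' \<longrightarrow> s_rel S Z Q x x'" by (elim bexE conjE)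
    then show ?case unfolding p s_id_def by (intro bexI[of _ "(Z, Q)"]) simp_all
  next
    case (9 p w y)
    obtain Y P where p: "p = (Y, P)" by (cases p)
    with 9 have YP: "Y \<in> carr S" "P \<in> carr S" "s_id S Y P w" by (simp_all add: s_id_def)
    from h[THEN conjunct2, THEN conjunct2, THEN conjunct2, THEN conjunct2, THEN conjunct1, rule_format,
        OF YP(1,2) 9(2) YP(3) 9(4), THEN conjunct2]
    obtain Z Q z where "Z \<in> carr S" "Q \<in> carr S" "s_pos S Z Q" "z \<in> carr S" "s_rel S Z Q y z" "s_ll S z w"
      "\<forall>x\<in>carr S. \<forall>x'\<in>carr S. s_rel S Y P x x' \<longrightarrow> s_rel S Z Q x x'" by (elim bexE conjE)
    then show ?case unfolding p by (intro bexI[of _ "(Z, Q)"] bexI[of _ z]) simp_all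
  next
    case (10 a b)
    from h6[OF this] show ?case by (rule conjunct1)
  next
    case (11 a b c)
    from h6[OF 11(1,2), THEN conjunct2, rule_format, OF 11(3)] 11(4,5) show ?case by simp
  next
    case (12 a w)
    from h[THEN conjunct2, THEN conjunct2, THEN conjunct2, THEN conjunct1, rule_format, OF 12, THEN conjunct1]
    show ?case .
  next
    case (13 a b w)
    from h6[OF 13(1,2), THEN conjunct2, rule_format, OF 13(3)] 13(4,5) show ?case by simp
  qed
qed

section \<open>The model\<close>

context tower begin

definition MS :: "'r struct" where
  "MS = \<lparr>carr = M, zer = 0, one = 1, add = (+), mul = (*), lt = (<)\<rparr>"

lemma MS_simps [simp]: "carr MS = M" "zer MS = 0" "one MS = 1" "add MS = (+)" "mul MS = (*)" "lt MS = (<)"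
  by (simp_all add: MS_def)

lemma is_struct_MS: "is_struct MS"
  by (simp add: is_struct_def M_0 M_1 M_add M_mult)

lemma s_gen_MS: "c \<in> M \<Longrightarrow> s_gen MS c \<longleftrightarrow> gen c"
proof -
  assume c: "c \<in> M"
  have "(\<exists>z\<in>M. (z < c \<or> z = c) \<and> y + z = c \<and> z * z < c) \<longleftrightarrow> (c - y) * (c - y) < c"
    if y: "y \<in> M" "y \<le> c" for y
  proof
    assume "\<exists>z\<in>M. (z < c \<or> z = c) \<and> y + z = c \<and> z * z < c"
    then obtain z where z: "y + z = c" "z * z < c" by blast
    then have "z = c - y" by (simp add: eq_diff_eq add.commute)
    with z(2) show "(c - y) * (c - y) < c" by simp
  next
    assume *: "(c - y) * (c - y) < c"
    have "c - y \<in> M" using M_diff c y by blast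
    moreover have "c - y \<le> c" using M_D(2)[OF y(1)] by simp
    then have "c - y < c \<or> c - y = c" by (simp only: le_less)
    moreover have "y + (c - y) = c" by simp
    ultimately show "\<exists>z\<in>M. (z < c \<or> z = c) \<and> y + z = c \<and> z * z < c" using * by blast
  qed
  then show ?thesis unfolding s_gen_def gen_def MS_simps using c
    by (simp only: le_less[symmetric]) (simp cong: ball_cong)
qed

lemma s_ll_MS: "w \<in> M \<Longrightarrow> s_ll MS a w \<longleftrightarrow> ll a w"
  by (simp add: s_ll_def ll_def s_gen_MS)

lemma s_mem_MS: "Y \<in> M \<Longrightarrow> s_mem MS Y P x x' \<longleftrightarrow> mem Y P x x'"
  by (simp add: s_mem_def mem_def s_ll_MS pr_def)

lemma s_tame_MS: "Y \<in> M \<Longrightarrow> s_tame MS Y P \<longleftrightarrow> tame Y P"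
  by (simp add: s_tame_def tame_def s_ll_MS s_gen_MS)

lemma s_just_MS:
  assumes "Y \<in> M" "Z \<in> M"
  shows "s_just MS Z Q Y P \<longleftrightarrow> justified (code_set Z Q) (code_set Y P)"
  unfolding s_just_def justified_def derived_def code_set_def using assms
  by (simp add: s_mem_MS) blast

lemma s_rel_MS: "Y \<in> M \<Longrightarrow> s_rel MS Y P x x' \<longleftrightarrow> coded_rel Y P x x'"
  by (simp add: s_rel_def coded_rel_def s_mem_MS s_tame_MS s_just_MS)

text \<open>The formula does not mention finiteness; in \<open>M\<close> it follows from tameness by
  \<open>code_finite\<close>.\<close>

lemma s_pos_MS:
  assumes "Y \<in> M" "P \<in> M"
  shows "s_pos MS Y P \<longleftrightarrow> tame Y P \<and> compat (code_set Y P)"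
proof -
  have "s_pos MS Y P \<longleftrightarrow> tame Y P \<and> (\<forall>p\<in>code_set Y P. gen (fst p) \<and> gen (snd p) \<and>
      (\<forall>q\<in>code_set Y P. apart p q))"
    unfolding s_pos_def apart_def code_set_def using assms
    by (simp add: s_mem_MS s_tame_MS s_gen_MS s_ll_MS) blast
  then show ?thesis unfolding compat_def using code_finite assms by blast
qed

lemma s_rel_MS_iff:
  assumes "Y \<in> M" "P \<in> M" "s_pos MS Y P" "x \<in> M" "x' \<in> M"
  shows "s_rel MS Y P x x' \<longleftrightarrow> ring_rel (code_set Y P) x x'"
  using assms coded_rel_iff s_rel_MS s_pos_MS by blast

lemma code_compat:
  assumes "compat G"
  shows "\<exists>Y\<in>M. \<exists>P\<in>M. s_pos MS Y P \<and> code_set Y P = G"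
proof -
  have "finite G" using assms by (simp add: compat_def)
  then obtain Y P where "Y \<in> M" "P \<in> M" "tame Y P" "code_set Y P = G"
    using code_exists compat_M[OF assms] by blast
  then show ?thesis using s_pos_MS assms by blast
qed

lemma ext_compat:
  assumes "Y \<in> M" "P \<in> M" "s_pos MS Y P" "code_set Y P \<subseteq> G" "compat G"
  shows "\<exists>Z\<in>M. \<exists>Q\<in>M. s_pos MS Z Q \<and> code_set Z Q = G \<and> s_ext MS Y P Z Q"
proof -
  obtain Z Q where Z: "Z \<in> M" "Q \<in> M" "s_pos MS Z Q" "code_set Z Q = G" using code_compat assms by blast
  have "s_rel MS Z Q x x'" if "x \<in> M" "x' \<in> M" "s_rel MS Y P x x'" for x x'
    using that s_rel_MS_iff[OF assms(1-3) that(1,2)] s_rel_MS_iff[OF Z(1-3) that(1,2)]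
      ring_rel_mono[of "code_set Y P" x x' G] assms(4) Z(4) by simp
  then have "s_ext MS Y P Z Q" unfolding s_ext_def using Z by simp
  then show ?thesis using Z by blast
qed

text \<open>Coded generators are themselves related, which gives one direction; conversely, whatever
  diagonal pairs of low elements generate is fixed and low.\<close>

lemma s_id_MS:
  assumes "Y \<in> M" "P \<in> M" "s_pos MS Y P" "gen w"
  shows "s_id MS Y P w \<longleftrightarrow> code_set Y P \<subseteq> Id \<and> (\<forall>p\<in>code_set Y P. lev (fst p) < lev w)"
proof
  have w: "w \<in> M" by (rule gen_M[OF assms(4)])
  have G: "compat (code_set Y P)" using s_pos_MS assms by blast
  {
    assume id: "s_id MS Y P w"
    have "g' = g \<and> lev g < lev w" if g: "(g, g') \<in> code_set Y P" for g g'
    proof -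
      have gM: "g \<in> M" "g' \<in> M" "gen g" using g compat_M[OF G] G by (auto simp: compat_def)
      have "s_rel MS Y P g g'" using s_rel_MS_iff[OF assms(1-3) gM(1,2)] ring_rel.gen[OF g] by simp
      then have "g' = g" "s_ll MS g w" using id gM unfolding s_id_def by auto
      then show ?thesis using s_ll_MS[OF w] ll_gen_iff[OF gM(3)] by simp
    qed
    then show "code_set Y P \<subseteq> Id \<and> (\<forall>p\<in>code_set Y P. lev (fst p) < lev w)" by auto
  next
    assume *: "code_set Y P \<subseteq> Id \<and> (\<forall>p\<in>code_set Y P. lev (fst p) < lev w)"
    have "x' = x \<and> s_ll MS x w" if x: "x \<in> M" "x' \<in> M" "s_rel MS Y P x x'" for x x'
    proof -
      have r: "ring_rel (code_set Y P) x x'" using s_rel_MS_iff[OF assms(1-3) x(1,2)] x(3) by simp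
      have "x \<in> low (lev w) \<and> x' \<in> low (lev w)"
      proof (rule ring_rel_low[OF r])
        fix g g' assume g: "(g, g') \<in> code_set Y P"
        then have "gen g" "g' = g" "lev g < lev w" using G * by (auto simp: compat_def)
        then show "g \<in> low (lev w) \<and> g' \<in> low (lev w)" using level_low_iff[OF level_lev] by simp
      qed
      then show ?thesis using ring_rel_Id_on[OF r] * s_ll_MS[OF w] ll_iff_low[OF x(1)] assms(4) by simp
    qed
    then show "s_id MS Y P w" using assms(3) by (simp add: s_id_def)
  }
qed

text \<open>Related elements have the same sign, so extending a position does not lead out of
  \<open>M\<close>.\<close>

lemma ring_rel_M: "compat G \<Longrightarrow> ring_rel G x x' \<Longrightarrow> x \<in> M \<longleftrightarrow> x' \<in> M"
  using ring_rel_sgn[of G x x'] unfolding M_def by (simp add: sgn_if split: if_splits)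

text \<open>The extension clauses are the extension lemmas for \<open>compat\<close> sets, carried
  over to codes by \<open>ext_compat\<close> and \<open>s_rel_MS_iff\<close>.\<close>

lemma s_homogeneous_MS: "s_homogeneous MS"
  unfolding s_homogeneous_def MS_simps
proof (intro conjI ballI impI)
  fix Y P z assume *: "Y \<in> M" "P \<in> M" "s_pos MS Y P" "z \<in> M" "z = 0 \<or> z = 1"
  have "ring_rel (code_set Y P) z z" using *(5) ring_rel.zero ring_rel.one by metis
  then show "s_rel MS Y P z z" using s_rel_MS_iff * by blast
next
  fix Y P x x' y y'
  assume *: "Y \<in> M" "P \<in> M" "s_pos MS Y P" "x \<in> M" "x' \<in> M" "y \<in> M" "y' \<in> M"
    "s_rel MS Y P x x' \<and> s_rel MS Y P y y'"
  have G: "compat (code_set Y P)" using s_pos_MS * by blast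
  have r: "ring_rel (code_set Y P) x x'" "ring_rel (code_set Y P) y y'" using * s_rel_MS_iff by blast+
  note ord = ring_rel_less_iff[OF G r]
  show "x < y \<Longrightarrow> x' < y'" "x' < y' \<Longrightarrow> x < y" "x = y \<Longrightarrow> x' = y'" "x' = y' \<Longrightarrow> x = y"
    using ord by simp_all
  fix s s' assume s: "s \<in> M" "s' \<in> M" "s = x + y \<and> s' = x' + y' \<or> s = x * y \<and> s' = x' * y'"
  then have "ring_rel (code_set Y P) s s'" using ring_rel.add[OF r] ring_rel.mult[OF r] by metis
  then show "s_rel MS Y P s s'" using s_rel_MS_iff *(1-3) s(1,2) by blast
next
  fix Y P y assume *: "Y \<in> M" "P \<in> M" "s_pos MS Y P" "y \<in> M"
  have G: "compat (code_set Y P)" using s_pos_MS * by blast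
  have yR: "y \<in> R" using * M_D by blast
  obtain G' y' where G': "code_set Y P \<subseteq> G'" "compat G'" "ring_rel G' y y'"
    using forth_extend[OF G yR] by blast
  obtain Z Q where Z: "Z \<in> M" "Q \<in> M" "s_pos MS Z Q" "code_set Z Q = G'" "s_ext MS Y P Z Q"
    using ext_compat[OF *(1-3) G'(1,2)] by blast
  have "y' \<in> M" using ring_rel_M[OF G'(2,3)] * by simp
  then have "s_rel MS Z Q y y'" using s_rel_MS_iff[OF Z(1-3) *(4)] G'(3) Z(4) by simp
  with Z \<open>y' \<in> M\<close> show "\<exists>Z\<in>M. \<exists>Q\<in>M. s_ext MS Y P Z Q \<and> (\<exists>z\<in>M. s_rel MS Z Q y z)" by blast
next
  fix Y P y assume *: "Y \<in> M" "P \<in> M" "s_pos MS Y P" "y \<in> M"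
  have G: "compat (code_set Y P)" using s_pos_MS * by blast
  have yR: "y \<in> R" using * M_D by blast
  obtain G' y' where G': "code_set Y P \<subseteq> G'" "compat G'" "ring_rel G' y' y"
    using back_extend[OF G yR] by blast
  obtain Z Q where Z: "Z \<in> M" "Q \<in> M" "s_pos MS Z Q" "code_set Z Q = G'" "s_ext MS Y P Z Q"
    using ext_compat[OF *(1-3) G'(1,2)] by blast
  have "y' \<in> M" using ring_rel_M[OF G'(2,3)] * by simp
  then have "s_rel MS Z Q y' y" using s_rel_MS_iff[OF Z(1-3) _ *(4)] G'(3) Z(4) by simp
  with Z \<open>y' \<in> M\<close> show "\<exists>Z\<in>M. \<exists>Q\<in>M. s_ext MS Y P Z Q \<and> (\<exists>z\<in>M. s_rel MS Z Q z y)" by blast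
next
  fix a w assume *: "a \<in> M" "w \<in> M" "s_ll MS a w"
  have w: "gen w" "a \<in> low (lev w)" using * s_ll_MS ll_iff_low by blast+
  have "\<bar>a\<bar> < w" using level_less[OF level_lev[OF w(1)] low_abs[OF w(2)]] .
  then show "a < w" by simp
  \<comment> \<open>The empty correspondence generates the identity on the integers and is the
    initial position.\<close>
  have "compat {}" by (simp add: compat_def)
  from code_compat[OF this] obtain Y P where Y: "Y \<in> M" "P \<in> M" "s_pos MS Y P" "code_set Y P = {}" by blast
  then have "s_id MS Y P w" using s_id_MS[OF Y(1-3) w(1)] by simp
  with Y show "\<exists>Y\<in>M. \<exists>P\<in>M. s_id MS Y P w" by blast
next
  fix Y P w y assume *: "Y \<in> M" "P \<in> M" "w \<in> M" "s_id MS Y P w" "y \<in> M" "s_ll MS y w"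
  have w: "gen w" "y \<in> low (lev w)" using * s_ll_MS ll_iff_low by blast+
  have pos: "s_pos MS Y P" using *(4) by (simp add: s_id_def)
  have G: "compat (code_set Y P)" using s_pos_MS * pos by blast
  have id: "code_set Y P \<subseteq> Id" "\<And>p. p \<in> code_set Y P \<Longrightarrow> lev (fst p) < lev w"
    using s_id_MS[OF *(1,2) pos w(1)] *(4) by simp_all
  obtain G' where G': "code_set Y P \<subseteq> G'" "compat G'" "G' \<subseteq> Id" "\<forall>p\<in>G'. lev (fst p) < lev w" "ring_rel G' y y"
    using id_extend[OF G id w(2)] by blast
  obtain Z Q where Z: "Z \<in> M" "Q \<in> M" "s_pos MS Z Q" "code_set Z Q = G'" "s_ext MS Y P Z Q"
    using ext_compat[OF *(1,2) pos G'(1,2)] by blast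
  have "s_rel MS Z Q y y" using s_rel_MS_iff[OF Z(1-3) *(5,5)] G'(5) Z(4) by simp
  moreover have "s_id MS Z Q w" using s_id_MS[OF Z(1-3) w(1)] G'(3,4) Z(4) by simp
  ultimately show "\<exists>Z\<in>M. \<exists>Q\<in>M. s_ext MS Y P Z Q \<and> s_rel MS Z Q y y \<and> s_id MS Z Q w" using Z by blast
next
  fix Y P w y assume *: "Y \<in> M" "P \<in> M" "w \<in> M" "s_id MS Y P w" "y \<in> M"
  have pos: "s_pos MS Y P" using *(4) by (simp add: s_id_def)
  have G: "compat (code_set Y P)" using s_pos_MS * pos by blast
  \<comment> \<open>No element far below \<open>w\<close> is given in this clause; that
    \<open>w\<close> is a generator follows because 0 is related to itself.\<close>
  have "s_rel MS Y P 0 0" using s_rel_MS_iff[OF *(1,2) pos M_0 M_0] ring_rel.zero by blast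
  then have "s_ll MS 0 w" using *(4) M_0 unfolding s_id_def by simp
  then have w: "gen w" using s_ll_MS[OF *(3)] ll_iff_low[OF M_0] by blast
  have id: "code_set Y P \<subseteq> Id" "\<And>p. p \<in> code_set Y P \<Longrightarrow> lev (fst p) < lev w"
    using s_id_MS[OF *(1,2) pos w(1)] *(4) by simp_all
  have "lev (snd p) < lev w" if p: "p \<in> code_set Y P" for p
    using id(1) id(2)[OF p] p by auto
  from move_extend[OF G this] M_D(1)[OF *(5)] obtain G' y' where
    G': "code_set Y P \<subseteq> G'" "compat G'" "ring_rel G' y y'" "y' \<in> low (lev w)" by blast
  obtain Z Q where Z: "Z \<in> M" "Q \<in> M" "s_pos MS Z Q" "code_set Z Q = G'" "s_ext MS Y P Z Q"
    using ext_compat[OF *(1,2) pos G'(1,2)] by blast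
  have y': "y' \<in> M" using ring_rel_M[OF G'(2,3)] * by simp
  then have "s_rel MS Z Q y y'" using s_rel_MS_iff[OF Z(1-3) *(5)] G'(3) Z(4) by simp
  moreover have "s_ll MS y' w" using s_ll_MS[OF *(3)] ll_iff_low[OF y'] w G'(4) by simp
  ultimately show "\<exists>Z\<in>M. \<exists>Q\<in>M. s_ext MS Y P Z Q \<and> (\<exists>z\<in>M. s_rel MS Z Q y z \<and> s_ll MS z w)"
    using Z y' by blast
next
  fix a b assume *: "a \<in> M" "b \<in> M"
  then have "{a, b} \<subseteq> R" using M_D(1) by blast
  then obtain j where "a \<in> low j" "b \<in> low j" using finite_low[of "{a, b}"] by auto
  then have "ll a (X j)" "ll b (X j)" using ll_iff_low * gen_X lev_X by simp_all
  then show "\<exists>w\<in>M. s_ll MS a w \<and> s_ll MS b w" using s_ll_MS[OF M_X] M_X by blast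
  fix c assume c: "c \<in> M" "(s_ll MS a b \<or> a < b) \<and> s_ll MS b c"
  have bc: "gen c" "b \<in> low (lev c)" using c s_ll_MS ll_iff_low * by blast+
  have "a < b"
  proof (cases "a < b")
    case False
    then have "ll a b" using c(2) s_ll_MS[OF *(2)] by simp
    then have "gen b" "a \<in> low (lev b)" using ll_iff_low[OF *(1)] by auto
    then have "\<bar>a\<bar> < b" using level_less[OF level_lev low_abs] by blast
    then show ?thesis by simp
  qed
  then have "\<bar>a\<bar> \<le> \<bar>b\<bar>" using M_D(2)[OF *(1)] by simp
  then have "a \<in> low (lev c)" using low_convex[OF M_D(1)[OF *(1)] _ bc(2)] by simp
  then show "s_ll MS a c" using s_ll_MS[OF c(1)] ll_iff_low[OF *(1)] bc(1) by simp
qed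

text \<open>Apart from subtraction, discreteness and non-negativity, the axioms hold in every
  ordered integral domain.\<close>

lemma sat_PA_minus:
  assumes "p \<in> PA_minus_axioms" "range e \<subseteq> M"
  shows "sat MS e p"
proof -
  have sub: "\<exists>z\<in>M. x + z = y" if "x < y" "x \<in> M" "y \<in> M" for x y
    using M_diff[OF that(3,2)] that(1) by (intro bexI[of _ "y - x"]) auto
  have one: "x = 1 \<or> 1 < x" if "0 < x" "x \<in> M" for x
    using R_discrete[OF M_D(1)[OF that(2)]] that(1) by auto
  show ?thesis
    using assms(1) unfolding PA_minus_axioms_def
  proof (elim imageE, goal_cases)
    case (1 q)
    have "sat MS e q" if "range e \<subseteq> M" for e
    proof -
      have eM: "e n \<in> M" for n using that by blast
      show ?thesis
        using 1(2) unfolding Let_def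
        by (elim insertE emptyE; hypsubst)
          (use sub[OF _ eM eM] M_D(2)[OF eM] one[OF _ eM] in
            \<open>auto simp: algebra_simps numeral_2_eq_2 le_less intro: mult_strict_left_mono mult_strict_right_mono\<close>)
    qed
    then show ?case unfolding 1(1) using assms(2) by (intro sat_universal_closure) simp_all
  qed
qed

end

section \<open>The single axiom and the completion\<close>

lemma sat_foldr_Con: "sat S e (foldr Con ps q) \<longleftrightarrow> (\<forall>p\<in>set ps. sat S e p) \<and> sat S e q"
  by (induction ps) auto

lemma sentence_foldr_Con: "(\<And>p. p \<in> set ps \<Longrightarrow> sentence p) \<Longrightarrow> sentence q \<Longrightarrow> sentence (foldr Con ps q)"
  by (induction ps) (simp_all add: sentence_def)

text \<open>Meant for \<open>homogeneous_fm\<close>, whose truth does not depend on the environment: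
  the closure makes it a sentence without a count of its variables and leaves its meaning
  unchanged.\<close>

lemma sat_closure_const:
  assumes "\<And>e. sat S e p \<longleftrightarrow> c" "carr S \<noteq> {}"
  shows "sat S e (universal_closure p) \<longleftrightarrow> c"
proof -
  have "sat S e ((Forall ^^ n) p) \<longleftrightarrow> c" for n e
  proof (induction n arbitrary: e)
    case (Suc n)
    then show ?case using assms(2) by auto
  qed (simp add: assms(1))
  then show ?thesis by (simp add: universal_closure_def)
qed

text \<open>A cut over arbitrarily many hypotheses, obtained semantically: every model of
  \<open>A\<close> is a model of \<open>Th A\<close>.\<close>

lemma Th_Th: assumes "\<And>p. p \<in> A \<Longrightarrow> sentence p" shows "Th (Th A) = Th A"
proof -
  have "A \<turnstile> p" if p: "sentence p" "Th A \<turnstile> p" for p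
  proof (rule completeness[OF assms p(1)])
    fix S :: "tm set struct" and e
    assume S: "is_struct S" "range e \<subseteq> carr S" "\<And>q. q \<in> A \<Longrightarrow> sat S e q"
    show "sat S e p"
    proof (rule soundness[OF p(2) S(1,2)])
      fix q assume "q \<in> Th A"
      then have "A \<turnstile> q" by (simp add: Th_def)
      then show "sat S e q" by (rule soundness[OF _ S])
    qed
  qed
  moreover have "Th A \<turnstile> p" if "p \<in> Th A" for p using that by (rule derives.Hyp)
  ultimately show ?thesis by (auto simp: Th_def)
qed

text \<open>The finitely many axioms of PA-minus go into the sentence itself, while the infinite
  scheme of collection follows from homogeneity.\<close>

definition conj_axiom :: "fm list \<Rightarrow> fm" where
  "conj_axiom ps = foldr Con ps (universal_closure homogeneous_fm)"

lemma sentence_conj_axiom: "(\<And>p. p \<in> set ps \<Longrightarrow> sentence p) \<Longrightarrow> sentence (conj_axiom ps)"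
  unfolding conj_axiom_def by (rule sentence_foldr_Con[OF _ sentence_universal_closure])

lemma sat_conj_axiom:
  assumes "is_struct S"
  shows "sat S e (conj_axiom ps) \<longleftrightarrow> (\<forall>p\<in>set ps. sat S e p) \<and> s_homogeneous S"
proof -
  have "carr S \<noteq> {}" using assms by (auto simp: is_struct_def)
  then show ?thesis unfolding conj_axiom_def sat_foldr_Con
    using sat_closure_const[of S homogeneous_fm "s_homogeneous S", OF sat_homogeneous_fm] by simp
qed

lemma sat_sigma_ll:
  assumes "is_struct S" "s_homogeneous S" "sentence p"
  shows "sat S e (sigma ll_fm p) \<longleftrightarrow> sat S e p"
proof -
  interpret homogeneous S "{(Y, P). Y \<in> carr S \<and> P \<in> carr S \<and> s_pos S Y P}" "\<lambda>(Y, P). s_rel S Y P" "s_ll S"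
    by (rule s_homogeneous_imp_homogeneous[OF assms(1,2)])
  show ?thesis by (rule sat_sigma[OF _ assms(3)]) (rule sat_ll_fm)
qed

lemma sat_Coll_axioms:
  assumes "is_struct S" "s_homogeneous S" "range e \<subseteq> carr S" "p \<in> Coll_axioms"
  shows "sat S e p"
proof -
  interpret homogeneous S "{(Y, P). Y \<in> carr S \<and> P \<in> carr S \<and> s_pos S Y P}" "\<lambda>(Y, P). s_rel S Y P" "s_ll S"
    by (rule s_homogeneous_imp_homogeneous[OF assms(1,2)])
  obtain q where "p = universal_closure (collection q)" using assms(4) by (auto simp: Coll_axioms_def)
  then show ?thesis using sat_universal_closure[OF sat_collection assms(3)] by simp
qed

theorem theorem6p17:
  "\<exists>U \<Phi> S. completion_of (Th (PA_minus_axioms \<union> Coll_axioms)) U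
     \<and> sentence \<Phi>
     \<and> (\<forall>p\<in>S. sentence p \<and> Sigma1 p)
     \<and> axiomatised_by U ({\<Phi>} \<union> S)"
proof -
  interpret tower tower_gen
    by standard (rule tower_gen_gt_power tower_gen_gt_of_nat, assumption?)+
  have "finite PA_minus_axioms" by (simp add: PA_minus_axioms_def Let_def)
  then obtain ps where ps: "set ps = PA_minus_axioms" using finite_list by blast
  have sent: "sentence p" if "p \<in> PA_minus_axioms \<union> Coll_axioms" for p
    using that sentence_universal_closure by (auto simp: PA_minus_axioms_def Coll_axioms_def)
  define \<Phi> where "\<Phi> = conj_axiom ps"
  have sent\<Phi>: "sentence \<Phi>" unfolding \<Phi>_def
    by (rule sentence_conj_axiom) (use sent ps in blast)
  note sat\<Phi> = sat_conj_axiom[of _ _ ps, folded \<Phi>_def, unfolded ps]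
  define e0 where "e0 = (\<lambda>_::nat. 0 :: (rat \<Rightarrow>\<^sub>0 int) \<Rightarrow>\<^sub>0 int)"
  have e0: "range e0 \<subseteq> carr MS" using M_0 by (auto simp: e0_def)
  have MS: "sat MS e0 \<Phi>" using sat\<Phi>[OF is_struct_MS] sat_PA_minus s_homogeneous_MS e0 by simp
  \<comment> \<open>Among these is \<open>sigma ll_fm p\<close> for every sentence \<open>p\<close>
    that is true in \<open>MS\<close>.\<close>
  define S where "S = {q. sentence q \<and> Sigma1 q \<and> sat MS e0 q}"
  define A where "A = {\<Phi>} \<union> S"
  have sentA: "sentence p" if "p \<in> A" for p using that sent\<Phi> by (auto simp: A_def S_def)
  have ThA: "Th A \<turnstile> p" if "sentence p"
    "\<And>(N :: tm set struct) e. is_struct N \<Longrightarrow> range e \<subseteq> carr N \<Longrightarrow> (\<And>q. q \<in> A \<Longrightarrow> sat N e q) \<Longrightarrow> sat N e p" for p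
  proof -
    have "A \<turnstile> p" by (rule completeness[OF sentA that(1)]) (assumption, rule that(2))
    then have "p \<in> Th A" using that(1) by (simp add: Th_def)
    then show ?thesis by (rule derives.Hyp)
  qed
  have "is_theory (Th A)" unfolding is_theory_def by (rule Th_Th[OF sentA])
  moreover have "consistent (Th A)"
    unfolding consistent_def
  proof
    assume bot: "Th A \<turnstile> \<^bold>\<bottom>"
    have A: "sat MS e0 q" if "q \<in> A" for q using that MS by (auto simp: A_def S_def)
    have "sat MS e0 \<^bold>\<bottom>"
    proof (rule soundness[OF bot is_struct_MS e0])
      fix q assume "q \<in> Th A"
      then have "A \<turnstile> q" by (simp add: Th_def)
      from soundness[OF this is_struct_MS e0 A] show "sat MS e0 q" .
    qed
    then show False by simp
  qed
  \<comment> \<open>In every model of \<Phi>, \<open>p\<close> is equivalent to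
    \<open>sigma ll_fm p\<close>, which belongs to \<open>S\<close> as soon as \<open>p\<close>
    holds in \<open>MS\<close>.\<close>
  moreover have decide: "Th A \<turnstile> p" if p: "sentence p" "sat MS e0 p" for p
  proof (rule ThA[OF p(1)])
    fix N :: "tm set struct" and e
    assume N: "is_struct N" "range e \<subseteq> carr N" "\<And>q. q \<in> A \<Longrightarrow> sat N e q"
    have "sentence (sigma ll_fm p)" by (rule sentence_sigma[OF free_bound_ll_fm p(1)])
    moreover have "Sigma1 (sigma ll_fm p)" by (rule Sigma1_sigma[OF Delta0_ll_fm])
    moreover have "sat MS e0 (sigma ll_fm p)"
      using sat_sigma_ll[OF is_struct_MS s_homogeneous_MS p(1)] p(2) by simp
    ultimately have "sat N e (sigma ll_fm p)" using N(3) by (simp add: A_def S_def)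
    moreover have "s_homogeneous N" using N(3)[of \<Phi>] sat\<Phi>[OF N(1)] by (simp add: A_def)
    ultimately show "sat N e p" using sat_sigma_ll[OF N(1) _ p(1)] by simp
  qed
  have "complete_theory (Th A)"
    unfolding complete_theory_def
  proof (intro allI impI)
    fix p assume p: "sentence p"
    then have "sentence (\<^bold>\<not> p)" by (simp add: sentence_def)
    then show "(Th A \<turnstile> p) \<or> (Th A \<turnstile> \<^bold>\<not> p)" using decide p by (cases "sat MS e0 p") simp_all
  qed
  moreover have "Th (PA_minus_axioms \<union> Coll_axioms) \<subseteq> Th A"
  proof
    fix p assume "p \<in> Th (PA_minus_axioms \<union> Coll_axioms)"
    then have p: "sentence p" "PA_minus_axioms \<union> Coll_axioms \<turnstile> p" by (simp_all add: Th_def)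
    have "A \<turnstile> p"
    proof (rule completeness[OF sentA p(1)])
      fix N :: "tm set struct" and e
      assume N: "is_struct N" "range e \<subseteq> carr N" "\<And>q. q \<in> A \<Longrightarrow> sat N e q"
      have *: "(\<forall>p\<in>PA_minus_axioms. sat N e p) \<and> s_homogeneous N"
        using N(3)[of \<Phi>] sat\<Phi>[OF N(1)] by (simp add: A_def)
      show "sat N e p"
        by (rule soundness[OF p(2) N(1,2)]) (use * sat_Coll_axioms[OF N(1) _ N(2)] in blast)
    qed
    then show "p \<in> Th A" using p(1) by (simp add: Th_def)
  qed
  ultimately have "completion_of (Th (PA_minus_axioms \<union> Coll_axioms)) (Th A)"
    by (simp add: completion_of_def)
  moreover have "axiomatised_by (Th A) ({\<Phi>} \<union> S)"
    unfolding axiomatised_by_def using sentA by (simp add: A_def)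
  moreover have "\<forall>p\<in>S. sentence p \<and> Sigma1 p" by (simp add: S_def)
  ultimately show ?thesis using sent\<Phi> by blast
qed

end
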